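(* If $\Theta$ is an inner function and $\varphi\in L^2$, then $$\frac{\left\|P_\Theta(\varphi)-\overline{\Theta(0)}\,P_\Theta(\Theta\varphi)\right\|}{(1-|\Theta(0)|^2)^{1/2}} \leq \|A_\varphi\|.$$
   Context: $\mathbb{D}$ is the open unit disk, $\partial\mathbb{D}$ the unit circle, $L^2 = L^2(\partial\mathbb{D},\frac{|d\zeta|}{2\pi})$ (complex-valued) with norm $\|\cdot\|$. $H^2$ is the Hardy space of $\mathbb{D}$, regarded as a closed subspace of $L^2$ via non-tangential boundary values, and $H^\infty$ is the set of bounded analytic functions on $\mathbb{D}$. An inner function $\Theta$ is an element of $H^\infty$ with $|\Theta|=1$ a.e. on $\partial\mathbb{D}$. The model space is $K_\Theta := H^2\cap(\Theta H^2)^\perp$, $P_\Theta$ is the orthogonal projection of $L^2$ onto $K_\Theta$, and $K_\Theta^\infty := H^\infty\cap K_\Theta$, which is dense in $K_\Theta$. For $\varphi\in L^2$ the truncated Toeplitz operator is the densely defined operator $A_\varphi f := P_\Theta(\varphi f)$, $f\in K_\Theta^\infty$, and $\|A_\varphi\| := \sup\{\|A_\varphi f\| : f\in K_\Theta^\infty,\ \|f\|=1\}$, which is finite if and only if $A_\varphi$ extends to a bounded operator on $K_\Theta$. *)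

theory Defs
  imports "HOL-Complex_Analysis.Complex_Analysis"
begin

text \<open>Elements of \<open>L\<^sup>2\<close> are represented by functions \<open>complex \<Rightarrow> complex\<close>; two representatives of
  the same class agree almost everywhere. The notions below that concern \<open>L\<^sup>2\<close> do not depend on the representative.\<close>

text \<open>Normalized arc length on the unit circle, as a measure on the whole plane. The completion makes
  every subset of the complement of the circle measurable (and null), so functions need only be
  controlled on the circle.\<close>

definition circle_measure :: "complex measure" where
  "circle_measure = completion (distr (uniform_measure lborel {0..2 * pi}) borel cis)"

definition L2 :: "(complex \<Rightarrow> complex) set" where
  "L2 = {f \<in> borel_measurable circle_measure. integrable circle_measure (\<lambda>\<zeta>. (cmod (f \<zeta>))\<^sup>2)}"

definition l2_inner :: "(complex \<Rightarrow> complex) \<Rightarrow> (complex \<Rightarrow> complex) \<Rightarrow> complex" where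
  "l2_inner f g = (\<integral>\<zeta>. f \<zeta> * cnj (g \<zeta>) \<partial>circle_measure)"

definition l2_norm :: "(complex \<Rightarrow> complex) \<Rightarrow> real" where
  "l2_norm f = sqrt (\<integral>\<zeta>. (cmod (f \<zeta>))\<^sup>2 \<partial>circle_measure)"

definition l2_perp :: "(complex \<Rightarrow> complex) set \<Rightarrow> (complex \<Rightarrow> complex) set" where
  "l2_perp S = {f \<in> L2. \<forall>g\<in>S. l2_inner f g = 0}"

text \<open>The orthogonal projection onto \<open>S\<close>, determined up to equality almost everywhere when \<open>S\<close> is a
  closed subspace.\<close>

definition l2_proj :: "(complex \<Rightarrow> complex) set \<Rightarrow> (complex \<Rightarrow> complex) \<Rightarrow> complex \<Rightarrow> complex" where
  "l2_proj S f = (SOME g. g \<in> S \<and> (\<lambda>\<zeta>. f \<zeta> - g \<zeta>) \<in> l2_perp S)"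

definition stolz_region :: "real \<Rightarrow> complex \<Rightarrow> complex set" where
  "stolz_region \<alpha> \<zeta> = {z \<in> ball 0 1. cmod (z - \<zeta>) < \<alpha> * (1 - cmod z)}"

definition nontangential_limit :: "(complex \<Rightarrow> complex) \<Rightarrow> complex \<Rightarrow> complex \<Rightarrow> bool" where
  "nontangential_limit f \<zeta> w \<longleftrightarrow> (\<forall>\<alpha>>1. (f \<longlongrightarrow> w) (at \<zeta> within stolz_region \<alpha> \<zeta>))"

text \<open>The default value 0 is used only where the non-tangential limit fails to exist.\<close>

definition boundary_fun :: "(complex \<Rightarrow> complex) \<Rightarrow> complex \<Rightarrow> complex" where
  "boundary_fun f \<zeta> =
     (if \<exists>w. nontangential_limit f \<zeta> w then THE w. nontangential_limit f \<zeta> w else 0)"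

definition has_boundary_values :: "(complex \<Rightarrow> complex) \<Rightarrow> (complex \<Rightarrow> complex) \<Rightarrow> bool" where
  "has_boundary_values f g \<longleftrightarrow> (AE \<zeta> in circle_measure. nontangential_limit f \<zeta> (g \<zeta>))"

text \<open>\<open>hardy2_disk\<close> and \<open>hardy_inf_disk\<close> consist of functions on the disk (their values off the disk
  are irrelevant); \<open>hardy2\<close> is the corresponding subspace of \<open>L\<^sup>2\<close>.\<close>

definition hardy2_disk :: "(complex \<Rightarrow> complex) set" where
  "hardy2_disk = {f. f holomorphic_on ball 0 1 \<and>
     bdd_above ((\<lambda>r. \<integral>\<zeta>. (cmod (f (of_real r * \<zeta>)))\<^sup>2 \<partial>circle_measure) ` {0..<1})}"

definition hardy_inf_disk :: "(complex \<Rightarrow> complex) set" where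
  "hardy_inf_disk = {f. f holomorphic_on ball 0 1 \<and> bounded (f ` ball 0 1)}"

definition hardy2 :: "(complex \<Rightarrow> complex) set" where
  "hardy2 = {g \<in> L2. \<exists>f\<in>hardy2_disk. has_boundary_values f g}"

definition inner_function :: "(complex \<Rightarrow> complex) \<Rightarrow> bool" where
  "inner_function \<Theta> \<longleftrightarrow>
     \<Theta> \<in> hardy_inf_disk \<and> (AE \<zeta> in circle_measure. cmod (boundary_fun \<Theta> \<zeta>) = 1)"

definition model_space :: "(complex \<Rightarrow> complex) \<Rightarrow> (complex \<Rightarrow> complex) set" where
  "model_space \<Theta> = hardy2 \<inter> l2_perp ((\<lambda>h \<zeta>. boundary_fun \<Theta> \<zeta> * h \<zeta>) ` hardy2)"

definition model_space_inf :: "(complex \<Rightarrow> complex) \<Rightarrow> (complex \<Rightarrow> complex) set" where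
  "model_space_inf \<Theta> = {g \<in> model_space \<Theta>. \<exists>f\<in>hardy_inf_disk. has_boundary_values f g}"

definition model_proj :: "(complex \<Rightarrow> complex) \<Rightarrow> (complex \<Rightarrow> complex) \<Rightarrow> complex \<Rightarrow> complex" where
  "model_proj \<Theta> = l2_proj (model_space \<Theta>)"

text \<open>The operator is only used on the domain \<open>model_space_inf \<Theta>\<close>.\<close>

definition truncated_toeplitz ::
    "(complex \<Rightarrow> complex) \<Rightarrow> (complex \<Rightarrow> complex) \<Rightarrow> (complex \<Rightarrow> complex) \<Rightarrow> complex \<Rightarrow> complex" where
  "truncated_toeplitz \<Theta> \<phi> f = model_proj \<Theta> (\<lambda>\<zeta>. \<phi> \<zeta> * f \<zeta>)"

text \<open>The supremum is infinite exactly when the operator is unbounded, and it is 0 when the model space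
  is trivial.\<close>

definition truncated_toeplitz_norm ::
    "(complex \<Rightarrow> complex) \<Rightarrow> (complex \<Rightarrow> complex) \<Rightarrow> ennreal" where
  "truncated_toeplitz_norm \<Theta> \<phi> =
     (SUP f\<in>{f \<in> model_space_inf \<Theta>. l2_norm f = 1}. ennreal (l2_norm (truncated_toeplitz \<Theta> \<phi> f)))"

end

theory Submission
  imports Defs
begin

text \<open>
  The reproducing kernel of the model space at the origin, \<open>k = 1 - cnj (\<Theta> 0) * \<Theta>\<close>, is bounded and
  has squared norm \<open>1 - \<bar>\<Theta> 0\<bar>\<^sup>2\<close>. The truncated Toeplitz operator maps it to
  \<open>P (\<phi>) - cnj (\<Theta> 0) * P (\<Theta> \<phi>)\<close>, so normalizing \<open>k\<close> gives the inequality.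

  The substance is that the projection \<open>P\<close> exists, i.e. that the space of boundary functions of the
  Hardy space is closed in \<open>L\<^sup>2\<close>. It is characterized by the vanishing of the negative Fourier
  coefficients. One inclusion follows from convergence in \<open>L\<^sup>1\<close> of the dilations of an \<open>L\<^sup>2\<close>-bounded
  family that converges almost everywhere. The other is Fatou's theorem: the Cauchy integral of such
  a function is its Poisson integral, and this has a non-tangential limit at every Lebesgue point.
\<close>

section \<open>Normalized arc length\<close>

text \<open>Elements of L^2 are plain functions and \<open>l2_proj\<close> picks an arbitrary
  representative with \<open>SOME\<close>, so the projection is not literally linear. Identities
  about it hold only a.e. and come from uniqueness of the orthogonal decomposition. Existence of
  projections is proved for orthogonal complements \<open>l2_perp S\<close> of arbitrary sets of L^2
  functions, which are automatically closed. The obstacle is that \<open>hardy2\<close> is defined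
  through non-tangential limits of functions on the disk; once it is exhibited as such a complement,
  the model space is one too. The kernel is the natural test function: it is the projection of the
  constant 1, and multiplying its two terms by \<phi> produces exactly the two functions that are
  projected on the left of the inequality. If |\<Theta>(0)| = 1, the kernel vanishes a.e. and cannot
  be normalized; the quotient on the left is then 0 because division by 0 yields 0.\<close>

lemma space_circle_measure [simp]: "space circle_measure = UNIV"
  by (simp add: circle_measure_def)

lemma borel_measurable_circle:
  fixes f :: "complex \<Rightarrow> 'a::topological_space"
  assumes "f \<in> borel_measurable borel"
  shows "f \<in> borel_measurable circle_measure"
  unfolding circle_measure_def by (rule measurable_completion) (use assms in simp)

lemma borel_measurable_cis [measurable]: "cis \<in> borel_measurable borel"
  by (intro borel_measurable_continuous_onI continuous_intros)

lemma emeasure_circle_UNIV: "emeasure circle_measure UNIV = 1"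
  by (simp add: circle_measure_def emeasure_distr emeasure_lborel_Icc ennreal_divide_self)

interpretation circle: finite_measure circle_measure
  by standard (simp add: emeasure_circle_UNIV)

lemma measure_circle_UNIV [simp]: "measure circle_measure UNIV = 1"
  by (simp add: measure_def emeasure_circle_UNIV)

lemma nn_integral_circle:
  assumes "f \<in> borel_measurable borel"
  shows "(\<integral>\<^sup>+\<zeta>. f \<zeta> \<partial>circle_measure)
    = (\<integral>\<^sup>+t. f (cis t) * indicator {0..2 * pi} t \<partial>lborel) / ennreal (2 * pi)"
  unfolding circle_measure_def
  using assms by (simp add: nn_integral_completion nn_integral_distr nn_integral_uniform_measure)

lemma Arg2pi_cis: "0 \<le> t \<Longrightarrow> t < 2 * pi \<Longrightarrow> Arg2pi (cis t) = t"
  by (rule Arg2pi_unique[of 1]) (auto simp: cis_conv_exp)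

text \<open>The exceptional null set of parameters is pulled back along \<open>Arg2pi\<close>, the
  inverse of \<open>cis\<close> on the open interval. Since \<open>P\<close> may be nonmeasurable,
  the proof exhibits a Borel null set containing every point of failure: the pullback, the branch
  cut of \<open>Arg2pi\<close>, and the complement of the circle.\<close>

lemma AE_circleI:
  assumes "AE t in lborel. t \<in> {0<..<2 * pi} \<longrightarrow> P (cis t)"
  shows "AE \<zeta> in circle_measure. P \<zeta>"
proof -
  obtain N where N: "N \<in> null_sets lborel" "\<And>t. t \<in> {0<..<2 * pi} \<Longrightarrow> \<not> P (cis t) \<Longrightarrow> t \<in> N"
    using assms unfolding eventually_ae_filter by auto
  \<comment> \<open>The branch cut of \<open>Arg2pi\<close>. It meets the circle only at 1, which is
    the image of both endpoints 0 and 2 pi; this is why the open interval suffices.\<close>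
  define R where "R = {z :: complex. 0 \<le> Re z \<and> Im z = 0}"
  have R: "closed R"
    unfolding R_def by (intro closed_Collect_conj closed_Collect_le closed_Collect_eq continuous_intros)
  have "continuous_on (- R) Arg2pi"
  proof (rule continuous_at_imp_continuous_on, safe)
    fix z :: complex assume "z \<notin> R"
    then have "z \<notin> \<real>\<^sub>\<ge>\<^sub>0"
      by (auto simp: R_def complex_nonneg_Reals_iff)
    then show "isCont Arg2pi z"
      by (rule continuous_at_Arg2pi)
  qed
  then have "(\<lambda>z. if z \<in> - R then Arg2pi z else 0) \<in> borel_measurable borel"
    using R by (intro borel_measurable_continuous_on_if) auto
  moreover have "N \<in> sets borel"
    using N by auto
  ultimately have m: "(\<lambda>z. if z \<in> - R then Arg2pi z else 0) -` N \<inter> space borel \<in> sets borel"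
    by (rule measurable_sets)
  define B where "B = ((\<lambda>z. if z \<in> - R then Arg2pi z else 0) -` N) \<union> R \<union> - sphere 0 1"
  have B: "B \<in> sets borel"
    using m R unfolding B_def by auto
  have arg: "Arg2pi (cis t) = t" if "t \<in> {0<..<2 * pi}" for t
    using that by (simp add: Arg2pi_cis)
  have cisR: "cis t \<notin> R" if "t \<in> {0<..<2 * pi}" for t
  proof
    assume "cis t \<in> R"
    then have "0 \<le> cos t" "sin t = 0" by (auto simp: R_def)
    then have "cos t = 1"
      using sin_cos_squared_add[of t] by (auto simp: power2_eq_1_iff)
    then have "cis t = 1" using \<open>sin t = 0\<close> by (simp add: complex_eq_iff)
    then have "Arg2pi 1 = t" using arg[OF that] by simp
    moreover have "Arg2pi 1 = 0" by (rule Arg2pi_unique[of 1]) auto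
    ultimately show False using that by simp
  qed
  have "AE t in lborel. t \<in> {0..2 * pi} \<longrightarrow> cis t \<notin> B"
    using AE_not_in[OF N(1)] AE_lborel_singleton[of 0] AE_lborel_singleton[of "2 * pi"]
    by eventually_elim (use arg cisR in \<open>auto simp: B_def\<close>)
  then have "AE t in uniform_measure lborel {0..2 * pi}. cis t \<notin> B"
    by (intro AE_uniform_measureI) auto
  then have *: "AE \<zeta> in circle_measure. \<zeta> \<notin> B"
    unfolding circle_measure_def by (intro AE_completion) (subst AE_distr_iff, use B in auto)
  have P: "P \<zeta>" if "\<zeta> \<notin> B" for \<zeta>
  proof (rule ccontr)
    assume "\<not> P \<zeta>"
    have z: "\<zeta> \<notin> R" "cmod \<zeta> = 1" "Arg2pi \<zeta> \<notin> N"
      using that by (auto simp: B_def)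
    have cis: "cis (Arg2pi \<zeta>) = \<zeta>"
      using z(2) complex_norm_eq_1_exp[of \<zeta>] by (simp add: cis_conv_exp)
    have "Arg2pi \<zeta> \<noteq> 0"
    proof
      assume "Arg2pi \<zeta> = 0"
      then have "\<zeta> = 1" using cis by simp
      then show False using z by (simp add: R_def)
    qed
    then have "Arg2pi \<zeta> \<in> {0<..<2 * pi}"
      using Arg2pi[of \<zeta>] by (auto simp: less_le)
    then show False
      using N(2)[of "Arg2pi \<zeta>"] \<open>\<not> P \<zeta>\<close> z(3) cis by simp
  qed
  show ?thesis using * by eventually_elim (rule P)
qed

lemma AE_circle_norm: "AE \<zeta> in circle_measure. cmod \<zeta> = 1"
  by (rule AE_circleI) auto

lemma integral_circle:
  fixes f :: "complex \<Rightarrow> complex"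
  assumes "f \<in> borel_measurable borel"
  shows "(\<integral>\<zeta>. f \<zeta> \<partial>circle_measure) = (\<integral>t. indicator {0..2 * pi} t *\<^sub>R f (cis t) \<partial>lborel) / (2 * pi)"
proof -
  have "(\<integral>\<zeta>. f \<zeta> \<partial>circle_measure) = (\<integral>t. f (cis t) \<partial>uniform_measure lborel {0..2 * pi})"
    unfolding circle_measure_def using assms by (simp add: integral_completion integral_distr)
  also have "uniform_measure lborel {0..2 * pi}
    = density lborel (\<lambda>t. ennreal (indicator {0..2 * pi} t / (2 * pi)))"
    unfolding uniform_measure_def
    by (rule density_cong) (auto simp: divide_ennreal[symmetric] indicator_def)
  also have "(\<integral>t. f (cis t) \<partial>\<dots>) = (\<integral>t. (indicator {0..2 * pi} t / (2 * pi)) *\<^sub>R f (cis t) \<partial>lborel)"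
    using assms by (intro integral_density) (auto)
  also have "\<dots> = (\<integral>t. (indicator {0..2 * pi} t *\<^sub>R f (cis t)) / (2 * pi) \<partial>lborel)"
    by (intro Bochner_Integration.integral_cong) (auto simp: scaleR_conv_of_real split: split_indicator)
  also have "\<dots> = (\<integral>t. indicator {0..2 * pi} t *\<^sub>R f (cis t) \<partial>lborel) / (2 * pi)"
    by simp
  finally show ?thesis .
qed

lemma integral_circle_power:
  assumes "n > 0"
  shows "(\<integral>\<zeta>. \<zeta> ^ n \<partial>circle_measure) = 0"
proof -
  have "set_lebesgue_integral lborel {0..2 * pi} (\<lambda>t. cis (real n * t))
    = cis (real n * (2 * pi)) / (\<i> * n) - cis (real n * 0) / (\<i> * n)"
    unfolding set_lebesgue_integral_def
  proof (rule integral_FTC_Icc)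
    show "((\<lambda>t. cis (real n * t) / (\<i> * n)) has_vector_derivative cis (real n * t)) (at t within {0..2 * pi})" for t
    proof -
      have "((\<lambda>t. exp (\<i> * of_real (real n * t)) / (\<i> * n)) has_vector_derivative exp (\<i> * of_real (real n * t))) (at t within {0..2 * pi})"
        using assms by (auto intro!: derivative_eq_intros has_vector_derivative_real_field
            simp: mult_ac)
      then show ?thesis by (simp add: cis_conv_exp)
    qed
    show "continuous_on {0..2 * pi} (\<lambda>t. cis (real n * t))" by (intro continuous_intros)
  qed simp
  also have "cis (real n * (2 * pi)) = 1"
    using cis_multiple_2pi[of "real n"] by (simp add: mult_ac)
  finally have "set_lebesgue_integral lborel {0..2 * pi} (\<lambda>t. cis (real n * t)) = 0" by simp
  then show ?thesis
    by (subst integral_circle) (auto simp: Complex.DeMoivre set_lebesgue_integral_def)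
qed

text \<open>The completed measure admits non-Borel functions, while the passage to the parameter
  interval and the differentiation theory are carried out for Borel ones. Real and imaginary parts
  are replaced separately.\<close>

lemma borel_version_circle:
  fixes g :: "complex \<Rightarrow> complex"
  assumes "g \<in> borel_measurable circle_measure"
  obtains g' where "g' \<in> borel_measurable borel" "AE \<zeta> in circle_measure. g \<zeta> = g' \<zeta>"
proof -
  let ?D = "distr (uniform_measure lborel {0..2 * pi}) borel cis"
  obtain u v where uv: "u \<in> borel_measurable ?D" "v \<in> borel_measurable ?D"
      "AE x in ?D. Re (g x) = u x" "AE x in ?D. Im (g x) = v x"
    using completion_ex_borel_measurable_real[of "\<lambda>x. Re (g x)" ?D]
      completion_ex_borel_measurable_real[of "\<lambda>x. Im (g x)" ?D] assms
    unfolding circle_measure_def by auto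
  show ?thesis
  proof
    show "(\<lambda>x. Complex (u x) (v x)) \<in> borel_measurable borel"
      using uv(1,2) unfolding borel_measurable_complex_iff by simp
    have "AE x in circle_measure. Re (g x) = u x" "AE x in circle_measure. Im (g x) = v x"
      using uv(3,4) unfolding circle_measure_def by (auto intro: AE_completion)
    then show "AE x in circle_measure. g x = Complex (u x) (v x)"
      by eventually_elim (simp add: complex_eq_iff)
  qed
qed

text \<open>This is where completeness of the measure pays off: preimages under \<open>f\<close> and
  \<open>g\<close> differ by a subset of a null set, and such subsets are measurable.\<close>

lemma measurable_circle_AE:
  fixes f g :: "complex \<Rightarrow> 'a::topological_space"
  assumes "f \<in> borel_measurable circle_measure" "AE \<zeta> in circle_measure. f \<zeta> = g \<zeta>"
  shows "g \<in> borel_measurable circle_measure"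
proof (rule measurableI)
  fix A :: "'a set" assume A: "A \<in> sets borel"
  have f: "f -` A \<inter> space circle_measure \<in> sets circle_measure"
    using assms(1) A by (rule measurable_sets)
  have "AE \<zeta> in circle_measure. \<zeta> \<in> f -` A \<inter> space circle_measure \<longleftrightarrow> \<zeta> \<in> g -` A \<inter> space circle_measure"
    using assms(2) by eventually_elim simp
  from completion.in_sets_AE[OF this[unfolded circle_measure_def] f[unfolded circle_measure_def]]
  show "g -` A \<inter> space circle_measure \<in> sets circle_measure"
    unfolding circle_measure_def by blast
qed simp

section \<open>The space of square integrable functions\<close>

lemma borel_measurable_cnj [measurable]: "cnj \<in> borel_measurable borel"
  by (intro borel_measurable_continuous_onI continuous_intros)

lemma L2_measurable: "f \<in> L2 \<Longrightarrow> f \<in> borel_measurable circle_measure"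
  by (simp add: L2_def)

lemma L2_integrable_square: "f \<in> L2 \<Longrightarrow> integrable circle_measure (\<lambda>\<zeta>. (cmod (f \<zeta>))\<^sup>2)"
  by (simp add: L2_def)

lemma L2_cong_AE:
  assumes "f \<in> L2" "AE \<zeta> in circle_measure. f \<zeta> = g \<zeta>"
  shows "g \<in> L2"
proof -
  have m: "g \<in> borel_measurable circle_measure"
    using measurable_circle_AE[OF L2_measurable[OF assms(1)] assms(2)] .
  have "integrable circle_measure (\<lambda>\<zeta>. (cmod (f \<zeta>))\<^sup>2) \<longleftrightarrow> integrable circle_measure (\<lambda>\<zeta>. (cmod (g \<zeta>))\<^sup>2)"
    using m L2_measurable[OF assms(1)]
    by (intro integrable_cong_AE) (auto intro: eventually_mono[OF assms(2)])
  with m show ?thesis using assms(1) by (simp add: L2_def)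
qed

lemma l2_norm_cong_AE:
  assumes "f \<in> L2" "AE \<zeta> in circle_measure. f \<zeta> = g \<zeta>"
  shows "l2_norm f = l2_norm g"
proof -
  have "(\<integral>\<zeta>. (cmod (f \<zeta>))\<^sup>2 \<partial>circle_measure) = (\<integral>\<zeta>. (cmod (g \<zeta>))\<^sup>2 \<partial>circle_measure)"
    using L2_measurable[OF assms(1)] L2_measurable[OF L2_cong_AE[OF assms]]
    by (intro integral_cong_AE) (auto intro: eventually_mono[OF assms(2)])
  then show ?thesis by (simp add: l2_norm_def)
qed

lemma L2_mult_bounded:
  assumes "f \<in> L2" "h \<in> borel_measurable circle_measure" "AE \<zeta> in circle_measure. cmod (h \<zeta>) \<le> C"
  shows "(\<lambda>\<zeta>. h \<zeta> * f \<zeta>) \<in> L2"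
proof -
  have "integrable circle_measure (\<lambda>\<zeta>. (cmod (h \<zeta> * f \<zeta>))\<^sup>2)"
  proof (rule Bochner_Integration.integrable_bound)
    show "integrable circle_measure (\<lambda>\<zeta>. C\<^sup>2 * (cmod (f \<zeta>))\<^sup>2)"
      using L2_integrable_square[OF assms(1)] by simp
    show "AE \<zeta> in circle_measure. norm ((cmod (h \<zeta> * f \<zeta>))\<^sup>2) \<le> norm (C\<^sup>2 * (cmod (f \<zeta>))\<^sup>2)"
      using assms(3)
    proof eventually_elim
      case (elim \<zeta>)
      then have "(cmod (h \<zeta>))\<^sup>2 \<le> C\<^sup>2" by (intro power_mono) auto
      then show ?case by (simp add: norm_mult power_mult_distrib mult_right_mono)
    qed
  qed (use assms L2_measurable[OF assms(1)] in measurable)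
  then show ?thesis
    using assms L2_measurable[OF assms(1)] by (auto simp: L2_def)
qed

lemma L2_bounded:
  assumes "h \<in> borel_measurable circle_measure" "AE \<zeta> in circle_measure. cmod (h \<zeta>) \<le> C"
  shows "h \<in> L2"
proof -
  have "(\<lambda>_. 1) \<in> L2" by (simp add: L2_def)
  from L2_mult_bounded[OF this assms] show ?thesis by simp
qed

lemma L2_const [simp]: "(\<lambda>_. c) \<in> L2"
  by (simp add: L2_def)

lemma L2_scale: "f \<in> L2 \<Longrightarrow> (\<lambda>\<zeta>. c * f \<zeta>) \<in> L2"
  by (rule L2_mult_bounded[of _ _ "cmod c"]) auto

lemma L2_add:
  assumes "f \<in> L2" "g \<in> L2"
  shows "(\<lambda>\<zeta>. f \<zeta> + g \<zeta>) \<in> L2"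
proof -
  note [measurable] = L2_measurable[OF assms(1)] L2_measurable[OF assms(2)]
  have "integrable circle_measure (\<lambda>\<zeta>. (cmod (f \<zeta> + g \<zeta>))\<^sup>2)"
  proof (rule Bochner_Integration.integrable_bound)
    show "integrable circle_measure (\<lambda>\<zeta>. 2 * (cmod (f \<zeta>))\<^sup>2 + 2 * (cmod (g \<zeta>))\<^sup>2)"
      using assms by (simp add: L2_def)
    show "AE \<zeta> in circle_measure. norm ((cmod (f \<zeta> + g \<zeta>))\<^sup>2) \<le> norm (2 * (cmod (f \<zeta>))\<^sup>2 + 2 * (cmod (g \<zeta>))\<^sup>2)"
    proof (intro AE_I2)
      fix \<zeta>
      have "(cmod (f \<zeta> + g \<zeta>))\<^sup>2 \<le> (cmod (f \<zeta>) + cmod (g \<zeta>))\<^sup>2"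
        by (intro power_mono norm_triangle_ineq) auto
      also have "\<dots> \<le> 2 * (cmod (f \<zeta>))\<^sup>2 + 2 * (cmod (g \<zeta>))\<^sup>2"
        using sum_squares_bound[of "cmod (f \<zeta>)" "cmod (g \<zeta>)"] by (simp add: power2_sum)
      finally show "norm ((cmod (f \<zeta> + g \<zeta>))\<^sup>2) \<le> norm (2 * (cmod (f \<zeta>))\<^sup>2 + 2 * (cmod (g \<zeta>))\<^sup>2)" by simp
    qed
  qed measurable
  then show ?thesis by (simp add: L2_def)
qed

lemma L2_diff: "f \<in> L2 \<Longrightarrow> g \<in> L2 \<Longrightarrow> (\<lambda>\<zeta>. f \<zeta> - g \<zeta>) \<in> L2"
  using L2_add[OF _ L2_scale[of g "-1"], of f] by simp

lemma L2_norm_fun: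
  assumes "f \<in> L2"
  shows "(\<lambda>\<zeta>. complex_of_real (cmod (f \<zeta>))) \<in> L2"
proof -
  have "(\<lambda>\<zeta>. complex_of_real (cmod (f \<zeta>))) \<in> borel_measurable circle_measure"
    using L2_measurable[OF assms] by measurable
  then show ?thesis using L2_integrable_square[OF assms] by (simp add: L2_def)
qed

lemma L2_integrable_mult_cnj:
  assumes "f \<in> L2" "g \<in> L2"
  shows "integrable circle_measure (\<lambda>\<zeta>. f \<zeta> * cnj (g \<zeta>))"
proof (rule Bochner_Integration.integrable_bound)
  note [measurable] = L2_measurable[OF assms(1)] L2_measurable[OF assms(2)]
  show "integrable circle_measure (\<lambda>\<zeta>. (cmod (f \<zeta>))\<^sup>2 + (cmod (g \<zeta>))\<^sup>2)"
    using assms by (simp add: L2_def)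
  show "(\<lambda>\<zeta>. f \<zeta> * cnj (g \<zeta>)) \<in> borel_measurable circle_measure" by measurable
  have "cmod (f \<zeta>) * cmod (g \<zeta>) \<le> (cmod (f \<zeta>))\<^sup>2 + (cmod (g \<zeta>))\<^sup>2" for \<zeta>
    using sum_squares_bound[of "cmod (f \<zeta>)" "cmod (g \<zeta>)"] mult_nonneg_nonneg[OF norm_ge_zero[of "f \<zeta>"] norm_ge_zero[of "g \<zeta>"]]
    by linarith
  then show "AE \<zeta> in circle_measure. norm (f \<zeta> * cnj (g \<zeta>)) \<le> norm ((cmod (f \<zeta>))\<^sup>2 + (cmod (g \<zeta>))\<^sup>2)"
    by (simp add: norm_mult)
qed

lemma L2_integrable: "f \<in> L2 \<Longrightarrow> integrable circle_measure f"
  using L2_integrable_mult_cnj[of f "\<lambda>_. 1"] by simp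

lemma l2_norm_square: "(l2_norm f)\<^sup>2 = (\<integral>\<zeta>. (cmod (f \<zeta>))\<^sup>2 \<partial>circle_measure)"
  by (simp add: l2_norm_def)

lemma l2_norm_nonneg [simp]: "0 \<le> l2_norm f"
  by (simp add: l2_norm_def)

lemma l2_norm_scale: "l2_norm (\<lambda>\<zeta>. c * f \<zeta>) = cmod c * l2_norm f"
  by (simp add: l2_norm_def norm_mult power_mult_distrib real_sqrt_mult)

lemma l2_inner_diff:
  assumes "f \<in> L2" "g \<in> L2" "h \<in> L2"
  shows "l2_inner (\<lambda>\<zeta>. f \<zeta> - g \<zeta>) h = l2_inner f h - l2_inner g h"
  using L2_integrable_mult_cnj[OF assms(1,3)] L2_integrable_mult_cnj[OF assms(2,3)]
  by (simp add: l2_inner_def algebra_simps)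

lemma l2_inner_scale: "l2_inner (\<lambda>\<zeta>. c * f \<zeta>) h = c * l2_inner f h"
  by (simp add: l2_inner_def mult.assoc)

lemma l2_inner_self: "l2_inner f f = of_real ((l2_norm f)\<^sup>2)"
  unfolding l2_inner_def l2_norm_square integral_complex_of_real[symmetric]
  by (simp only: complex_norm_square)

text \<open>The common source of the parallelogram law, Cauchy-Schwarz, the triangle inequality, the
  variational argument for projections and the norm of the kernel; these differ only in the choice
  of \<open>c\<close>.\<close>

lemma l2_norm_diff_square:
  assumes "f \<in> L2" "g \<in> L2"
  shows "(l2_norm (\<lambda>\<zeta>. f \<zeta> - c * g \<zeta>))\<^sup>2
    = (l2_norm f)\<^sup>2 - 2 * Re (cnj c * l2_inner f g) + (cmod c)\<^sup>2 * (l2_norm g)\<^sup>2"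
proof -
  define r where "r \<zeta> = Re (cnj c * (f \<zeta> * cnj (g \<zeta>)))" for \<zeta>
  have i: "integrable circle_measure (\<lambda>\<zeta>. cnj c * (f \<zeta> * cnj (g \<zeta>)))"
    using L2_integrable_mult_cnj[OF assms] by simp
  then have r: "integrable circle_measure r" unfolding r_def by (rule integrable_Re)
  have "(\<integral>\<zeta>. r \<zeta> \<partial>circle_measure) = Re (\<integral>\<zeta>. cnj c * (f \<zeta> * cnj (g \<zeta>)) \<partial>circle_measure)"
    unfolding r_def using i by (rule integral_Re)
  also have "\<dots> = Re (cnj c * l2_inner f g)" by (simp only: l2_inner_def integral_mult_right_zero)
  finally have int_r: "(\<integral>\<zeta>. r \<zeta> \<partial>circle_measure) = Re (cnj c * l2_inner f g)" .
  have eq: "(cmod (f \<zeta> - c * g \<zeta>))\<^sup>2 = (cmod (f \<zeta>))\<^sup>2 - 2 * r \<zeta> + (cmod c)\<^sup>2 * (cmod (g \<zeta>))\<^sup>2" for \<zeta>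
    unfolding cmod_power2 r_def by (simp add: power2_eq_square algebra_simps)
  show ?thesis
    unfolding l2_norm_square eq int_r[symmetric]
    using L2_integrable_square[OF assms(1)] L2_integrable_square[OF assms(2)] r by simp
qed

lemma l2_parallelogram:
  assumes "f \<in> L2" "g \<in> L2"
  shows "(l2_norm (\<lambda>\<zeta>. f \<zeta> - g \<zeta>))\<^sup>2 + (l2_norm (\<lambda>\<zeta>. f \<zeta> + g \<zeta>))\<^sup>2 = 2 * (l2_norm f)\<^sup>2 + 2 * (l2_norm g)\<^sup>2"
  using l2_norm_diff_square[OF assms, of 1] l2_norm_diff_square[OF assms, of "-1"] by simp

lemma l2_Cauchy_Schwarz:
  assumes "f \<in> L2" "g \<in> L2"
  shows "cmod (l2_inner f g) \<le> l2_norm f * l2_norm g"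
proof -
  let ?I = "l2_inner f g"
  \<comment> \<open>The coefficient of \<open>g\<close> is a real multiple of the inner product, so
    that the cross term becomes real and the sign of \<open>t\<close> controls it. The optimal value
    is \<open>t\<close> = 1 / |g|^2.\<close>
  have key: "2 * t * (cmod ?I)\<^sup>2 \<le> (l2_norm f)\<^sup>2 + t\<^sup>2 * (cmod ?I)\<^sup>2 * (l2_norm g)\<^sup>2" for t :: real
  proof -
    have "0 \<le> (l2_norm (\<lambda>\<zeta>. f \<zeta> - (t * ?I) * g \<zeta>))\<^sup>2" by simp
    also have "\<dots> = (l2_norm f)\<^sup>2 - 2 * Re (cnj (t * ?I) * ?I) + (cmod (t * ?I))\<^sup>2 * (l2_norm g)\<^sup>2"
      by (rule l2_norm_diff_square[OF assms])
    also have "Re (cnj (t * ?I) * ?I) = t * (cmod ?I)\<^sup>2"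
      unfolding cmod_power2 by (simp add: power2_eq_square algebra_simps)
    finally show ?thesis by (simp add: norm_mult power_mult_distrib)
  qed
  have "(cmod ?I)\<^sup>2 \<le> (l2_norm f)\<^sup>2 * (l2_norm g)\<^sup>2"
  proof (cases "l2_norm g = 0")
    case True
    have "?I = 0"
    proof (rule ccontr)
      assume "?I \<noteq> 0"
      then have "0 < (cmod ?I)\<^sup>2" by simp
      \<comment> \<open>If |g| = 0 the quadratic term is gone and \<open>key\<close> bounds a linear
        function of \<open>t\<close>. This value of \<open>t\<close> makes the left side 2 (|f|^2 +
        1), which exceeds |f|^2.\<close>
      then have "2 * (((l2_norm f)\<^sup>2 + 1) / (cmod ?I)\<^sup>2) * (cmod ?I)\<^sup>2 = 2 * ((l2_norm f)\<^sup>2 + 1)"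
        by simp
      then have "2 * ((l2_norm f)\<^sup>2 + 1) \<le> (l2_norm f)\<^sup>2"
        using key[of "((l2_norm f)\<^sup>2 + 1) / (cmod ?I)\<^sup>2"] True by simp
      then have "2 * (l2_norm f)\<^sup>2 + 2 \<le> (l2_norm f)\<^sup>2" by (simp add: algebra_simps)
      then show False using zero_le_power2[of "l2_norm f"] by linarith
    qed
    then show ?thesis by simp
  next
    case False
    then have p: "0 < (l2_norm g)\<^sup>2" by simp
    have "(1 / s)\<^sup>2 * x * s = x / s" "2 * (1 / s) * x = x / s + x / s" if "s > 0" for x s :: real
      using that by (simp_all add: power2_eq_square)
    then have "(cmod ?I)\<^sup>2 / (l2_norm g)\<^sup>2 \<le> (l2_norm f)\<^sup>2"
      using key[of "1 / (l2_norm g)\<^sup>2"] p by (smt (verit))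
    then show ?thesis using p by (simp add: pos_divide_le_eq)
  qed
  then have "(cmod ?I)\<^sup>2 \<le> (l2_norm f * l2_norm g)\<^sup>2" by (simp add: power_mult_distrib)
  then show ?thesis by (rule power2_le_imp_le) simp
qed

lemma l2_norm_triangle:
  assumes "f \<in> L2" "g \<in> L2"
  shows "l2_norm (\<lambda>\<zeta>. f \<zeta> + g \<zeta>) \<le> l2_norm f + l2_norm g"
proof -
  have "(l2_norm (\<lambda>\<zeta>. f \<zeta> - (-1) * g \<zeta>))\<^sup>2
      = (l2_norm f)\<^sup>2 - 2 * Re (cnj (-1) * l2_inner f g) + (cmod (-1))\<^sup>2 * (l2_norm g)\<^sup>2"
    by (rule l2_norm_diff_square[OF assms])
  also have "\<dots> \<le> (l2_norm f)\<^sup>2 + 2 * (l2_norm f * l2_norm g) + (l2_norm g)\<^sup>2"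
    using l2_Cauchy_Schwarz[OF assms] complex_Re_le_cmod[of "l2_inner f g"] by simp
  also have "\<dots> = (l2_norm f + l2_norm g)\<^sup>2" by (simp add: power2_sum)
  finally have "(l2_norm (\<lambda>\<zeta>. f \<zeta> + g \<zeta>))\<^sup>2 \<le> (l2_norm f + l2_norm g)\<^sup>2" by simp
  then show ?thesis by (rule power2_le_imp_le) simp
qed

lemma l1_le_l2_norm:
  assumes "f \<in> L2"
  shows "(\<integral>\<zeta>. cmod (f \<zeta>) \<partial>circle_measure) \<le> l2_norm f"
proof -
  have "cmod (l2_inner (\<lambda>\<zeta>. of_real (cmod (f \<zeta>))) (\<lambda>_. 1)) \<le> l2_norm (\<lambda>\<zeta>. of_real (cmod (f \<zeta>))) * l2_norm (\<lambda>_. 1)"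
    by (rule l2_Cauchy_Schwarz) (use assms L2_norm_fun in auto)
  then show ?thesis by (simp add: l2_inner_def l2_norm_def)
qed

section \<open>Limits in L^2 and completeness\<close>

lemma L2_Fatou:
  assumes "\<And>m. u m \<in> L2" "\<And>m. l2_norm (u m) \<le> C" "f \<in> borel_measurable circle_measure"
    and "AE \<zeta> in circle_measure. (\<lambda>m. u m \<zeta>) \<longlonglongrightarrow> f \<zeta>"
  shows "f \<in> L2" "l2_norm f \<le> C"
proof -
  note [measurable] = L2_measurable[OF assms(1)] assms(3)
  have C: "0 \<le> C" using assms(2)[of 0] l2_norm_nonneg[of "u 0"] by linarith
  have "(\<integral>\<^sup>+\<zeta>. ennreal ((cmod (f \<zeta>))\<^sup>2) \<partial>circle_measure)
      = (\<integral>\<^sup>+\<zeta>. liminf (\<lambda>m. ennreal ((cmod (u m \<zeta>))\<^sup>2)) \<partial>circle_measure)"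
  proof (rule nn_integral_cong_AE)
    show "AE \<zeta> in circle_measure. ennreal ((cmod (f \<zeta>))\<^sup>2) = liminf (\<lambda>m. ennreal ((cmod (u m \<zeta>))\<^sup>2))"
      using assms(4)
    proof eventually_elim
      case (elim \<zeta>)
      have "(\<lambda>m. ennreal ((cmod (u m \<zeta>))\<^sup>2)) \<longlonglongrightarrow> ennreal ((cmod (f \<zeta>))\<^sup>2)"
        by (intro tendsto_ennrealI tendsto_intros elim)
      then show ?case using lim_imp_Liminf[OF sequentially_bot] by metis
    qed
  qed
  also have "\<dots> \<le> liminf (\<lambda>m. \<integral>\<^sup>+\<zeta>. ennreal ((cmod (u m \<zeta>))\<^sup>2) \<partial>circle_measure)"
    by (rule nn_integral_liminf) measurable
  also have "\<dots> \<le> liminf (\<lambda>m::nat. ennreal (C\<^sup>2))"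
  proof (intro Liminf_mono always_eventually allI)
    fix m
    have "(\<integral>\<^sup>+\<zeta>. ennreal ((cmod (u m \<zeta>))\<^sup>2) \<partial>circle_measure) = ennreal ((l2_norm (u m))\<^sup>2)"
      unfolding l2_norm_square by (rule nn_integral_eq_integral) (use L2_integrable_square[OF assms(1)] in auto)
    also have "\<dots> \<le> ennreal (C\<^sup>2)" by (intro ennreal_leI power_mono assms(2)) simp
    finally show "(\<integral>\<^sup>+\<zeta>. ennreal ((cmod (u m \<zeta>))\<^sup>2) \<partial>circle_measure) \<le> ennreal (C\<^sup>2)" .
  qed
  finally have le: "(\<integral>\<^sup>+\<zeta>. ennreal ((cmod (f \<zeta>))\<^sup>2) \<partial>circle_measure) \<le> ennreal (C\<^sup>2)"
    by (simp add: Liminf_const)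
  then have i: "integrable circle_measure (\<lambda>\<zeta>. (cmod (f \<zeta>))\<^sup>2)"
    by (intro integrableI_bounded) (auto simp: le_less_trans)
  then show "f \<in> L2" using assms(3) by (simp add: L2_def)
  have "ennreal ((l2_norm f)\<^sup>2) \<le> ennreal (C\<^sup>2)"
    unfolding l2_norm_square using le nn_integral_eq_integral[OF i] by simp
  then have "(l2_norm f)\<^sup>2 \<le> C\<^sup>2" by simp
  then show "l2_norm f \<le> C" using C by (rule power2_le_imp_le)
qed

text \<open>The geometric rate is built into the hypothesis so that no subsequence has to be
  extracted: the L^1 norms of the increments are summable, hence the increments are absolutely
  summable almost everywhere. The rate of convergence to the pointwise limit then follows from
  Fatou's lemma applied to the tails.\<close>

lemma L2_complete:
  fixes f :: "nat \<Rightarrow> complex \<Rightarrow> complex"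
  assumes f: "\<And>n. f n \<in> L2"
    and cauchy: "\<And>m n. n \<le> m \<Longrightarrow> l2_norm (\<lambda>\<zeta>. f n \<zeta> - f m \<zeta>) \<le> (1 / 2) ^ n"
  obtains g where "g \<in> L2" "(\<lambda>n. l2_norm (\<lambda>\<zeta>. f n \<zeta> - g \<zeta>)) \<longlonglongrightarrow> 0"
proof -
  note [measurable] = L2_measurable[OF f]
  have step: "(\<integral>\<^sup>+\<zeta>. ennreal (cmod (f (Suc n) \<zeta> - f n \<zeta>)) \<partial>circle_measure) \<le> ennreal ((1 / 2) ^ n)" for n
  proof -
    have d: "(\<lambda>\<zeta>. f n \<zeta> - f (Suc n) \<zeta>) \<in> L2" by (intro L2_diff f)
    have "(\<integral>\<^sup>+\<zeta>. ennreal (cmod (f (Suc n) \<zeta> - f n \<zeta>)) \<partial>circle_measure)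
        = ennreal (\<integral>\<zeta>. cmod (f n \<zeta> - f (Suc n) \<zeta>) \<partial>circle_measure)"
      by (subst norm_minus_commute, rule nn_integral_eq_integral) (use L2_integrable[OF d] in auto)
    also have "\<dots> \<le> ennreal ((1 / 2) ^ n)"
      using l1_le_l2_norm[OF d] cauchy[of n "Suc n"] by (intro ennreal_leI) auto
    finally show ?thesis .
  qed
  have "(\<integral>\<^sup>+\<zeta>. (\<Sum>n. ennreal (cmod (f (Suc n) \<zeta> - f n \<zeta>))) \<partial>circle_measure)
      = (\<Sum>n. \<integral>\<^sup>+\<zeta>. ennreal (cmod (f (Suc n) \<zeta> - f n \<zeta>)) \<partial>circle_measure)"
    by (rule nn_integral_suminf) measurable
  also have "\<dots> \<le> (\<Sum>n. ennreal ((1 / 2) ^ n))"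
    by (intro suminf_le step) auto
  also have "\<dots> = ennreal 2"
    using power_half_series suminf_geometric[of "1/2::real"] by (subst suminf_ennreal2) (auto simp: summable_geometric)
  finally have "(\<integral>\<^sup>+\<zeta>. (\<Sum>n. ennreal (cmod (f (Suc n) \<zeta> - f n \<zeta>))) \<partial>circle_measure) \<noteq> \<infinity>"
    by (auto simp: top_unique)
  then have "AE \<zeta> in circle_measure. (\<Sum>n. ennreal (cmod (f (Suc n) \<zeta> - f n \<zeta>))) \<noteq> \<infinity>"
    by (rule nn_integral_PInf_AE[rotated]) measurable
  then have conv: "AE \<zeta> in circle_measure. convergent (\<lambda>n. f n \<zeta>)"
  proof eventually_elim
    case (elim \<zeta>)
    then have "summable (\<lambda>n. cmod (f (Suc n) \<zeta> - f n \<zeta>))"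
      by (intro summable_suminf_not_top) auto
    then have "summable (\<lambda>n. f (Suc n) \<zeta> - f n \<zeta>)" by (rule summable_norm_cancel)
    then have "convergent (\<lambda>n. f n \<zeta> - f 0 \<zeta>)"
      unfolding summable_iff_convergent by (simp only: sum_lessThan_telescope[of "\<lambda>n. f n \<zeta>"])
    then show ?case by (simp add: convergent_diff_const_right_iff)
  qed
  define g where "g = (\<lambda>\<zeta>. lim (\<lambda>n. f n \<zeta>))"
  have [measurable]: "g \<in> borel_measurable circle_measure"
    unfolding g_def by measurable
  have lim: "AE \<zeta> in circle_measure. (\<lambda>n. f n \<zeta>) \<longlonglongrightarrow> g \<zeta>"
    using conv by eventually_elim (simp add: g_def convergent_LIMSEQ_iff)
  have *: "(\<lambda>\<zeta>. f n \<zeta> - g \<zeta>) \<in> L2" "l2_norm (\<lambda>\<zeta>. f n \<zeta> - g \<zeta>) \<le> (1 / 2) ^ n" for n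
  proof -
    have "AE \<zeta> in circle_measure. (\<lambda>m. f n \<zeta> - f (m + n) \<zeta>) \<longlonglongrightarrow> f n \<zeta> - g \<zeta>"
      using lim by eventually_elim (intro tendsto_intros LIMSEQ_ignore_initial_segment)
    moreover have "(\<lambda>\<zeta>. f n \<zeta> - f (m + n) \<zeta>) \<in> L2" "l2_norm (\<lambda>\<zeta>. f n \<zeta> - f (m + n) \<zeta>) \<le> (1 / 2) ^ n" for m
      by (rule L2_diff[OF f f]) (rule cauchy, simp)
    moreover have "(\<lambda>\<zeta>. f n \<zeta> - g \<zeta>) \<in> borel_measurable circle_measure" by measurable
    ultimately show "(\<lambda>\<zeta>. f n \<zeta> - g \<zeta>) \<in> L2" "l2_norm (\<lambda>\<zeta>. f n \<zeta> - g \<zeta>) \<le> (1 / 2) ^ n"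
      using L2_Fatou[where u="\<lambda>m \<zeta>. f n \<zeta> - f (m + n) \<zeta>" and C="(1 / 2) ^ n"] by blast+
  qed
  show ?thesis
  proof
    show "g \<in> L2" using L2_diff[OF f *(1), of 0 0] by simp
    show "(\<lambda>n. l2_norm (\<lambda>\<zeta>. f n \<zeta> - g \<zeta>)) \<longlonglongrightarrow> 0"
      by (rule tendsto_sandwich[OF _ _ tendsto_const LIMSEQ_realpow_zero[of "1/2"]])
        (use *(2) in \<open>auto intro!: always_eventually\<close>)
  qed
qed

section \<open>Orthogonal projections\<close>

lemma l2_perp_L2: "f \<in> l2_perp S \<Longrightarrow> f \<in> L2"
  by (simp add: l2_perp_def)

lemma l2_perp_scale: "f \<in> l2_perp S \<Longrightarrow> (\<lambda>\<zeta>. c * f \<zeta>) \<in> l2_perp S"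
  by (auto simp: l2_perp_def L2_scale l2_inner_scale)

lemma l2_perp_diff: "S \<subseteq> L2 \<Longrightarrow> f \<in> l2_perp S \<Longrightarrow> g \<in> l2_perp S \<Longrightarrow> (\<lambda>\<zeta>. f \<zeta> - g \<zeta>) \<in> l2_perp S"
  by (auto simp: l2_perp_def L2_diff l2_inner_diff subset_iff)

lemma l2_perp_add: 
  assumes "S \<subseteq> L2" "f \<in> l2_perp S" "g \<in> l2_perp S"
  shows "(\<lambda>\<zeta>. f \<zeta> + g \<zeta>) \<in> l2_perp S"
  using l2_perp_diff[OF assms(1,2) l2_perp_scale[OF assms(3), of "-1"]] by simp

text \<open>By Cauchy-Schwarz, the inner product with a fixed \<open>h\<close> is continuous along
  the sequence, and it vanishes at every term.\<close>

lemma l2_perp_closed: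
  assumes "S \<subseteq> L2" "\<And>n. f n \<in> l2_perp S" "g \<in> L2" "(\<lambda>n. l2_norm (\<lambda>\<zeta>. f n \<zeta> - g \<zeta>)) \<longlonglongrightarrow> 0"
  shows "g \<in> l2_perp S"
  unfolding l2_perp_def
proof (intro CollectI conjI ballI)
  fix h assume "h \<in> S"
  then have h: "h \<in> L2" using assms by auto
  have le: "cmod (l2_inner g h) \<le> l2_norm (\<lambda>\<zeta>. f n \<zeta> - g \<zeta>) * l2_norm h" for n
  proof -
    have "l2_inner (\<lambda>\<zeta>. f n \<zeta> - g \<zeta>) h = - l2_inner g h"
      using assms(2)[of n] \<open>h \<in> S\<close> l2_inner_diff[OF l2_perp_L2[OF assms(2)] assms(3) h, of n]
      by (simp add: l2_perp_def)
    then show ?thesis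
      using l2_Cauchy_Schwarz[OF L2_diff[OF l2_perp_L2[OF assms(2)] assms(3)] h, of n] by simp
  qed
  have "(\<lambda>n. l2_norm (\<lambda>\<zeta>. f n \<zeta> - g \<zeta>) * l2_norm h) \<longlonglongrightarrow> 0 * l2_norm h"
    by (intro tendsto_intros assms)
  then have "cmod (l2_inner g h) \<le> 0"
    by (intro LIMSEQ_le_const[where X="\<lambda>n. l2_norm (\<lambda>\<zeta>. f n \<zeta> - g \<zeta>) * l2_norm h"]) (use le in auto)
  then show "l2_inner g h = 0" by simp
qed (rule assms)

text \<open>A minimizing sequence for the distance from \<open>\<phi>\<close> is Cauchy by the
  parallelogram law, because midpoints stay in \<open>l2_perp S\<close>. The limit attains the
  minimum, and minimality forces the residual to be orthogonal to all of
  \<open>l2_perp S\<close>.\<close>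

lemma l2_projection_exists:
  assumes S: "S \<subseteq> L2" and \<phi>: "\<phi> \<in> L2"
  shows "\<exists>g. g \<in> l2_perp S \<and> (\<lambda>\<zeta>. \<phi> \<zeta> - g \<zeta>) \<in> l2_perp (l2_perp S)"
proof -
  define D where "D g = (l2_norm (\<lambda>\<zeta>. \<phi> \<zeta> - g \<zeta>))\<^sup>2" for g
  define d where "d = Inf (D ` l2_perp S)"
  have "(\<lambda>_. 0) \<in> l2_perp S" by (simp add: l2_perp_def l2_inner_def)
  then have ne: "D ` l2_perp S \<noteq> {}" by blast
  have bdd: "bdd_below (D ` l2_perp S)" by (rule bdd_belowI[of _ 0]) (auto simp: D_def)
  have d_le: "d \<le> D g" if "g \<in> l2_perp S" for g
    unfolding d_def by (intro cInf_lower bdd imageI that)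
  \<comment> \<open>This tolerance makes the parallelogram law give a squared distance of at most
    4^(-m) / 2 + 4^(-n) / 2, which is at most (2^(-n))^2 for n \<le> m: precisely the rate required
    by \<open>L2_complete\<close>.\<close>
  have "\<exists>g \<in> l2_perp S. D g < d + (1 / 4) ^ n / 4" for n
    using cInf_lessD[OF ne, of "d + (1 / 4) ^ n / 4"] by (auto simp: d_def)
  then obtain f where f: "\<And>n. f n \<in> l2_perp S" "\<And>n. D (f n) < d + (1 / 4) ^ n / 4"
    by metis
  have diff: "(\<lambda>\<zeta>. \<phi> \<zeta> - g \<zeta>) \<in> L2" if "g \<in> l2_perp S" for g
    by (intro L2_diff \<phi> l2_perp_L2[OF that])
  have cauchy: "l2_norm (\<lambda>\<zeta>. f n \<zeta> - f m \<zeta>) \<le> (1 / 2) ^ n" if "n \<le> m" for m n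
  proof -
    let ?mid = "\<lambda>\<zeta>. (1 / 2) * (f n \<zeta> + f m \<zeta>)"
    have mid: "?mid \<in> l2_perp S"
      by (intro l2_perp_scale l2_perp_add S f)
    have "(l2_norm (\<lambda>\<zeta>. (\<phi> \<zeta> - f m \<zeta>) - (\<phi> \<zeta> - f n \<zeta>)))\<^sup>2 + (l2_norm (\<lambda>\<zeta>. (\<phi> \<zeta> - f m \<zeta>) + (\<phi> \<zeta> - f n \<zeta>)))\<^sup>2
      = 2 * D (f m) + 2 * D (f n)"
      unfolding D_def by (intro l2_parallelogram diff f)
    also have "(\<lambda>\<zeta>. (\<phi> \<zeta> - f m \<zeta>) + (\<phi> \<zeta> - f n \<zeta>)) = (\<lambda>\<zeta>. 2 * (\<phi> \<zeta> - ?mid \<zeta>))"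
      by (auto simp: fun_eq_iff algebra_simps)
    also have "(l2_norm (\<lambda>\<zeta>. 2 * (\<phi> \<zeta> - ?mid \<zeta>)))\<^sup>2 = 4 * D ?mid"
      by (simp only: l2_norm_scale D_def) (simp add: power_mult_distrib)
    finally have "(l2_norm (\<lambda>\<zeta>. f n \<zeta> - f m \<zeta>))\<^sup>2 = 2 * D (f m) + 2 * D (f n) - 4 * D ?mid"
      by simp
    also have "\<dots> \<le> (1 / 4) ^ m / 2 + (1 / 4) ^ n / 2"
      using f(2)[of m] f(2)[of n] d_le[OF mid] by linarith
    also have "\<dots> \<le> (1 / 4) ^ n"
    proof -
      have "(1 / 4 :: real) ^ m \<le> (1 / 4) ^ n" by (rule power_decreasing[OF that]) auto
      then show ?thesis by linarith
    qed
    also have "\<dots> = ((1 / 2) ^ n)\<^sup>2" by (simp add: power2_eq_square power_mult_distrib[symmetric])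
    finally show ?thesis by (rule power2_le_imp_le) simp
  qed
  obtain g where g: "g \<in> L2" "(\<lambda>n. l2_norm (\<lambda>\<zeta>. f n \<zeta> - g \<zeta>)) \<longlonglongrightarrow> 0"
    using L2_complete[OF l2_perp_L2[OF f(1)] cauchy] by blast
  have gS: "g \<in> l2_perp S"
    by (rule l2_perp_closed[OF S f(1) g])
  have "l2_inner (\<lambda>\<zeta>. \<phi> \<zeta> - g \<zeta>) u = 0" if u: "u \<in> l2_perp S" for u
  proof -
    let ?I = "l2_inner (\<lambda>\<zeta>. \<phi> \<zeta> - g \<zeta>) u"
    have uL: "u \<in> L2" using u by (rule l2_perp_L2)
    have key: "D g \<le> d"
    proof (rule LIMSEQ_le_const[where X="\<lambda>n. (sqrt (d + (1 / 4) ^ n / 4) + l2_norm (\<lambda>\<zeta>. f n \<zeta> - g \<zeta>))\<^sup>2"])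
      have d0: "0 \<le> d" unfolding d_def by (rule cInf_greatest[OF ne]) (auto simp: D_def)
      have "(\<lambda>n. (sqrt (d + (1 / 4) ^ n / 4) + l2_norm (\<lambda>\<zeta>. f n \<zeta> - g \<zeta>))\<^sup>2) \<longlonglongrightarrow> (sqrt (d + 0 / 4) + 0)\<^sup>2"
        by (intro tendsto_intros g LIMSEQ_realpow_zero) auto
      then show "(\<lambda>n. (sqrt (d + (1 / 4) ^ n / 4) + l2_norm (\<lambda>\<zeta>. f n \<zeta> - g \<zeta>))\<^sup>2) \<longlonglongrightarrow> d"
        using d0 by simp
      have "D g \<le> (sqrt (d + (1 / 4) ^ n / 4) + l2_norm (\<lambda>\<zeta>. f n \<zeta> - g \<zeta>))\<^sup>2" for n
      proof -
        let ?a = "\<lambda>\<zeta>. \<phi> \<zeta> - f n \<zeta>" and ?b = "\<lambda>\<zeta>. f n \<zeta> - g \<zeta>"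
        have ab: "?a \<in> L2" "?b \<in> L2" using diff f L2_diff l2_perp_L2 g by blast+
        have "D g \<le> (l2_norm ?a + l2_norm ?b)\<^sup>2"
          using l2_norm_triangle[OF ab] by (simp add: D_def)
        also have "\<dots> \<le> (sqrt (d + (1 / 4) ^ n / 4) + l2_norm ?b)\<^sup>2"
          using f(2)[of n] by (intro power_mono add_mono real_le_rsqrt) (auto simp: D_def)
        finally show ?thesis .
      qed
      then show "\<exists>N. \<forall>n\<ge>N. D g \<le> (sqrt (d + (1 / 4) ^ n / 4) + l2_norm (\<lambda>\<zeta>. f n \<zeta> - g \<zeta>))\<^sup>2" by blast
    qed
    \<comment> \<open>First-order optimality: moving \<open>g\<close> by \<open>t * ?I\<close> times
      \<open>u\<close> stays in the subspace and cannot decrease the distance.\<close>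
    have ineq: "2 * t * (cmod ?I)\<^sup>2 \<le> t\<^sup>2 * (cmod ?I)\<^sup>2 * (l2_norm u)\<^sup>2" for t :: real
    proof -
      have "(\<lambda>\<zeta>. g \<zeta> + (t * ?I) * u \<zeta>) \<in> l2_perp S"
        by (intro l2_perp_add S gS l2_perp_scale u)
      then have "D g \<le> D (\<lambda>\<zeta>. g \<zeta> + (t * ?I) * u \<zeta>)" using key d_le by force
      also have "\<dots> = (l2_norm (\<lambda>\<zeta>. (\<phi> \<zeta> - g \<zeta>) - (t * ?I) * u \<zeta>))\<^sup>2"
        by (simp add: D_def algebra_simps)
      also have "\<dots> = D g - 2 * Re (cnj (t * ?I) * ?I) + (cmod (t * ?I))\<^sup>2 * (l2_norm u)\<^sup>2"
        unfolding D_def by (rule l2_norm_diff_square[OF diff[OF gS] uL])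
      also have "Re (cnj (t * ?I) * ?I) = t * (cmod ?I)\<^sup>2"
        unfolding cmod_power2 by (simp add: power2_eq_square algebra_simps)
      finally show ?thesis by (simp add: norm_mult power_mult_distrib)
    qed
    \<comment> \<open>A positive \<open>t\<close> with t |u|^2 < 1. For it the quadratic term is too
      small to compensate the linear one unless the inner product is 0; the summand 1 also covers
      |u| = 0.\<close>
    define t where "t = 1 / (1 + (l2_norm u)\<^sup>2)"
    have t: "t > 0" "t * (l2_norm u)\<^sup>2 < 1"
      unfolding t_def by (auto simp: field_simps add_pos_nonneg)
    have "t * (cmod ?I)\<^sup>2 * 2 \<le> t * (cmod ?I)\<^sup>2 * (t * (l2_norm u)\<^sup>2)"
      using ineq[of t] by (simp add: power2_eq_square mult_ac)
    moreover have "t * (cmod ?I)\<^sup>2 * (t * (l2_norm u)\<^sup>2) \<le> t * (cmod ?I)\<^sup>2 * 1"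
      using t by (intro mult_left_mono) auto
    ultimately have "t * (cmod ?I)\<^sup>2 \<le> 0" by (smt (verit))
    then show ?thesis using t by (simp add: mult_le_0_iff)
  qed
  then have "(\<lambda>\<zeta>. \<phi> \<zeta> - g \<zeta>) \<in> l2_perp (l2_perp S)"
    using diff[OF gS] by (simp add: l2_perp_def)
  with gS show ?thesis by blast
qed

lemma l2_proj_perp:
  assumes "S \<subseteq> L2" "\<phi> \<in> L2"
  shows "l2_proj (l2_perp S) \<phi> \<in> l2_perp S"
    and "(\<lambda>\<zeta>. \<phi> \<zeta> - l2_proj (l2_perp S) \<phi> \<zeta>) \<in> l2_perp (l2_perp S)"
  using someI_ex[OF l2_projection_exists[OF assms]] unfolding l2_proj_def by auto

lemma l2_norm_eq_0_AE:
  assumes "f \<in> L2" "l2_norm f = 0"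
  shows "AE \<zeta> in circle_measure. f \<zeta> = 0"
proof -
  have "(\<integral>\<zeta>. (cmod (f \<zeta>))\<^sup>2 \<partial>circle_measure) = 0"
    using assms(2) l2_norm_square[of f] by simp
  then show ?thesis
    using integral_nonneg_eq_0_iff_AE[OF L2_integrable_square[OF assms(1)]] by auto
qed

text \<open>The difference of two candidates lies in \<open>l2_perp S\<close>, and as a difference
  of two residuals it is orthogonal to \<open>l2_perp S\<close>. So it is orthogonal to itself.
  Identities about \<open>model_proj\<close> are obtained through this lemma, since the chosen
  representative itself is unknown.\<close>

lemma l2_proj_unique_AE:
  assumes "S \<subseteq> L2" "\<phi> \<in> L2" "g \<in> l2_perp S" "(\<lambda>\<zeta>. \<phi> \<zeta> - g \<zeta>) \<in> l2_perp (l2_perp S)"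
  shows "AE \<zeta> in circle_measure. l2_proj (l2_perp S) \<phi> \<zeta> = g \<zeta>"
proof -
  let ?P = "l2_proj (l2_perp S) \<phi>"
  let ?w = "\<lambda>\<zeta>. ?P \<zeta> - g \<zeta>"
  note P = l2_proj_perp[OF assms(1,2)]
  have w: "?w \<in> l2_perp S" by (intro l2_perp_diff assms P)
  have "l2_inner (\<lambda>\<zeta>. (\<phi> \<zeta> - g \<zeta>) - (\<phi> \<zeta> - ?P \<zeta>)) ?w = 0"
    by (subst l2_inner_diff) (use w P assms in \<open>auto simp: l2_perp_def\<close>)
  then have "l2_inner ?w ?w = 0" by simp
  then have "l2_norm ?w = 0" unfolding l2_inner_self by simp
  from l2_norm_eq_0_AE[OF l2_perp_L2[OF w] this] show ?thesis by simp
qed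

section \<open>Moments of boundary functions\<close>

text \<open>Termwise integration under a numerical majorant \<open>b\<close>, with \<open>G\<close>
  merely integrable. It serves Taylor series of dilations, the Poisson series and inner products
  with dilations alike. The a.e. sum \<open>s\<close> is measurable because the measure is
  complete.\<close>

lemma integral_circle_sums:
  fixes G :: "complex \<Rightarrow> complex"
  assumes G: "integrable circle_measure G" and b: "summable b"
    and v: "\<And>k. v k \<in> borel_measurable circle_measure"
    and bound: "AE \<zeta> in circle_measure. \<forall>k. cmod (v k \<zeta>) \<le> b k"
    and s: "AE \<zeta> in circle_measure. (\<lambda>k. v k \<zeta>) sums s \<zeta>"
  shows "(\<lambda>k. \<integral>\<zeta>. G \<zeta> * v k \<zeta> \<partial>circle_measure) sums (\<integral>\<zeta>. G \<zeta> * s \<zeta> \<partial>circle_measure)"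
    and "s \<in> borel_measurable circle_measure"
proof -
  note [measurable] = v
  have [measurable]: "G \<in> borel_measurable circle_measure" using G by simp
  show s_meas [measurable]: "s \<in> borel_measurable circle_measure"
  proof (rule measurable_circle_AE)
    show "(\<lambda>\<zeta>. \<Sum>k. v k \<zeta>) \<in> borel_measurable circle_measure" by measurable
    show "AE \<zeta> in circle_measure. (\<Sum>k. v k \<zeta>) = s \<zeta>"
      using s by eventually_elim (simp add: sums_iff)
  qed
  have le: "AE \<zeta> in circle_measure. \<forall>k. cmod (G \<zeta> * v k \<zeta>) \<le> b k * cmod (G \<zeta>)"
    using bound by eventually_elim (auto simp: norm_mult mult.commute[of "cmod (G _)"] intro: mult_right_mono)
  have le': "AE \<zeta> in circle_measure. cmod (G \<zeta> * v k \<zeta>) \<le> b k * cmod (G \<zeta>)" for k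
    using le by eventually_elim blast
  have int: "integrable circle_measure (\<lambda>\<zeta>. G \<zeta> * v k \<zeta>)" for k
  proof (rule Bochner_Integration.integrable_bound)
    show "integrable circle_measure (\<lambda>\<zeta>. b k * cmod (G \<zeta>))" using G by simp
    show "AE \<zeta> in circle_measure. norm (G \<zeta> * v k \<zeta>) \<le> norm (b k * cmod (G \<zeta>))"
      using le'[of k] by eventually_elim simp
  qed simp
  have "(\<lambda>k. \<integral>\<zeta>. G \<zeta> * v k \<zeta> \<partial>circle_measure) sums (\<integral>\<zeta>. (\<Sum>k. G \<zeta> * v k \<zeta>) \<partial>circle_measure)"
  proof (rule sums_integral[OF int])
    show "AE \<zeta> in circle_measure. summable (\<lambda>k. norm (G \<zeta> * v k \<zeta>))"
      using le
    proof eventually_elim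
      case (elim \<zeta>)
      show ?case
        by (rule summable_comparison_test'[where g="\<lambda>k. b k * cmod (G \<zeta>)" and N=0])
          (use elim b in \<open>auto intro: summable_mult2\<close>)
    qed
    have bnd: "(\<integral>\<zeta>. norm (G \<zeta> * v k \<zeta>) \<partial>circle_measure) \<le> b k * (\<integral>\<zeta>. cmod (G \<zeta>) \<partial>circle_measure)" for k
    proof -
      have "(\<integral>\<zeta>. norm (G \<zeta> * v k \<zeta>) \<partial>circle_measure) \<le> (\<integral>\<zeta>. b k * cmod (G \<zeta>) \<partial>circle_measure)"
        by (rule integral_mono_AE) (use le' int G in auto)
      then show ?thesis by simp
    qed
    show "summable (\<lambda>k. \<integral>\<zeta>. norm (G \<zeta> * v k \<zeta>) \<partial>circle_measure)"
      by (rule summable_comparison_test'[where g="\<lambda>k. b k * (\<integral>\<zeta>. cmod (G \<zeta>) \<partial>circle_measure)" and N=0])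
        (use b bnd in \<open>auto intro: summable_mult2\<close>)
  qed
  moreover have "(\<integral>\<zeta>. (\<Sum>k. G \<zeta> * v k \<zeta>) \<partial>circle_measure) = (\<integral>\<zeta>. G \<zeta> * s \<zeta> \<partial>circle_measure)"
  proof (rule integral_cong_AE)
    show "AE \<zeta> in circle_measure. (\<Sum>k. G \<zeta> * v k \<zeta>) = G \<zeta> * s \<zeta>"
      using s by eventually_elim (auto simp: sums_iff suminf_mult)
  qed measurable
  ultimately show "(\<lambda>k. \<integral>\<zeta>. G \<zeta> * v k \<zeta> \<partial>circle_measure) sums (\<integral>\<zeta>. G \<zeta> * s \<zeta> \<partial>circle_measure)"
    by simp
qed

lemma borel_measurable_power_circle [measurable]: "(\<lambda>\<zeta>. \<zeta> ^ n) \<in> borel_measurable circle_measure"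
  by (rule borel_measurable_circle) measurable

lemma AE_circle_power_le: "AE \<zeta> in circle_measure. \<forall>k. cmod (\<zeta> ^ k) \<le> 1"
  using AE_circle_norm by eventually_elim (simp add: norm_power)

lemma L2_power: "(\<lambda>\<zeta>. \<zeta> ^ n) \<in> L2"
  by (rule L2_bounded[of _ 1]) (use AE_circle_power_le in \<open>auto elim: eventually_mono\<close>)

section \<open>Moments of dilations and passage to the boundary\<close>

lemma holomorphic_dilation_sums:
  assumes "f holomorphic_on ball 0 1" "0 \<le> r" "r < 1"
  obtains c where "c 0 = f 0" "summable (\<lambda>k. cmod (c k))"
    "\<And>\<zeta>. cmod \<zeta> = 1 \<Longrightarrow> (\<lambda>k. c k * \<zeta> ^ k) sums f (of_real r * \<zeta>)"
proof
  define a where "a k = (deriv ^^ k) f 0 / fact k" for k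
  have a: "(\<lambda>k. a k * z ^ k) sums f z" if "z \<in> ball 0 1" for z
    using holomorphic_power_series[OF assms(1) that] by (simp add: a_def)
  \<comment> \<open>Convergence at a larger radius inside the disk yields absolute convergence at
    \<open>r\<close>.\<close>
  obtain r' where r': "r < r'" "r' < 1" using dense[OF assms(3)] by auto
  show "a 0 * of_real r ^ 0 = f 0" by (simp add: a_def)
  have "summable (\<lambda>k. a k * of_real r' ^ k)"
    using a[of "of_real r'"] r' assms by (auto simp: sums_iff)
  then have "summable (\<lambda>k. norm (a k * of_real r ^ k))"
    by (rule powser_insidea) (use r' assms in auto)
  then show "summable (\<lambda>k. cmod (a k * of_real r ^ k))" .
  show "(\<lambda>k. a k * of_real r ^ k * \<zeta> ^ k) sums f (of_real r * \<zeta>)" if "cmod \<zeta> = 1" for \<zeta>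
    using a[of "of_real r * \<zeta>"] that assms by (simp add: norm_mult power_mult_distrib mult.assoc)
qed

text \<open>Integrating the Taylor series against \<open>\<zeta> ^ n\<close> leaves only integrals
  of \<open>\<zeta> ^ (n + k)\<close>, all of which vanish except for n = k = 0. The case n = 0 is
  the mean value property.\<close>

lemma integral_circle_dilation:
  assumes "f holomorphic_on ball 0 1" "0 \<le> r" "r < 1"
  shows "(\<integral>\<zeta>. f (of_real r * \<zeta>) * \<zeta> ^ n \<partial>circle_measure) = (if n = 0 then f 0 else 0)"
    and "(\<lambda>\<zeta>. f (of_real r * \<zeta>)) \<in> borel_measurable circle_measure"
proof -
  obtain c where c: "c 0 = f 0" "summable (\<lambda>k. cmod (c k))"
    "\<And>\<zeta>. cmod \<zeta> = 1 \<Longrightarrow> (\<lambda>k. c k * \<zeta> ^ k) sums f (of_real r * \<zeta>)"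
    using holomorphic_dilation_sums[OF assms] by blast
  have s: "AE \<zeta> in circle_measure. (\<lambda>k. c k * \<zeta> ^ k) sums f (of_real r * \<zeta>)"
    using AE_circle_norm by eventually_elim (rule c(3))
  have b: "AE \<zeta> in circle_measure. \<forall>k. cmod (c k * \<zeta> ^ k) \<le> cmod (c k)"
    using AE_circle_norm by eventually_elim (simp add: norm_mult norm_power)
  have m: "(\<lambda>\<zeta>. c k * \<zeta> ^ k) \<in> borel_measurable circle_measure" for k by measurable
  note sums = integral_circle_sums[OF L2_integrable[OF L2_power[of n]] c(2) m b s]
  show "(\<lambda>\<zeta>. f (of_real r * \<zeta>)) \<in> borel_measurable circle_measure" by (rule sums)
  have "(\<integral>\<zeta>. \<zeta> ^ n * (c k * \<zeta> ^ k) \<partial>circle_measure) = c k * (if n + k = 0 then 1 else 0)" for k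
  proof -
    have "(\<integral>\<zeta>. \<zeta> ^ n * (c k * \<zeta> ^ k) \<partial>circle_measure) = c k * (\<integral>\<zeta>. \<zeta> ^ (n + k) \<partial>circle_measure)"
      by (subst integral_mult_right_zero[symmetric]) (simp add: power_add mult_ac)
    then show ?thesis using integral_circle_power[of "n + k"] by auto
  qed
  then have "(\<lambda>k. c k * (if n + k = 0 then 1 else 0)) sums (\<integral>\<zeta>. \<zeta> ^ n * f (of_real r * \<zeta>) \<partial>circle_measure)"
    using sums(1) by simp
  moreover have "(\<lambda>k. c k * (if n + k = 0 then 1 else 0)) sums (if n = 0 then f 0 else 0)"
  proof (cases "n = 0")
    case True
    then have "(\<lambda>k. c k * (if n + k = 0 then 1 else 0)) = (\<lambda>k. if k = 0 then c k else 0)" by auto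
    then show ?thesis using sums_single[of 0 c] True c(1) by simp
  qed simp
  ultimately show "(\<integral>\<zeta>. f (of_real r * \<zeta>) * \<zeta> ^ n \<partial>circle_measure) = (if n = 0 then f 0 else 0)"
    by (simp add: sums_unique2 mult.commute)
qed

text \<open>No integrable majorant is assumed; the L^2 bound supplies uniform integrability instead.
  Split |w| \<le> min(|w|, K) + |w|^2 / K: the first term tends to 0 in the mean by bounded
  convergence, the second has integral at most C^2 / K.\<close>

lemma L2_bounded_tendsto_0:
  assumes w: "\<And>m. w m \<in> L2" "\<And>m. l2_norm (w m) \<le> C" and lim: "AE \<zeta> in circle_measure. (\<lambda>m. w m \<zeta>) \<longlonglongrightarrow> 0"
  shows "(\<lambda>m. \<integral>\<zeta>. cmod (w m \<zeta>) \<partial>circle_measure) \<longlonglongrightarrow> 0"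
proof -
  note [measurable] = L2_measurable[OF w(1)]
  have *: "(\<integral>\<zeta>. cmod (w m \<zeta>) \<partial>circle_measure) \<le> (\<integral>\<zeta>. min (cmod (w m \<zeta>)) K \<partial>circle_measure) + C\<^sup>2 / K" if "K > 0" for m K
  proof -
    have min: "integrable circle_measure (\<lambda>\<zeta>. min (cmod (w m \<zeta>)) K)"
      by (rule circle.integrable_const_bound[where B=K]) (use that in auto)
    have sq: "integrable circle_measure (\<lambda>\<zeta>. (cmod (w m \<zeta>))\<^sup>2 / K)"
      using L2_integrable_square[OF w(1)] by simp
    have "(\<integral>\<zeta>. cmod (w m \<zeta>) \<partial>circle_measure) \<le> (\<integral>\<zeta>. min (cmod (w m \<zeta>)) K + (cmod (w m \<zeta>))\<^sup>2 / K \<partial>circle_measure)"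
    proof (rule integral_mono)
      fix \<zeta>
      show "cmod (w m \<zeta>) \<le> min (cmod (w m \<zeta>)) K + (cmod (w m \<zeta>))\<^sup>2 / K"
      proof (cases "cmod (w m \<zeta>) \<le> K")
        case False
        then have "cmod (w m \<zeta>) * K \<le> cmod (w m \<zeta>) * cmod (w m \<zeta>)" by (intro mult_left_mono) auto
        then have "cmod (w m \<zeta>) \<le> (cmod (w m \<zeta>))\<^sup>2 / K" using that by (simp add: pos_le_divide_eq power2_eq_square)
        then show ?thesis using that False by simp
      qed (use that in simp)
    qed (use min sq L2_integrable[OF w(1)] in auto)
    also have "\<dots> = (\<integral>\<zeta>. min (cmod (w m \<zeta>)) K \<partial>circle_measure) + (l2_norm (w m))\<^sup>2 / K"
      using min sq by (simp add: l2_norm_square)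
    also have "(l2_norm (w m))\<^sup>2 / K \<le> C\<^sup>2 / K"
      using w(2)[of m] that by (intro divide_right_mono power_mono) auto
    finally show ?thesis by simp
  qed
  show ?thesis
  proof (rule LIMSEQ_I)
    fix e :: real assume e: "e > 0"
    \<comment> \<open>Large enough to make C^2 / K smaller than e / 2; the summand 1 keeps
      \<open>K\<close> positive when C = 0.\<close>
    define K where "K = 2 * (C\<^sup>2 + 1) / e"
    have K: "K > 0" using e by (simp add: K_def add_nonneg_pos)
    have small: "C\<^sup>2 / K < e / 2"
    proof -
      have "C\<^sup>2 / K = e / 2 * (C\<^sup>2 / (C\<^sup>2 + 1))" using e by (simp add: K_def)
      also have "\<dots> < e / 2 * 1"
        using e by (intro mult_strict_left_mono) (auto simp: divide_less_eq add_nonneg_pos)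
      finally show ?thesis by simp
    qed
    have "(\<lambda>m. \<integral>\<zeta>. min (cmod (w m \<zeta>)) K \<partial>circle_measure) \<longlonglongrightarrow> (\<integral>\<zeta>. 0 \<partial>circle_measure)"
    proof (rule integral_dominated_convergence[where w="\<lambda>_. K"])
      show "AE \<zeta> in circle_measure. (\<lambda>m. min (cmod (w m \<zeta>)) K) \<longlonglongrightarrow> 0"
        using lim
      proof eventually_elim
        case (elim \<zeta>)
        have "(\<lambda>m. min (cmod (w m \<zeta>)) K) \<longlonglongrightarrow> min (cmod 0) K"
          by (intro tendsto_intros elim)
        then show ?case using K by simp
      qed
    qed (use K in auto)
    then obtain N where N: "\<forall>m\<ge>N. norm ((\<integral>\<zeta>. min (cmod (w m \<zeta>)) K \<partial>circle_measure) - 0) < e / 2"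
      using e by (auto dest!: LIMSEQ_D[where r="e/2"])
    have "\<forall>m\<ge>N. norm ((\<integral>\<zeta>. cmod (w m \<zeta>) \<partial>circle_measure) - 0) < e"
    proof (intro allI impI)
      fix m assume "N \<le> m"
      with N have "norm ((\<integral>\<zeta>. min (cmod (w m \<zeta>)) K \<partial>circle_measure) - 0) < e / 2" by blast
      then have "(\<integral>\<zeta>. min (cmod (w m \<zeta>)) K \<partial>circle_measure) < e / 2" by (simp add: abs_less_iff)
      moreover have "0 \<le> (\<integral>\<zeta>. cmod (w m \<zeta>) \<partial>circle_measure)" by (rule Bochner_Integration.integral_nonneg) simp
      ultimately show "norm ((\<integral>\<zeta>. cmod (w m \<zeta>) \<partial>circle_measure) - 0) < e"
        using *[OF K, of m] small unfolding diff_zero real_norm_def by linarith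
    qed
    then show "\<exists>N. \<forall>m\<ge>N. norm ((\<integral>\<zeta>. cmod (w m \<zeta>) \<partial>circle_measure) - 0) < e" by blast
  qed
qed

text \<open>The bound in \<open>hardy2_disk\<close> concerns Bochner integrals, whose values by
  themselves do not certify integrability. Membership in \<open>L2\<close> is therefore obtained
  from boundedness of \<open>f\<close> on the compact disk of radius \<open>r\<close>, and only the
  norm bound comes from the definition.\<close>

lemma hardy2_disk_L2_dilation:
  assumes "f \<in> hardy2_disk"
  obtains C where "\<And>r. 0 \<le> r \<Longrightarrow> r < 1 \<Longrightarrow> (\<lambda>\<zeta>. f (of_real r * \<zeta>)) \<in> L2"
    "\<And>r. 0 \<le> r \<Longrightarrow> r < 1 \<Longrightarrow> l2_norm (\<lambda>\<zeta>. f (of_real r * \<zeta>)) \<le> C"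
proof -
  have f: "f holomorphic_on ball 0 1" using assms by (simp add: hardy2_disk_def)
  obtain B where B: "\<And>r. 0 \<le> r \<Longrightarrow> r < 1 \<Longrightarrow> (\<integral>\<zeta>. (cmod (f (of_real r * \<zeta>)))\<^sup>2 \<partial>circle_measure) \<le> B"
    using assms unfolding hardy2_disk_def bdd_above_def by fastforce
  show ?thesis
  proof
    fix r :: real assume r: "0 \<le> r" "r < 1"
    have "compact (f ` cball 0 r)"
      using r by (intro compact_continuous_image holomorphic_on_imp_continuous_on holomorphic_on_subset[OF f]) auto
    then obtain K where K: "\<And>z. cmod z \<le> r \<Longrightarrow> cmod (f z) \<le> K"
      unfolding bounded_iff[of "f ` cball 0 r"] by (metis bounded_iff compact_imp_bounded image_eqI mem_cball_0)
    show "(\<lambda>\<zeta>. f (of_real r * \<zeta>)) \<in> L2"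
    proof (rule L2_bounded)
      show "AE \<zeta> in circle_measure. cmod (f (of_real r * \<zeta>)) \<le> K"
        using AE_circle_norm by eventually_elim (rule K, use r in \<open>simp add: norm_mult\<close>)
    qed (rule integral_circle_dilation[OF f r])
    show "l2_norm (\<lambda>\<zeta>. f (of_real r * \<zeta>)) \<le> sqrt B"
      unfolding l2_norm_def by (intro real_sqrt_le_mono B r)
  qed
qed

lemma ex_radial_sequence:
  obtains r :: "nat \<Rightarrow> real" where "\<And>m. 0 \<le> r m" "\<And>m. r m < 1" "r \<longlonglongrightarrow> 1"
proof (rule that[of "\<lambda>m. 1 - 1 / real (Suc m)"])
  have "(\<lambda>m. 1 - 1 / real (Suc m)) \<longlonglongrightarrow> 1 - 0" by (intro tendsto_intros LIMSEQ_Suc lim_1_over_n)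
  then show "(\<lambda>m. 1 - 1 / real (Suc m)) \<longlonglongrightarrow> 1" by simp
qed auto

text \<open>The radius to \<zeta> lies in the Stolz region of aperture 2, since |r \<zeta> -
  \<zeta>| = 1 - r. This turns the non-tangential limit into a sequential one, to which limit
  theorems for integrals apply.\<close>

lemma nontangential_limit_radial:
  assumes "nontangential_limit f \<zeta> w" "cmod \<zeta> = 1" and r: "\<And>m. 0 \<le> r m" "\<And>m. r m < 1" "r \<longlonglongrightarrow> 1"
  shows "(\<lambda>m. f (of_real (r m) * \<zeta>)) \<longlonglongrightarrow> w"
proof -
  have lim: "(f \<longlongrightarrow> w) (at \<zeta> within stolz_region 2 \<zeta>)"
    using assms(1) by (auto simp: nontangential_limit_def)
  have "filterlim (\<lambda>m. of_real (r m) * \<zeta>) (at \<zeta> within stolz_region 2 \<zeta>) sequentially"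
    unfolding filterlim_at
  proof
    have "of_real (r m) * \<zeta> \<in> stolz_region 2 \<zeta>" for m
    proof -
      have "of_real (r m) * \<zeta> - \<zeta> = of_real (r m - 1) * \<zeta>" by (simp add: algebra_simps)
      then have "cmod (of_real (r m) * \<zeta> - \<zeta>) = 1 - r m"
        using r(2)[of m] assms(2) by (simp only: norm_mult norm_of_real) simp
      then show ?thesis using r(1,2)[of m] assms(2) by (simp add: stolz_region_def norm_mult)
    qed
    moreover have "of_real (r m) * \<zeta> \<noteq> \<zeta>" for m
      using r(2)[of m] assms(2) by auto
    ultimately show "\<forall>\<^sub>F m in sequentially. of_real (r m) * \<zeta> \<in> stolz_region 2 \<zeta> \<and> of_real (r m) * \<zeta> \<noteq> \<zeta>" by simp
    have "(\<lambda>m. of_real (r m) * \<zeta>) \<longlonglongrightarrow> of_real 1 * \<zeta>" by (intro tendsto_intros r)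
    then show "(\<lambda>m. of_real (r m) * \<zeta>) \<longlonglongrightarrow> \<zeta>" by simp
  qed
  then show ?thesis by (rule filterlim_compose[OF lim])
qed

text \<open>All dilations of \<open>f\<close> have the same moments, and they converge to
  \<open>g\<close> in L^1. Besides the vanishing for n > 0, the case n = 0 recovers the value at the
  origin from boundary values, which is how \<Theta>(0) enters later.\<close>

lemma hardy2_moments:
  assumes f: "f \<in> hardy2_disk" and bv: "has_boundary_values f g" and g: "g \<in> L2"
  shows "(\<integral>\<zeta>. g \<zeta> * \<zeta> ^ n \<partial>circle_measure) = (if n = 0 then f 0 else 0)"
proof -
  obtain r :: "nat \<Rightarrow> real" where r: "\<And>m. 0 \<le> r m" "\<And>m. r m < 1" "r \<longlonglongrightarrow> 1"
    by (rule ex_radial_sequence) blast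
  obtain C where C: "\<And>r. 0 \<le> r \<Longrightarrow> r < 1 \<Longrightarrow> (\<lambda>\<zeta>. f (of_real r * \<zeta>)) \<in> L2"
    "\<And>r. 0 \<le> r \<Longrightarrow> r < 1 \<Longrightarrow> l2_norm (\<lambda>\<zeta>. f (of_real r * \<zeta>)) \<le> C"
    using hardy2_disk_L2_dilation[OF f] by blast
  define w where "w m \<zeta> = f (of_real (r m) * \<zeta>) - g \<zeta>" for m \<zeta>
  have wL: "w m \<in> L2" for m unfolding w_def by (intro L2_diff C r g)
  have wC: "l2_norm (w m) \<le> C + l2_norm g" for m
    using l2_norm_triangle[OF C(1)[OF r(1,2)] L2_scale[OF g, of "-1"], of m] C(2)[OF r(1,2), of m] l2_norm_scale[of "-1" g]
    by (simp add: w_def[abs_def])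
  have w0: "AE \<zeta> in circle_measure. (\<lambda>m. w m \<zeta>) \<longlonglongrightarrow> 0"
    using bv[unfolded has_boundary_values_def] AE_circle_norm
  proof eventually_elim
    case (elim \<zeta>)
    have "(\<lambda>m. w m \<zeta>) \<longlonglongrightarrow> g \<zeta> - g \<zeta>"
      unfolding w_def by (intro tendsto_intros nontangential_limit_radial elim r)
    then show ?case by simp
  qed
  have hol: "f holomorphic_on ball 0 1" using f by (simp add: hardy2_disk_def)
  let ?J = "if n = 0 then f 0 else 0"
  \<comment> \<open>The left side does not depend on \<open>m\<close>, since \<open>?J\<close> is
    the moment of every dilation; letting \<open>m\<close> grow on the right makes it 0.\<close>
  have le: "cmod (?J - (\<integral>\<zeta>. g \<zeta> * \<zeta> ^ n \<partial>circle_measure)) \<le> (\<integral>\<zeta>. cmod (w m \<zeta>) \<partial>circle_measure)" for m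
  proof -
    have int: "integrable circle_measure (\<lambda>\<zeta>. h \<zeta> * \<zeta> ^ n)" if "h \<in> L2" for h
    proof -
      have "(\<lambda>\<zeta>. \<zeta> ^ n * h \<zeta>) \<in> L2"
        by (rule L2_mult_bounded[OF that, of _ 1]) (use AE_circle_power_le in \<open>auto elim: eventually_mono\<close>)
      from L2_integrable[OF this] show ?thesis by (simp add: mult.commute)
    qed
    have "?J - (\<integral>\<zeta>. g \<zeta> * \<zeta> ^ n \<partial>circle_measure) = (\<integral>\<zeta>. w m \<zeta> * \<zeta> ^ n \<partial>circle_measure)"
      using integral_circle_dilation(1)[OF hol r(1,2), of m n] int[OF C(1)[OF r(1,2)], of m] int[OF g]
      by (simp add: w_def left_diff_distrib)
    also have "cmod \<dots> \<le> (\<integral>\<zeta>. cmod (w m \<zeta> * \<zeta> ^ n) \<partial>circle_measure)" by simp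
    also have "\<dots> \<le> (\<integral>\<zeta>. cmod (w m \<zeta>) \<partial>circle_measure)"
    proof (rule integral_mono_AE)
      show "AE \<zeta> in circle_measure. cmod (w m \<zeta> * \<zeta> ^ n) \<le> cmod (w m \<zeta>)"
        using AE_circle_norm by eventually_elim (simp add: norm_mult norm_power)
    qed (use int[OF wL] L2_integrable[OF wL] in auto)
    finally show ?thesis .
  qed
  have "cmod (?J - (\<integral>\<zeta>. g \<zeta> * \<zeta> ^ n \<partial>circle_measure)) \<le> 0"
    by (rule LIMSEQ_le_const[OF L2_bounded_tendsto_0[OF wL wC w0]]) (use le in blast)
  then show ?thesis by simp
qed

section \<open>Lebesgue points\<close>

text \<open>Inside any open U containing E, the balls with large \<nu>-average form a Vitali cover.
  A countable disjoint subfamily covers E up to a null set, and summing over it gives b |E| \<le>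
  \<nu>(U). Outer regularity of the finite measure \<nu> then replaces U by E.\<close>

lemma Vitali_density_bound:
  fixes \<nu> :: "real measure"
  assumes sets: "sets \<nu> = sets borel" and fin: "emeasure \<nu> (space \<nu>) \<noteq> \<infinity>" and E: "E \<in> sets borel"
    and dens: "\<And>x d. x \<in> E \<Longrightarrow> 0 < d \<Longrightarrow> \<exists>r. 0 < r \<and> r < d \<and> ennreal b * emeasure lborel (ball x r) \<le> emeasure \<nu> (ball x r)"
  shows "ennreal b * emeasure lborel E \<le> emeasure \<nu> E"
proof -
  have *: "ennreal b * emeasure lborel E \<le> emeasure \<nu> U" if U: "E \<subseteq> U" "open U" for U
  proof -
    define K where "K = {(x, r). x \<in> E \<and> 0 < r \<and> ball x r \<subseteq> U \<and> ennreal b * emeasure lborel (ball x r) \<le> emeasure \<nu> (ball x r)}"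
    have cov: "\<exists>i. i \<in> K \<and> x \<in> ball (fst i) (snd i) \<and> snd i < d" if "x \<in> E" "0 < d" for x d
    proof -
      obtain e where e: "e > 0" "ball x e \<subseteq> U" using U \<open>x \<in> E\<close> open_contains_ball by blast
      obtain r where r: "0 < r" "r < min d e" "ennreal b * emeasure lborel (ball x r) \<le> emeasure \<nu> (ball x r)"
        using dens[OF \<open>x \<in> E\<close>, of "min d e"] e \<open>0 < d\<close> by auto
      have "ball x r \<subseteq> U" using e r by (meson order_trans subset_ball less_imp_le min.strict_boundedE)
      then have "(x, r) \<in> K" using r \<open>x \<in> E\<close> by (simp add: K_def)
      then show ?thesis using r by (intro exI[of _ "(x, r)"]) auto
    qed
    obtain C where C: "countable C" "C \<subseteq> K"
      "pairwise (\<lambda>i j. disjnt (ball (fst i) (snd i)) (ball (fst j) (snd j))) C"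
      "negligible (E - (\<Union>i \<in> C. ball (fst i) (snd i)))"
      using Vitali_covering_theorem_balls[of E K fst snd, OF cov] by blast
    let ?V = "\<Union>i \<in> C. ball (fst i) (snd i)"
    have V: "?V \<in> sets borel" by (intro borel_open) auto
    have disj: "disjoint_family_on (\<lambda>i. ball (fst i) (snd i)) C"
      using C(3) by (auto simp: disjoint_family_on_def pairwise_def disjnt_def)
    have "emeasure lborel (E - ?V) = 0"
    proof -
      have "E - ?V \<in> null_sets lebesgue" using C(4) by (simp add: negligible_iff_null_sets)
      then have "E - ?V \<in> null_sets lborel"
        using E V by (subst (asm) null_sets_completion_iff) auto
      then show ?thesis by auto
    qed
    have "emeasure lborel E \<le> emeasure lborel (?V \<union> (E - ?V))"
      by (rule emeasure_mono) (use E V in auto)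
    also have "\<dots> \<le> emeasure lborel ?V + emeasure lborel (E - ?V)"
      by (rule emeasure_subadditive) (use E V in auto)
    also have "\<dots> = (\<integral>\<^sup>+i. emeasure lborel (ball (fst i) (snd i)) \<partial>count_space C)"
      using \<open>emeasure lborel (E - ?V) = 0\<close> emeasure_UN_countable[OF _ C(1) disj, of lborel] by simp
    finally have "ennreal b * emeasure lborel E \<le> ennreal b * (\<integral>\<^sup>+i. emeasure lborel (ball (fst i) (snd i)) \<partial>count_space C)"
      by (intro mult_left_mono) auto
    also have "\<dots> = (\<integral>\<^sup>+i. ennreal b * emeasure lborel (ball (fst i) (snd i)) \<partial>count_space C)"
      by (simp add: nn_integral_cmult)
    also have "\<dots> \<le> (\<integral>\<^sup>+i. emeasure \<nu> (ball (fst i) (snd i)) \<partial>count_space C)"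
      by (intro nn_integral_mono) (use C(2) in \<open>auto simp: K_def\<close>)
    also have "\<dots> = emeasure \<nu> ?V"
      using emeasure_UN_countable[OF _ C(1) disj, of \<nu>] sets by simp
    also have "\<dots> \<le> emeasure \<nu> U"
    proof (rule emeasure_mono)
      have "ball (fst i) (snd i) \<subseteq> U" if "i \<in> C" for i
        using subsetD[OF C(2) that] by (simp add: K_def split_beta)
      then show "?V \<subseteq> U" by blast
    qed (use U sets in simp)
    finally show ?thesis .
  qed
  show ?thesis
    unfolding outer_regular[OF sets fin E] by (rule INF_greatest) (use * in auto)
qed

text \<open>If the averages of \<open>w\<close> exceed \<open>b\<close> at arbitrarily small scales on \<open>{w \<le> a}\<close> with \<open>a < b\<close>, then
  the Vitali bound contradicts \<open>\<nu> E \<le> a * \<bar>E\<bar>\<close>, where \<open>\<nu> = w dx\<close>, unless the set is null.\<close>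

lemma differentiation_upper_bound:
  fixes w :: "real \<Rightarrow> real"
  assumes w [measurable]: "w \<in> borel_measurable borel" and nonneg: "\<And>x. 0 \<le> w x"
    and fin: "(\<integral>\<^sup>+t. w t \<partial>lborel) \<noteq> \<infinity>"
  shows "AE x in lborel. \<forall>b > w x. \<exists>d>0. \<forall>r. 0 < r \<and> r < d \<longrightarrow>
    (\<integral>\<^sup>+t. w t * indicator (ball x r) t \<partial>lborel) \<le> ennreal b * emeasure lborel (ball x r)"
proof -
  define \<nu> where "\<nu> = density lborel w"
  have sets\<nu>: "sets \<nu> = sets borel" by (simp add: \<nu>_def)
  have em: "emeasure \<nu> A = (\<integral>\<^sup>+t. w t * indicator A t \<partial>lborel)" if "A \<in> sets borel" for A
    unfolding \<nu>_def using that by (subst emeasure_density) (auto intro!: nn_integral_cong simp: indicator_def)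
  have fin\<nu>: "emeasure \<nu> (space \<nu>) \<noteq> \<infinity>"
    using fin em[of UNIV] by (simp add: \<nu>_def)
  define G where "G b d = {x. \<exists>r. 0 < r \<and> r < d \<and> ennreal b * emeasure lborel (ball x r) < emeasure \<nu> (ball x r)}" for b d :: real
  have openG: "open (G b d)" for b d
  proof (subst open_contains_ball, rule)
    fix x assume "x \<in> G b d"
    then obtain r where r: "0 < r" "r < d" "ennreal b * emeasure lborel (ball x r) < emeasure \<nu> (ball x r)"
      by (auto simp: G_def)
    \<comment> \<open>Continuity of \<nu> from below carries the strict inequality over to a
      slightly smaller concentric ball. If the centre moves by less than the gained margin, the ball
      of radius \<open>r\<close> still contains that smaller ball while its length is unchanged;
      hence \<open>G b d\<close> is open.\<close>
    define A where "A n = ball x (r - r / real (Suc n))" for n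
    have UN: "(\<Union>n. A n) = ball x r"
    proof (intro equalityI subsetI)
      fix y assume "y \<in> ball x r"
      then obtain n where "inverse (real (Suc n)) < (r - dist x y) / r"
        using reals_Archimedean[of "(r - dist x y) / r"] r by auto
      then have "r / real (Suc n) < r - dist x y" using r(1) by (simp add: field_simps)
      then have "y \<in> A n" unfolding A_def mem_ball by linarith
      then show "y \<in> (\<Union>n. A n)" by blast
    next
      fix y assume "y \<in> (\<Union>n. A n)"
      then obtain n where "dist x y < r - r / real (Suc n)" by (auto simp: A_def)
      moreover have "0 < r / real (Suc n)" using r by simp
      ultimately have "dist x y < r" by linarith
      then show "y \<in> ball x r" by simp
    qed
    have "incseq A"
      unfolding A_def incseq_def using r(1) by (auto intro!: subset_ball divide_left_mono)
    moreover have "range A \<subseteq> sets \<nu>"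
      by (auto simp: A_def sets\<nu>)
    ultimately have "(SUP n. emeasure \<nu> (A n)) = emeasure \<nu> (ball x r)"
      using SUP_emeasure_incseq[of A \<nu>] UN by simp
    then obtain n where n: "ennreal b * emeasure lborel (ball x r) < emeasure \<nu> (A n)"
      using r(3) by (metis less_SUP_iff)
    have "ball x (r / real (Suc n)) \<subseteq> G b d"
    proof
      fix y assume "y \<in> ball x (r / real (Suc n))"
      then have d: "dist x y < r / real (Suc n)" by simp
      have "A n \<subseteq> ball y r"
      proof
        fix t assume "t \<in> A n"
        then have "dist x t < r - r / real (Suc n)" by (simp add: A_def)
        then show "t \<in> ball y r"
          using d dist_triangle[of y t x] by (simp add: dist_commute)
      qed
      then have "emeasure \<nu> (A n) \<le> emeasure \<nu> (ball y r)"
        by (rule emeasure_mono) (simp add: sets\<nu>)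
      moreover have "emeasure lborel (ball y r) = emeasure lborel (ball x r)"
        using r(1) by (simp add: ball_eq_greaterThanLessThan)
      ultimately show "y \<in> G b d" using n r by (auto simp: G_def intro!: exI[of _ r])
    qed
    then show "\<exists>e>0. ball x e \<subseteq> G b d" using r by (intro exI[of _ "r / real (Suc n)"]) auto
  qed
  define E where "E a b = {x. w x \<le> a} \<inter> (\<Inter>n. G b (1 / real (Suc n)))" for a b
  have E_sets [measurable]: "E a b \<in> sets borel" for a b
  proof -
    have "(\<Inter>n. G b (1 / real (Suc n))) \<in> sets borel"
      using openG by (intro sets.countable_INT) auto
    moreover have "{x. w x \<le> a} \<in> sets borel" by measurable
    ultimately show ?thesis by (auto simp: E_def)
  qed
  have null: "E a b \<in> null_sets lborel" if ab: "0 \<le> a" "a < b" for a b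
  proof -
    have le1: "ennreal b * emeasure lborel (E a b) \<le> emeasure \<nu> (E a b)"
    proof (rule Vitali_density_bound[OF sets\<nu> fin\<nu> E_sets])
      fix x d :: real assume "x \<in> E a b" "0 < d"
      then obtain n where "1 / real (Suc n) < d" using reals_Archimedean[of d] by (auto simp: inverse_eq_divide)
      moreover have "x \<in> G b (1 / real (Suc n))" using \<open>x \<in> E a b\<close> by (auto simp: E_def)
      ultimately show "\<exists>r. 0 < r \<and> r < d \<and> ennreal b * emeasure lborel (ball x r) \<le> emeasure \<nu> (ball x r)"
        by (auto simp: G_def intro: less_imp_le)
    qed
    have "emeasure \<nu> (E a b) = (\<integral>\<^sup>+t. w t * indicator (E a b) t \<partial>lborel)" by (rule em) measurable
    also have "\<dots> \<le> (\<integral>\<^sup>+t. ennreal a * indicator (E a b) t \<partial>lborel)"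
      by (intro nn_integral_mono) (auto simp: E_def indicator_def intro: ennreal_leI)
    also have "\<dots> = ennreal a * emeasure lborel (E a b)"
      by (rule nn_integral_cmult_indicator) simp
    finally have le2: "ennreal b * emeasure lborel (E a b) \<le> ennreal a * emeasure lborel (E a b)"
      using le1 by simp
    \<comment> \<open>Since b > 0 and \<nu> is finite, E has finite length; only then can b |E|
      \<le> a |E| be cancelled to give |E| = 0.\<close>
    have "emeasure \<nu> (E a b) < \<infinity>"
      using emeasure_space[of \<nu> "E a b"] fin\<nu> by (simp add: top.not_eq_extremum le_less_trans)
    with le1 have "ennreal b * emeasure lborel (E a b) < \<infinity>" by (rule le_less_trans)
    then have "emeasure lborel (E a b) \<noteq> \<infinity>" using ab by (auto simp: ennreal_mult_eq_top_iff)
    then obtain m where m: "emeasure lborel (E a b) = ennreal m" "0 \<le> m"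
      by (cases "emeasure lborel (E a b)") auto
    have "b * m \<le> a * m" using le2 m ab by (simp add: ennreal_mult[symmetric] ennreal_le_iff)
    then have "m = 0" using ab m by (metis mult_less_cancel_right_pos not_le order_le_less)
    then show ?thesis using m by auto
  qed
  \<comment> \<open>Restricting to rational pairs leaves countably many null sets to avoid at
    once.\<close>
  have "AE x in lborel. \<forall>p \<in> {(a, b). a \<in> \<rat> \<and> b \<in> \<rat> \<and> 0 \<le> a \<and> a < b}. x \<notin> E (fst p) (snd p)"
  proof (subst AE_ball_countable)
    show "countable {(a, b). a \<in> \<rat> \<and> b \<in> \<rat> \<and> 0 \<le> a \<and> a < (b::real)}"
      by (rule countable_subset[OF _ countable_SIGMA[OF countable_rat, of "\<lambda>_. \<rat>"]]) (use countable_rat in auto)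
    show "\<forall>p\<in>{(a, b). a \<in> \<rat> \<and> b \<in> \<rat> \<and> 0 \<le> a \<and> a < b}. AE x in lborel. x \<notin> E (fst p) (snd p)"
      using null by (auto intro: AE_not_in)
  qed
  then show ?thesis
  proof eventually_elim
    case (elim x)
    show ?case
    proof (intro allI impI)
      fix b assume "w x < b"
      \<comment> \<open>Two rationals are placed between \<open>w x\<close> and \<open>b\<close>. As
        \<open>w x\<close> lies below \<open>a\<close>, the point can miss \<open>E a c\<close> only
        because the averages do not exceed \<open>c\<close> at all sufficiently small
        scales.\<close>
      obtain a where a: "a \<in> \<rat>" "w x < a" "a < b" using Rats_dense_in_real[OF \<open>w x < b\<close>] by auto
      obtain c where c: "c \<in> \<rat>" "a < c" "c < b" using Rats_dense_in_real[OF \<open>a < b\<close>] by auto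
      have "0 \<le> a" using a nonneg[of x] by linarith
      then have "x \<notin> E a c" using elim a c by auto
      then obtain n where n: "x \<notin> G c (1 / real (Suc n))" using a by (auto simp: E_def)
      show "\<exists>d>0. \<forall>r. 0 < r \<and> r < d \<longrightarrow>
        (\<integral>\<^sup>+t. w t * indicator (ball x r) t \<partial>lborel) \<le> ennreal b * emeasure lborel (ball x r)"
      proof (intro exI[of _ "1 / real (Suc n)"] conjI allI impI)
        fix r assume "0 < r \<and> r < 1 / real (Suc n)"
        then have "emeasure \<nu> (ball x r) \<le> ennreal c * emeasure lborel (ball x r)"
          using n unfolding G_def not_less[symmetric] by blast
        also have "\<dots> \<le> ennreal b * emeasure lborel (ball x r)"
          using c by (intro mult_right_mono ennreal_leI) auto
        finally show "(\<integral>\<^sup>+t. w t * indicator (ball x r) t \<partial>lborel) \<le> ennreal b * emeasure lborel (ball x r)"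
          by (simp add: em)
      qed simp
    qed
  qed
qed

text \<open>The differentiation bound for |g - q| is applied simultaneously to all q in a countable
  dense set, and q is then taken close to the value g(x). The cutoff to {c..d} ensures finite
  integrals and is invisible on small balls around an interior point.\<close>

lemma Lebesgue_points:
  fixes g :: "real \<Rightarrow> complex"
  assumes g [measurable]: "g \<in> borel_measurable borel"
    and fin: "(\<integral>\<^sup>+t. cmod (g t) * indicator {c..d} t \<partial>lborel) \<noteq> \<infinity>"
  shows "AE x in lborel. x \<in> {c<..<d} \<longrightarrow> (\<forall>e>0. \<exists>\<delta>>0. \<forall>r. 0 < r \<and> r < \<delta> \<longrightarrow>
    (\<integral>\<^sup>+t. cmod (g t - g x) * indicator (ball x r) t \<partial>lborel) \<le> ennreal (e * r))"
proof -
  obtain D :: "complex set" where D: "countable D" "\<And>U. open U \<Longrightarrow> U \<noteq> {} \<Longrightarrow> \<exists>q\<in>D. q \<in> U"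
    by (rule countable_dense_setE) blast
  let ?w = "\<lambda>q t. cmod (g t - q) * indicator {c..d} t"
  have "AE x in lborel. \<forall>q\<in>D. \<forall>b > ?w q x. \<exists>\<delta>>0. \<forall>r. 0 < r \<and> r < \<delta> \<longrightarrow>
    (\<integral>\<^sup>+t. ?w q t * indicator (ball x r) t \<partial>lborel) \<le> ennreal b * emeasure lborel (ball x r)"
    unfolding AE_ball_countable[OF D(1)]
  proof (intro ballI differentiation_upper_bound)
    fix q assume "q \<in> D"
    have "(\<integral>\<^sup>+t. ?w q t \<partial>lborel) \<le> (\<integral>\<^sup>+t. ennreal (cmod (g t) * indicator {c..d} t) + ennreal (cmod q) * indicator {c..d} t \<partial>lborel)"
      by (intro nn_integral_mono) (auto simp: indicator_def ennreal_plus[symmetric] norm_triangle_ineq4 simp del: ennreal_plus intro!: ennreal_leI)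
    also have "\<dots> = (\<integral>\<^sup>+t. cmod (g t) * indicator {c..d} t \<partial>lborel) + ennreal (cmod q) * emeasure lborel {c..d}"
      by (subst nn_integral_add) (auto simp: nn_integral_cmult_indicator)
    also have "\<dots> < \<infinity>"
      using fin by (auto simp: top.not_eq_extremum[symmetric] ennreal_mult_eq_top_iff emeasure_lborel_Icc_eq)
    finally show "(\<integral>\<^sup>+t. ?w q t \<partial>lborel) \<noteq> \<infinity>" by simp
  qed auto
  then show ?thesis
  proof eventually_elim
    case (elim x)
    show ?case
    proof (intro impI allI)
      fix e :: real assume x: "x \<in> {c<..<d}" and e: "0 < e"
      \<comment> \<open>A ball of radius r has length 2 r, and e / 8 is used once for the average of
        |g - q| and once for |g(x) - q|; the total e r / 2 stays below e r.\<close>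
      obtain q where q: "q \<in> D" "q \<in> ball (g x) (e / 8)" using D(2)[of "ball (g x) (e / 8)"] e by auto
      have dq: "cmod (g x - q) < e / 8" using q(2) by (simp add: dist_norm)
      have "?w q x < e / 8" using dq x by simp
      then obtain \<delta> where \<delta>: "\<delta> > 0" "\<And>r. 0 < r \<Longrightarrow> r < \<delta> \<Longrightarrow>
          (\<integral>\<^sup>+t. ?w q t * indicator (ball x r) t \<partial>lborel) \<le> ennreal (e / 8) * emeasure lborel (ball x r)"
        using elim q(1) by blast
      obtain \<delta>' where \<delta>': "\<delta>' > 0" "ball x \<delta>' \<subseteq> {c<..<d}"
        using x open_contains_ball[of "{c<..<d}"] open_greaterThanLessThan by metis
      show "\<exists>\<delta>>0. \<forall>r. 0 < r \<and> r < \<delta> \<longrightarrow>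
        (\<integral>\<^sup>+t. cmod (g t - g x) * indicator (ball x r) t \<partial>lborel) \<le> ennreal (e * r)"
      proof (intro exI[of _ "min \<delta> \<delta>'"] conjI allI impI)
        fix r assume r: "0 < r \<and> r < min \<delta> \<delta>'"
        have sub: "ball x r \<subseteq> {c<..<d}" using r \<delta>' subset_ball[of r \<delta>' x] by auto
        have em: "emeasure lborel (ball x r) = ennreal (2 * r)"
          using r by (simp add: ball_eq_greaterThanLessThan)
        have "(\<integral>\<^sup>+t. cmod (g t - g x) * indicator (ball x r) t \<partial>lborel)
            \<le> (\<integral>\<^sup>+t. ennreal (?w q t * indicator (ball x r) t) + ennreal (e / 8) * indicator (ball x r) t \<partial>lborel)"
        proof (intro nn_integral_mono)
          fix t
          show "ennreal (cmod (g t - g x) * indicator (ball x r) t)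
            \<le> ennreal (?w q t * indicator (ball x r) t) + ennreal (e / 8) * indicator (ball x r) t"
          proof (cases "t \<in> ball x r")
            case True
            then have "t \<in> {c..d}" using sub by force
            have "cmod (g t - g x) \<le> cmod (g t - q) + e / 8"
              using norm_triangle_ineq4[of "g t - q" "g x - q"] dq by simp
            then show ?thesis
              using True \<open>t \<in> {c..d}\<close> e by (simp add: ennreal_plus[symmetric] ennreal_leI del: ennreal_plus)
          qed simp
        qed
        also have "\<dots> = (\<integral>\<^sup>+t. ?w q t * indicator (ball x r) t \<partial>lborel) + ennreal (e / 8) * emeasure lborel (ball x r)"
        proof -
          have [measurable]: "ball x r \<in> sets borel" by simp
          show ?thesis
            by (subst nn_integral_cmult_indicator[symmetric], simp, rule nn_integral_add) measurable
        qed
        also have "\<dots> \<le> ennreal (e / 8) * emeasure lborel (ball x r) + ennreal (e / 8) * emeasure lborel (ball x r)"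
          using \<delta>(2)[of r] r by (intro add_right_mono) auto
        also have "\<dots> = ennreal (e / 8 * (2 * r) + e / 8 * (2 * r))"
          using r e by (simp add: em ennreal_mult[symmetric] ennreal_plus[symmetric] del: ennreal_plus)
        also have "\<dots> \<le> ennreal (e * r)"
          using r e by (intro ennreal_leI) simp
        finally show "(\<integral>\<^sup>+t. cmod (g t - g x) * indicator (ball x r) t \<partial>lborel) \<le> ennreal (e * r)" .
      qed (use \<delta> \<delta>' in auto)
    qed
  qed
qed

section \<open>Transfer of Lebesgue points from the line to the circle\<close>

text \<open>Near \<open>x\<close> the derivative of \<open>cis\<close> has modulus 1, so chords are
  at least half the parameter distance. On the remaining compact parameter set the chord to
  \<open>cis x\<close> is bounded below, because an interior \<open>x\<close> shares its image with
  no other parameter, the endpoints included. Short chords therefore come only from nearby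
  parameters.\<close>

lemma cis_dist_lower_bound:
  assumes x: "x \<in> {0<..<2 * pi}"
  obtains \<rho> where "\<rho> > 0" "\<And>t. t \<in> {0..2 * pi} \<Longrightarrow> dist (cis t) (cis x) \<le> \<rho> \<Longrightarrow> \<bar>t - x\<bar> \<le> 2 * dist (cis t) (cis x)"
proof -
  have "(cis has_vector_derivative \<i> * cis x) (at x)"
    unfolding cis_conv_exp by (auto intro!: derivative_eq_intros has_vector_derivative_real_field simp: mult_ac)
  then have "(cis has_derivative (\<lambda>h. h *\<^sub>R (\<i> * cis x))) (at x)"
    by (simp add: has_vector_derivative_def)
  then obtain \<delta> where \<delta>: "\<delta> > 0"
    "\<And>t. norm (t - x) < \<delta> \<Longrightarrow> norm (cis t - cis x - (t - x) *\<^sub>R (\<i> * cis x)) \<le> (1 / 2) * norm (t - x)"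
    unfolding has_derivative_at_alt by (metis half_gt_zero_iff zero_less_one)
  have near: "\<bar>t - x\<bar> \<le> 2 * dist (cis t) (cis x)" if "\<bar>t - x\<bar> < \<delta>" for t
  proof -
    have "norm ((t - x) *\<^sub>R (\<i> * cis x)) \<le> norm (cis t - cis x) + norm (cis t - cis x - (t - x) *\<^sub>R (\<i> * cis x))"
      using norm_triangle_ineq4[of "cis t - cis x" "cis t - cis x - (t - x) *\<^sub>R (\<i> * cis x)"] by simp
    then show ?thesis using \<delta>(2)[of t] that by (simp add: norm_mult dist_norm)
  qed
  define K where "K = {0..2 * pi} - ball x \<delta>"
  have "compact K" unfolding K_def by (intro compact_diff) auto
  then have cK: "compact ((\<lambda>t. dist (cis t) (cis x)) ` K)"
    by (intro compact_continuous_image continuous_intros)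
  have pos: "dist (cis t) (cis x) > 0" if "t \<in> K" for t
  proof -
    have "t \<noteq> x" using that \<delta>(1) by (auto simp: K_def)
    have "cis t \<noteq> cis x"
    proof
      assume eq: "cis t = cis x"
      show False
      proof (cases "t < 2 * pi")
        case True
        then show False using Arg2pi_cis[of t] Arg2pi_cis[of x] eq \<open>t \<noteq> x\<close> x that by (auto simp: K_def)
      next
        case False
        then have "cis x = cis 0" using that eq by (auto simp: K_def)
        then show False using Arg2pi_cis[of x] Arg2pi_cis[of 0] x by auto
      qed
    qed
    then show ?thesis by simp
  qed
  obtain m where m: "m > 0" "\<And>t. t \<in> K \<Longrightarrow> m \<le> dist (cis t) (cis x)"
  proof (cases "K = {}")
    case True
    then show ?thesis using that[of 1] by auto
  next
    case False
    then obtain s where "s \<in> K" "\<And>t. t \<in> K \<Longrightarrow> dist (cis s) (cis x) \<le> dist (cis t) (cis x)"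
      using compact_attains_inf[OF cK] by auto
    then show ?thesis using that[of "dist (cis s) (cis x)"] pos by blast
  qed
  show ?thesis
  \<comment> \<open>Half of the minimal chord \<open>m\<close>, so that a chord of length at most
    \<open>m / 2\<close> excludes parameters in \<open>K\<close>.\<close>
  proof (rule that[of "m / 2"])
    fix t assume "t \<in> {0..2 * pi}" "dist (cis t) (cis x) \<le> m / 2"
    then have "t \<notin> K" using m by fastforce
    then have "\<bar>t - x\<bar> < \<delta>" using \<open>t \<in> {0..2 * pi}\<close> by (auto simp: K_def dist_real_def abs_minus_commute)
    then show "\<bar>t - x\<bar> \<le> 2 * dist (cis t) (cis x)" by (rule near)
  qed (use m in simp)
qed

text \<open>A small chordal disk around \<open>cis x\<close> pulls back into a parameter interval of
  comparable size. The comparison factor 3 is absorbed by the normalization 1 / (2 pi).\<close>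

lemma Lebesgue_points_circle:
  fixes g :: "complex \<Rightarrow> complex"
  assumes g [measurable]: "g \<in> borel_measurable borel" and int: "integrable circle_measure g"
  shows "AE \<zeta> in circle_measure. \<forall>e>0. \<exists>\<rho>\<^sub>0>0. \<forall>\<rho>. 0 < \<rho> \<and> \<rho> \<le> \<rho>\<^sub>0 \<longrightarrow>
    (\<integral>\<^sup>+\<xi>. ennreal (cmod (g \<xi> - g \<zeta>)) * indicator {\<xi>. dist \<xi> \<zeta> \<le> \<rho>} \<xi> \<partial>circle_measure) \<le> ennreal (e * \<rho>)"
proof (rule AE_circleI)
  have "(\<integral>\<^sup>+\<xi>. ennreal (cmod (g \<xi>)) \<partial>circle_measure) < \<infinity>"
    using int by (simp add: integrable_iff_bounded)
  then have "(\<integral>\<^sup>+t. ennreal (cmod (g (cis t))) * indicator {0..2 * pi} t \<partial>lborel) / ennreal (2 * pi) < \<infinity>"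
    by (subst (asm) nn_integral_circle) measurable
  then have fin: "(\<integral>\<^sup>+t. cmod (g (cis t)) * indicator {0..2 * pi} t \<partial>lborel) \<noteq> \<infinity>"
    by (auto simp: ennreal_mult' ennreal_indicator[symmetric] ennreal_top_divide ennreal_mult_eq_top_iff)
  have "AE x in lborel. x \<in> {0<..<2 * pi} \<longrightarrow> (\<forall>e>0. \<exists>\<delta>>0. \<forall>r. 0 < r \<and> r < \<delta> \<longrightarrow>
    (\<integral>\<^sup>+t. cmod (g (cis t) - g (cis x)) * indicator (ball x r) t \<partial>lborel) \<le> ennreal (e * r))"
    by (rule Lebesgue_points[OF _ fin]) measurable
  then show "AE x in lborel. x \<in> {0<..<2 * pi} \<longrightarrow> (\<forall>e>0. \<exists>\<rho>\<^sub>0>0. \<forall>\<rho>. 0 < \<rho> \<and> \<rho> \<le> \<rho>\<^sub>0 \<longrightarrow>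
    (\<integral>\<^sup>+\<xi>. ennreal (cmod (g \<xi> - g (cis x))) * indicator {\<xi>. dist \<xi> (cis x) \<le> \<rho>} \<xi> \<partial>circle_measure) \<le> ennreal (e * \<rho>))"
  proof eventually_elim
    case (elim x)
    show ?case
    proof (intro impI allI)
      fix e :: real assume x: "x \<in> {0<..<2 * pi}" and e: "0 < e"
      obtain \<rho>1 where \<rho>1: "\<rho>1 > 0"
        "\<And>t. t \<in> {0..2 * pi} \<Longrightarrow> dist (cis t) (cis x) \<le> \<rho>1 \<Longrightarrow> \<bar>t - x\<bar> \<le> 2 * dist (cis t) (cis x)"
        using cis_dist_lower_bound[OF x] by blast
      obtain \<delta> where \<delta>: "\<delta> > 0" "\<And>r. 0 < r \<Longrightarrow> r < \<delta> \<Longrightarrow>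
          (\<integral>\<^sup>+t. cmod (g (cis t) - g (cis x)) * indicator (ball x r) t \<partial>lborel) \<le> ennreal (e * r)"
        using elim x e by blast
      show "\<exists>\<rho>\<^sub>0>0. \<forall>\<rho>. 0 < \<rho> \<and> \<rho> \<le> \<rho>\<^sub>0 \<longrightarrow>
        (\<integral>\<^sup>+\<xi>. ennreal (cmod (g \<xi> - g (cis x))) * indicator {\<xi>. dist \<xi> (cis x) \<le> \<rho>} \<xi> \<partial>circle_measure) \<le> ennreal (e * \<rho>)"
      \<comment> \<open>The chord bound gives parameter distance at most 2 \<rho>, and radius 3
        \<rho> makes the surrounding ball open. With \<rho> \<le> \<delta> / 6 this radius stays
        below \<delta>.\<close>
      proof (intro exI[of _ "min \<rho>1 (\<delta> / 6)"] conjI allI impI)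
        fix \<rho> assume \<rho>: "0 < \<rho> \<and> \<rho> \<le> min \<rho>1 (\<delta> / 6)"
        have m: "{\<xi>. dist \<xi> (cis x) \<le> \<rho>} \<in> sets borel" by measurable
        have "(\<integral>\<^sup>+\<xi>. ennreal (cmod (g \<xi> - g (cis x))) * indicator {\<xi>. dist \<xi> (cis x) \<le> \<rho>} \<xi> \<partial>circle_measure)
          = (\<integral>\<^sup>+t. ennreal (cmod (g (cis t) - g (cis x))) * indicator {\<xi>. dist \<xi> (cis x) \<le> \<rho>} (cis t)
              * indicator {0..2 * pi} t \<partial>lborel) / ennreal (2 * pi)"
          using m by (intro nn_integral_circle) measurable
        also have "\<dots> \<le> (\<integral>\<^sup>+t. cmod (g (cis t) - g (cis x)) * indicator (ball x (3 * \<rho>)) t \<partial>lborel) / ennreal (2 * pi)"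
        proof (intro divide_right_mono_ennreal nn_integral_mono)
          fix t
          have "t \<in> ball x (3 * \<rho>)" if "t \<in> {0..2 * pi}" "dist (cis t) (cis x) \<le> \<rho>"
            using \<rho>1(2)[OF that(1)] that(2) \<rho> by (simp add: dist_real_def abs_minus_commute)
          then show "ennreal (cmod (g (cis t) - g (cis x))) * indicator {\<xi>. dist \<xi> (cis x) \<le> \<rho>} (cis t) * indicator {0..2 * pi} t
            \<le> ennreal (cmod (g (cis t) - g (cis x)) * indicator (ball x (3 * \<rho>)) t)"
            by (auto simp: indicator_def simp del: mem_ball)
        qed
        also have "\<dots> \<le> ennreal (e * (3 * \<rho>)) / ennreal (2 * pi)"
          by (intro divide_right_mono_ennreal \<delta>) (use \<rho> \<delta>(1) in auto)
        also have "\<dots> = ennreal (e * (3 * \<rho>) / (2 * pi))"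
          using e \<rho> by (intro divide_ennreal) auto
        also have "\<dots> \<le> ennreal (e * \<rho>)"
        proof (rule ennreal_leI)
          have "e * \<rho> * 3 \<le> e * \<rho> * (2 * pi)" using e \<rho> pi_gt3 by (intro mult_left_mono) auto
          then show "e * (3 * \<rho>) / (2 * pi) \<le> e * \<rho>" by (simp add: pos_divide_le_eq mult_ac)
        qed
        finally show "(\<integral>\<^sup>+\<xi>. ennreal (cmod (g \<xi> - g (cis x))) * indicator {\<xi>. dist \<xi> (cis x) \<le> \<rho>} \<xi> \<partial>circle_measure) \<le> ennreal (e * \<rho>)" .
      qed (use \<rho>1 \<delta> in auto)
    qed
  qed
qed

section \<open>Dyadic estimates for Poisson-type kernels\<close>

text \<open>A single summand already dominates: take the least k with d \<le> 2^k h. For k > 0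
  minimality gives d > 2^(k-1) h, so the kernel is at most 4^(-(k-1)) / h; the shift from k - 1 to k
  is the factor 4. For k = 0 the trivial bound 1 / h suffices.\<close>

lemma dyadic_kernel_bound:
  fixes d h :: real
  assumes "0 \<le> d" "0 < h"
  shows "ennreal (h / (h + d)\<^sup>2) \<le> (\<Sum>k. ennreal (4 * (1 / 4) ^ k / h) * indicator {y. y \<le> 2 ^ k * h} d)"
proof -
  define P where "P k \<longleftrightarrow> d \<le> 2 ^ k * h" for k :: nat
  obtain n where "d / h < 2 ^ n" using real_arch_pow[of 2 "d / h"] by auto
  then have "P n" using assms by (simp add: P_def field_simps)
  define k where "k = (LEAST k. P k)"
  have Pk: "P k" unfolding k_def using \<open>P n\<close> by (rule LeastI)
  have "h / (h + d)\<^sup>2 \<le> 4 * (1 / 4) ^ k / h"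
  proof (cases k)
    case 0
    have "h / (h + d)\<^sup>2 \<le> h / h\<^sup>2" using assms by (intro divide_left_mono power_mono) auto
    also have "\<dots> \<le> 4 / h" using assms by (simp add: power2_eq_square field_simps)
    finally show ?thesis using 0 by simp
  next
    case (Suc j)
    then have "\<not> P j" using not_less_Least[of j P] by (simp add: k_def)
    then have "2 ^ j * h \<le> h + d" using assms by (simp add: P_def)
    then have "h / (h + d)\<^sup>2 \<le> h / (2 ^ j * h)\<^sup>2" using assms by (intro divide_left_mono power_mono) auto
    also have "\<dots> = 4 * (1 / 4) ^ k / h"
      using assms Suc by (simp add: power2_eq_square field_simps power_mult_distrib[symmetric])
    finally show ?thesis .
  qed
  then have "ennreal (h / (h + d)\<^sup>2) \<le> ennreal (4 * (1 / 4) ^ k / h) * indicator {y. y \<le> 2 ^ k * h} d"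
    using Pk by (auto simp: P_def intro: ennreal_leI)
  also have "\<dots> \<le> (\<Sum>k. ennreal (4 * (1 / 4) ^ k / h) * indicator {y. y \<le> 2 ^ k * h} d)"
  proof -
    define f where "f k = ennreal (4 * (1 / 4) ^ k / h) * indicator {y. y \<le> 2 ^ k * h} d" for k
    have "sum f {k} \<le> suminf f" by (rule sum_le_suminf) auto
    then have "f k \<le> suminf f" by simp
    then show ?thesis unfolding f_def .
  qed
  finally show ?thesis .
qed

text \<open>The k-th dyadic ball contributes at most (4 * 4^(-k) / h) * (e 2^k h) = 4 e 2^(-k), and
  these sum to 8 e. The bound is independent of \<open>h\<close>, hence uniform as the boundary is
  approached.\<close>

lemma nn_integral_dyadic_kernel:
  fixes w :: "'a \<Rightarrow> ennreal" and d :: "'a \<Rightarrow> real"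
  assumes [measurable]: "w \<in> borel_measurable M" "d \<in> borel_measurable M" and d: "\<And>x. 0 \<le> d x"
    and h: "0 < h" and e: "0 \<le> e"
    and bound: "\<And>\<rho>. 0 < \<rho> \<Longrightarrow> (\<integral>\<^sup>+x. w x * indicator {x. d x \<le> \<rho>} x \<partial>M) \<le> ennreal (e * \<rho>)"
  shows "(\<integral>\<^sup>+x. w x * ennreal (h / (h + d x)\<^sup>2) \<partial>M) \<le> ennreal (8 * e)"
proof -
  have "(\<integral>\<^sup>+x. w x * ennreal (h / (h + d x)\<^sup>2) \<partial>M)
    \<le> (\<integral>\<^sup>+x. (\<Sum>k. ennreal (4 * (1 / 4) ^ k / h) * (w x * indicator {x. d x \<le> 2 ^ k * h} x)) \<partial>M)"
  proof (intro nn_integral_mono)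
    fix x
    have "w x * ennreal (h / (h + d x)\<^sup>2) \<le> w x * (\<Sum>k. ennreal (4 * (1 / 4) ^ k / h) * indicator {y. y \<le> 2 ^ k * h} (d x))"
      by (intro mult_left_mono dyadic_kernel_bound d h) auto
    also have "\<dots> = (\<Sum>k. ennreal (4 * (1 / 4) ^ k / h) * (w x * indicator {x. d x \<le> 2 ^ k * h} x))"
      unfolding ennreal_suminf_cmult[symmetric] by (intro suminf_cong) (simp add: indicator_def mult.commute)
    finally show "w x * ennreal (h / (h + d x)\<^sup>2) \<le> (\<Sum>k. ennreal (4 * (1 / 4) ^ k / h) * (w x * indicator {x. d x \<le> 2 ^ k * h} x))" .
  qed
  also have "\<dots> = (\<Sum>k. \<integral>\<^sup>+x. ennreal (4 * (1 / 4) ^ k / h) * (w x * indicator {x. d x \<le> 2 ^ k * h} x) \<partial>M)"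
    by (rule nn_integral_suminf) measurable
  also have "\<dots> = (\<Sum>k. ennreal (4 * (1 / 4) ^ k / h) * (\<integral>\<^sup>+x. w x * indicator {x. d x \<le> 2 ^ k * h} x \<partial>M))"
    by (intro suminf_cong nn_integral_cmult) measurable
  also have "\<dots> \<le> (\<Sum>k. ennreal (4 * e * (1 / 2) ^ k))"
  proof (intro suminf_le allI)
    fix k :: nat
    have "ennreal (4 * (1 / 4) ^ k / h) * (\<integral>\<^sup>+x. w x * indicator {x. d x \<le> 2 ^ k * h} x \<partial>M)
      \<le> ennreal (4 * (1 / 4) ^ k / h) * ennreal (e * (2 ^ k * h))"
      by (intro mult_left_mono bound) (use h in auto)
    also have "\<dots> = ennreal (4 * (1 / 4) ^ k / h * (e * (2 ^ k * h)))"
      using h e by (intro ennreal_mult[symmetric]) auto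
    also have "4 * (1 / 4) ^ k / h * (e * (2 ^ k * h)) = 4 * e * ((1 / 4) ^ k * 2 ^ k)"
      using h by simp
    also have "(1 / 4) ^ k * 2 ^ k = (1 / 2 :: real) ^ k" by (simp add: power_mult_distrib[symmetric])
    finally show "ennreal (4 * (1 / 4) ^ k / h) * (\<integral>\<^sup>+x. w x * indicator {x. d x \<le> 2 ^ k * h} x \<partial>M) \<le> ennreal (4 * e * (1 / 2) ^ k)" .
  qed auto
  also have "\<dots> = ennreal (\<Sum>k. 4 * e * (1 / 2) ^ k)"
    using e by (intro suminf_ennreal2) (auto intro!: summable_mult summable_geometric)
  also have "(\<Sum>k. 4 * e * (1 / 2) ^ k) = 8 * e"
    using suminf_geometric[of "1/2::real"] by (subst suminf_mult) (auto simp: summable_geometric)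
  finally show ?thesis .
qed

section \<open>Poisson integrals and non-tangential limits\<close>

definition poisson :: "complex \<Rightarrow> complex \<Rightarrow> real" where
  "poisson z \<zeta> = (1 - (cmod z)\<^sup>2) / (cmod (\<zeta> - z))\<^sup>2"

lemma borel_measurable_poisson [measurable]: "poisson z \<in> borel_measurable borel"
  unfolding poisson_def[abs_def] by measurable

lemma poisson_nonneg: "cmod z < 1 \<Longrightarrow> 0 \<le> poisson z \<zeta>"
  by (simp add: poisson_def abs_square_le_1)

text \<open>With a = z * cnj \<zeta>, the geometric series of a and of its conjugate add up to (1 -
  |a|^2) / |1 - a|^2, and |1 - a| = |\<zeta> - z|. The exponent \<open>Suc k\<close> in the second
  family counts the constant frequency once and leaves there only positive powers of
  \<zeta>.\<close>

lemma poisson_series: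
  assumes "cmod z < 1" "cmod \<zeta> = 1"
  shows "(\<lambda>k. (z * cnj \<zeta>) ^ k + (cnj z * \<zeta>) ^ Suc k) sums of_real (poisson z \<zeta>)"
proof -
  define a where "a = z * cnj \<zeta>"
  have \<zeta>: "\<zeta> * cnj \<zeta> = 1" using assms(2) by (simp add: complex_norm_square[symmetric])
  have a: "cmod a < 1" using assms by (simp add: a_def norm_mult)
  then have ne: "1 - a \<noteq> 0" "1 - cnj a \<noteq> 0"
    by (metis eq_iff_diff_eq_0 norm_one less_irrefl, metis eq_iff_diff_eq_0 complex_mod_cnj norm_one less_irrefl)
  have "cmod (1 - a) = cmod (\<zeta> - z)"
  proof -
    have "\<zeta> * (1 - a) = \<zeta> - z" using \<zeta> by (simp add: a_def algebra_simps)
    then have "cmod \<zeta> * cmod (1 - a) = cmod (\<zeta> - z)" by (metis norm_mult)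
    then show ?thesis using assms(2) by simp
  qed
  have "(\<lambda>k. a ^ k + cnj a * cnj a ^ k) sums (1 / (1 - a) + cnj a * (1 / (1 - cnj a)))"
    using a by (intro sums_add sums_mult geometric_sums) auto
  moreover have "1 / (1 - a) + cnj a * (1 / (1 - cnj a)) = (1 - a * cnj a) / ((1 - a) * cnj (1 - a))"
    using ne by (simp add: field_simps)
  moreover have "\<dots> = of_real (poisson z \<zeta>)"
    using \<open>cmod (1 - a) = cmod (\<zeta> - z)\<close> assms
    unfolding complex_norm_square[symmetric] by (simp add: poisson_def a_def norm_mult)
  ultimately show ?thesis by (simp add: a_def mult.commute[of "cnj z"])
qed

lemma integrable_circle_mult_bounded:
  fixes g :: "complex \<Rightarrow> complex"
  assumes "integrable circle_measure g" "h \<in> borel_measurable circle_measure" "AE \<zeta> in circle_measure. cmod (h \<zeta>) \<le> C"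
  shows "integrable circle_measure (\<lambda>\<zeta>. g \<zeta> * h \<zeta>)"
proof (rule Bochner_Integration.integrable_bound)
  show "integrable circle_measure (\<lambda>\<zeta>. C * cmod (g \<zeta>))" using assms by simp
  show "(\<lambda>\<zeta>. g \<zeta> * h \<zeta>) \<in> borel_measurable circle_measure"
    using assms(2) borel_measurable_integrable[OF assms(1)] by measurable
  show "AE \<zeta> in circle_measure. norm (g \<zeta> * h \<zeta>) \<le> norm (C * cmod (g \<zeta>))"
    using assms(3)
  proof eventually_elim
    case (elim \<zeta>)
    then have "cmod (h \<zeta>) * cmod (g \<zeta>) \<le> C * cmod (g \<zeta>)" by (rule mult_right_mono) simp
    then show ?case using abs_ge_self[of "C * cmod (g \<zeta>)"] by (simp add: norm_mult mult.commute)
  qed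
qed

text \<open>Vanishing moments annihilate the half of the Poisson series with positive powers of
  \<zeta>. What remains is the Cauchy series, which is why an analytic function arises from a
  Poisson integral.\<close>

lemma poisson_integral_sums:
  assumes g: "integrable circle_measure g" and z: "cmod z < 1"
    and moments: "\<And>n. n > 0 \<Longrightarrow> (\<integral>\<zeta>. g \<zeta> * \<zeta> ^ n \<partial>circle_measure) = 0"
  shows "(\<lambda>k. (\<integral>\<zeta>. g \<zeta> * cnj (\<zeta> ^ k) \<partial>circle_measure) * z ^ k) sums (\<integral>\<zeta>. g \<zeta> * of_real (poisson z \<zeta>) \<partial>circle_measure)"
proof -
  let ?v = "\<lambda>k \<zeta>. (z * cnj \<zeta>) ^ k + (cnj z * \<zeta>) ^ Suc k"
  have b: "summable (\<lambda>k. 2 * cmod z ^ k)" using z by (intro summable_mult summable_geometric) simp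
  have m: "?v k \<in> borel_measurable circle_measure" for k by (rule borel_measurable_circle) measurable
  have bound: "AE \<zeta> in circle_measure. \<forall>k. cmod (?v k \<zeta>) \<le> 2 * cmod z ^ k"
    using AE_circle_norm
  proof eventually_elim
    case (elim \<zeta>)
    have "cmod (?v k \<zeta>) \<le> 2 * cmod z ^ k" for k
    proof -
      have "cmod (?v k \<zeta>) \<le> cmod ((z * cnj \<zeta>) ^ k) + cmod ((cnj z * \<zeta>) ^ Suc k)" by (rule norm_triangle_ineq)
      also have "\<dots> = cmod z ^ k + cmod z ^ Suc k"
        unfolding norm_power norm_mult complex_mod_cnj elim by simp
      also have "\<dots> \<le> 2 * cmod z ^ k"
        using mult_right_mono[of "cmod z" 1 "cmod z ^ k"] z by simp
      finally show ?thesis .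
    qed
    then show ?case by blast
  qed
  have s: "AE \<zeta> in circle_measure. (\<lambda>k. ?v k \<zeta>) sums of_real (poisson z \<zeta>)"
    using AE_circle_norm by eventually_elim (rule poisson_series[OF z])
  have "(\<integral>\<zeta>. g \<zeta> * ?v k \<zeta> \<partial>circle_measure) = (\<integral>\<zeta>. g \<zeta> * cnj (\<zeta> ^ k) \<partial>circle_measure) * z ^ k" for k
  proof -
    have pw: "AE \<zeta> in circle_measure. cmod (\<zeta> ^ n) \<le> 1" "AE \<zeta> in circle_measure. cmod (cnj (\<zeta> ^ n)) \<le> 1" for n
      using AE_circle_norm by (eventually_elim; simp add: norm_power)+
    have i1: "integrable circle_measure (\<lambda>\<zeta>. g \<zeta> * \<zeta> ^ Suc k)"
      by (rule integrable_circle_mult_bounded[OF g borel_measurable_power_circle pw(1)])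
    have i2: "integrable circle_measure (\<lambda>\<zeta>. g \<zeta> * cnj (\<zeta> ^ k))"
      by (rule integrable_circle_mult_bounded[OF g _ pw(2)]) (rule borel_measurable_circle, measurable)
    have "(\<lambda>\<zeta>. g \<zeta> * ?v k \<zeta>) = (\<lambda>\<zeta>. z ^ k * (g \<zeta> * cnj (\<zeta> ^ k)) + cnj z ^ Suc k * (g \<zeta> * \<zeta> ^ Suc k))"
      by (simp add: power_mult_distrib algebra_simps)
    then have "(\<integral>\<zeta>. g \<zeta> * ?v k \<zeta> \<partial>circle_measure)
      = z ^ k * (\<integral>\<zeta>. g \<zeta> * cnj (\<zeta> ^ k) \<partial>circle_measure) + cnj z ^ Suc k * (\<integral>\<zeta>. g \<zeta> * \<zeta> ^ Suc k \<partial>circle_measure)"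
      using i1 i2 by (simp only:) (subst Bochner_Integration.integral_add; simp)
    then show ?thesis using moments[of "Suc k"] by simp
  qed
  with integral_circle_sums(1)[OF g b m bound s] show ?thesis by simp
qed

lemma integral_poisson:
  assumes "cmod z < 1"
  shows "(\<integral>\<zeta>. complex_of_real (poisson z \<zeta>) \<partial>circle_measure) = 1"
proof -
  have "(\<integral>\<zeta>. cnj (\<zeta> ^ k) \<partial>circle_measure) = (if k = 0 then 1 else 0)" for k
  proof -
    have "(\<integral>\<zeta>. cnj (\<zeta> ^ k) \<partial>circle_measure) = cnj (\<integral>\<zeta>. \<zeta> ^ k \<partial>circle_measure)"
      by (rule Bochner_Integration.integral_cnj)
    then show ?thesis using integral_circle_power[of k] by auto
  qed
  then have "(\<lambda>k. (if k = 0 then 1 else 0) * z ^ k) sums (\<integral>\<zeta>. 1 * of_real (poisson z \<zeta>) \<partial>circle_measure)"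
    using poisson_integral_sums[of "\<lambda>_. 1" z] assms integral_circle_power by simp
  moreover have "(\<lambda>k. (if k = 0 then 1 else 0) * z ^ k) = (\<lambda>k. if k = 0 then (1::complex) else 0)" by auto
  ultimately have "(\<lambda>k. if k = 0 then 1 else 0) sums (\<integral>\<zeta>. 1 * complex_of_real (poisson z \<zeta>) \<partial>circle_measure)"
    by (simp only:)
  from sums_unique2[OF this sums_single[of 0 "\<lambda>_. 1"]] show ?thesis by simp
qed

lemma poisson_le:
  assumes "cmod z < 1" "cmod \<zeta> = 1"
  shows "poisson z \<zeta> \<le> (1 - (cmod z)\<^sup>2) / (1 - cmod z)\<^sup>2"
proof -
  have "1 - cmod z \<le> cmod (\<zeta> - z)" using norm_triangle_ineq2[of \<zeta> z] assms by simp
  then show ?thesis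
    unfolding poisson_def using assms
    by (intro divide_left_mono power_mono mult_pos_pos zero_less_power) (auto simp: abs_square_le_1)
qed

text \<open>Both 1 - |z| and, up to the factor 1 + \<alpha>, dist \<xi> \<zeta> are bounded by
  |\<xi> - z|; adding them gives 2 + \<alpha>. The remaining factor 2 comes from 1 - |z|^2 \<le> 2
  (1 - |z|). The right side is the kernel of the dyadic estimate with h = 1 - |z|.\<close>

lemma poisson_stolz_le:
  assumes z: "z \<in> stolz_region \<alpha> \<zeta>" and "cmod \<xi> = 1" "\<alpha> > 0"
  shows "poisson z \<xi> \<le> 2 * (2 + \<alpha>)\<^sup>2 * ((1 - cmod z) / (1 - cmod z + dist \<xi> \<zeta>)\<^sup>2)"
proof -
  let ?h = "1 - cmod z"
  have z1: "cmod z < 1" "cmod (z - \<zeta>) < \<alpha> * ?h" using z by (auto simp: stolz_region_def)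
  have h: "?h \<le> cmod (\<xi> - z)" using norm_triangle_ineq2[of \<xi> z] assms by simp
  have "dist \<xi> \<zeta> \<le> cmod (\<xi> - z) + cmod (z - \<zeta>)" using norm_triangle_ineq[of "\<xi> - z" "z - \<zeta>"] by (simp add: dist_norm)
  also have "\<dots> \<le> cmod (\<xi> - z) + \<alpha> * cmod (\<xi> - z)"
  proof -
    have "\<alpha> * ?h \<le> \<alpha> * cmod (\<xi> - z)" using h assms(3) by (intro mult_left_mono) auto
    then show ?thesis using z1 by linarith
  qed
  finally have "?h + dist \<xi> \<zeta> \<le> (2 + \<alpha>) * cmod (\<xi> - z)" using h by (simp add: algebra_simps)
  then have sq: "(?h + dist \<xi> \<zeta>)\<^sup>2 \<le> (2 + \<alpha>)\<^sup>2 * (cmod (\<xi> - z))\<^sup>2"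
    using z1 unfolding power_mult_distrib[symmetric] by (intro power_mono) auto
  have pos: "0 < (?h + dist \<xi> \<zeta>)\<^sup>2" "0 < (cmod (\<xi> - z))\<^sup>2"
  proof -
    have "0 < ?h" "0 \<le> dist \<xi> \<zeta>" using z1 by auto
    then have "0 < ?h + dist \<xi> \<zeta>" "0 < cmod (\<xi> - z)" using h by linarith+
    then show "0 < (?h + dist \<xi> \<zeta>)\<^sup>2" "0 < (cmod (\<xi> - z))\<^sup>2" by (auto intro!: zero_less_power)
  qed
  have "1 - (cmod z)\<^sup>2 = ?h * (1 + cmod z)" by (simp add: power2_eq_square algebra_simps)
  also have "\<dots> \<le> ?h * 2" using z1 by (intro mult_left_mono) auto
  finally have "poisson z \<xi> \<le> ?h * 2 / (cmod (\<xi> - z))\<^sup>2"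
    unfolding poisson_def by (rule divide_right_mono) simp
  also have "\<dots> \<le> 2 * (2 + \<alpha>)\<^sup>2 * (?h / (?h + dist \<xi> \<zeta>)\<^sup>2)"
  proof -
    have "?h * 2 * (?h + dist \<xi> \<zeta>)\<^sup>2 \<le> ?h * 2 * ((2 + \<alpha>)\<^sup>2 * (cmod (\<xi> - z))\<^sup>2)"
      using sq z1 by (intro mult_left_mono) auto
    moreover have "x * 2 / a \<le> 2 * B * (x / c)" if "x * 2 * c \<le> x * 2 * (B * a)" "0 < c" "0 < a" for x a B c :: real
      using that by (simp add: field_simps)
    ultimately show ?thesis using pos by blast
  qed
  finally show ?thesis .
qed

text \<open>On a Stolz region the Poisson kernel is dominated by a multiple of h / (h + d)^2, with h
  = 1 - |z| and d the distance to \<zeta>. Within \<rho>_0 of \<zeta> the Lebesgue condition and the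
  dyadic estimate give a bound 8 e uniform in h; farther out the kernel is at most h / \<rho>_0^2,
  which tends to 0.\<close>

lemma poisson_integral_nontangential:
  fixes g :: "complex \<Rightarrow> complex"
  assumes g [measurable]: "g \<in> borel_measurable borel" and int: "integrable circle_measure g" and \<zeta>: "cmod \<zeta> = 1"
    and leb: "\<forall>e>0. \<exists>\<rho>\<^sub>0>0. \<forall>\<rho>. 0 < \<rho> \<and> \<rho> \<le> \<rho>\<^sub>0 \<longrightarrow>
      (\<integral>\<^sup>+\<xi>. ennreal (cmod (g \<xi> - g \<zeta>)) * indicator {\<xi>. dist \<xi> \<zeta> \<le> \<rho>} \<xi> \<partial>circle_measure) \<le> ennreal (e * \<rho>)"
  shows "nontangential_limit (\<lambda>z. \<integral>\<xi>. g \<xi> * of_real (poisson z \<xi>) \<partial>circle_measure) \<zeta> (g \<zeta>)"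
  unfolding nontangential_limit_def
proof (intro allI impI)
  fix \<alpha> :: real assume \<alpha>: "1 < \<alpha>"
  let ?F = "\<lambda>z. \<integral>\<xi>. g \<xi> * of_real (poisson z \<xi>) \<partial>circle_measure"
  define w where "w \<xi> = cmod (g \<xi> - g \<zeta>)" for \<xi>
  have w [measurable]: "w \<in> borel_measurable circle_measure"
    unfolding w_def by (rule borel_measurable_circle) measurable
  have dm [measurable]: "(\<lambda>\<xi>. dist \<xi> \<zeta>) \<in> borel_measurable circle_measure"
    by (rule borel_measurable_circle) measurable
  have int_w: "integrable circle_measure w" unfolding w_def using int by simp
  define W where "W = (\<integral>\<xi>. w \<xi> \<partial>circle_measure)"
  have W: "0 \<le> W" unfolding W_def w_def by (rule Bochner_Integration.integral_nonneg) simp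
  have nnW: "(\<integral>\<^sup>+\<xi>. w \<xi> \<partial>circle_measure) = ennreal W"
    unfolding W_def by (rule nn_integral_eq_integral[OF int_w]) (simp add: w_def)
  define K where "K = 2 * (2 + \<alpha>)\<^sup>2"
  have K: "0 < K" using \<alpha> by (simp add: K_def)
  have bound: "cmod (?F z - g \<zeta>) \<le> K * (8 * e + (1 - cmod z) / \<rho>\<^sub>0\<^sup>2 * W)"
    if z: "z \<in> stolz_region \<alpha> \<zeta>" and \<rho>0: "\<rho>\<^sub>0 > 0" and e: "e > 0"
      and small: "\<And>\<rho>. 0 < \<rho> \<Longrightarrow> \<rho> \<le> \<rho>\<^sub>0 \<Longrightarrow>
        (\<integral>\<^sup>+\<xi>. ennreal (w \<xi>) * indicator {\<xi>. dist \<xi> \<zeta> \<le> \<rho>} \<xi> \<partial>circle_measure) \<le> ennreal (e * \<rho>)" for z \<rho>\<^sub>0 e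
  proof -
    have z1: "cmod z < 1" using z by (simp add: stolz_region_def)
    define h where "h = 1 - cmod z"
    have h: "0 < h" using z1 by (simp add: h_def)
    \<comment> \<open>Cutting the weight off at \<open>\<rho>\<^sub>0\<close> extends the linear
      bound, known only for small radii, to all radii as \<open>nn_integral_dyadic_kernel\<close>
      demands.\<close>
    define v where "v \<xi> = ennreal (w \<xi>) * indicator {\<xi>. dist \<xi> \<zeta> \<le> \<rho>\<^sub>0} \<xi>" for \<xi>
    have [measurable]: "v \<in> borel_measurable circle_measure"
      unfolding v_def by measurable
    have Pm: "(\<lambda>\<xi>. complex_of_real (poisson z \<xi>)) \<in> borel_measurable circle_measure"
      by (rule borel_measurable_circle) measurable
    have Pb: "AE \<xi> in circle_measure. cmod (of_real (poisson z \<xi>)) \<le> (1 - (cmod z)\<^sup>2) / (1 - cmod z)\<^sup>2"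
      using AE_circle_norm
      by eventually_elim (use poisson_le[OF z1] poisson_nonneg[OF z1] in simp)
    have i1: "integrable circle_measure (\<lambda>\<xi>. g \<xi> * of_real (poisson z \<xi>))"
      by (rule integrable_circle_mult_bounded[OF int Pm Pb])
    have i2: "integrable circle_measure (\<lambda>\<xi>. g \<zeta> * of_real (poisson z \<xi>))"
      by (rule integrable_circle_mult_bounded[OF _ Pm Pb]) simp
    have i3: "integrable circle_measure (\<lambda>\<xi>. (g \<xi> - g \<zeta>) * of_real (poisson z \<xi>))"
      using Bochner_Integration.integrable_diff[OF i1 i2] by (simp add: left_diff_distrib)
    have "?F z - g \<zeta> = ?F z - (\<integral>\<xi>. g \<zeta> * of_real (poisson z \<xi>) \<partial>circle_measure)"
      using integral_poisson[OF z1] by (simp only: integral_mult_right_zero) simp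
    also have "\<dots> = (\<integral>\<xi>. (g \<xi> - g \<zeta>) * of_real (poisson z \<xi>) \<partial>circle_measure)"
      using Bochner_Integration.integral_diff[OF i1 i2] by (simp add: left_diff_distrib)
    finally have "ennreal (cmod (?F z - g \<zeta>)) \<le> (\<integral>\<^sup>+\<xi>. cmod ((g \<xi> - g \<zeta>) * of_real (poisson z \<xi>)) \<partial>circle_measure)"
      using integral_norm_bound_ennreal[OF i3] by simp
    also have "\<dots> \<le> (\<integral>\<^sup>+\<xi>. ennreal K * (v \<xi> * ennreal (h / (h + dist \<xi> \<zeta>)\<^sup>2) + ennreal (h / \<rho>\<^sub>0\<^sup>2) * ennreal (w \<xi>)) \<partial>circle_measure)"
    proof (rule nn_integral_mono_AE)
      show "AE \<xi> in circle_measure. ennreal (cmod ((g \<xi> - g \<zeta>) * of_real (poisson z \<xi>)))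
        \<le> ennreal K * (v \<xi> * ennreal (h / (h + dist \<xi> \<zeta>)\<^sup>2) + ennreal (h / \<rho>\<^sub>0\<^sup>2) * ennreal (w \<xi>))"
        using AE_circle_norm
      proof eventually_elim
        case (elim \<xi>)
        have w0: "0 \<le> w \<xi>" by (simp add: w_def)
        have "cmod ((g \<xi> - g \<zeta>) * of_real (poisson z \<xi>)) = w \<xi> * poisson z \<xi>"
          using poisson_nonneg[OF z1] by (simp add: w_def norm_mult)
        also have "\<dots> \<le> w \<xi> * (K * (h / (h + dist \<xi> \<zeta>)\<^sup>2))"
          using poisson_stolz_le[OF z elim] \<alpha> w0 unfolding K_def h_def by (intro mult_left_mono) auto
        finally have le: "cmod ((g \<xi> - g \<zeta>) * of_real (poisson z \<xi>)) \<le> K * (w \<xi> * (h / (h + dist \<xi> \<zeta>)\<^sup>2))"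
          by (simp add: mult_ac)
        have le2: "ennreal (w \<xi> * (h / (h + dist \<xi> \<zeta>)\<^sup>2)) \<le> v \<xi> * ennreal (h / (h + dist \<xi> \<zeta>)\<^sup>2) + ennreal (h / \<rho>\<^sub>0\<^sup>2) * ennreal (w \<xi>)"
        proof (cases "dist \<xi> \<zeta> \<le> \<rho>\<^sub>0")
          case True
          then have "ennreal (w \<xi> * (h / (h + dist \<xi> \<zeta>)\<^sup>2)) = v \<xi> * ennreal (h / (h + dist \<xi> \<zeta>)\<^sup>2)"
            unfolding v_def using w0 h by (subst ennreal_mult) (auto simp del: times_divide_eq_right)
          then show ?thesis by simp
        next
          case False
          have "h / (h + dist \<xi> \<zeta>)\<^sup>2 \<le> h / \<rho>\<^sub>0\<^sup>2"
            using False \<rho>0 h by (intro divide_left_mono power_mono mult_pos_pos zero_less_power) auto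
          then have "w \<xi> * (h / (h + dist \<xi> \<zeta>)\<^sup>2) \<le> h / \<rho>\<^sub>0\<^sup>2 * w \<xi>"
            using w0 by (subst mult.commute) (rule mult_right_mono)
          then have "ennreal (w \<xi> * (h / (h + dist \<xi> \<zeta>)\<^sup>2)) \<le> ennreal (h / \<rho>\<^sub>0\<^sup>2) * ennreal (w \<xi>)"
            using w0 h by (subst ennreal_mult[symmetric]) (auto intro: ennreal_leI)
          then show ?thesis by (rule order_trans) simp
        qed
        have "ennreal (cmod ((g \<xi> - g \<zeta>) * of_real (poisson z \<xi>))) \<le> ennreal K * ennreal (w \<xi> * (h / (h + dist \<xi> \<zeta>)\<^sup>2))"
          using le K w0 h by (subst ennreal_mult[symmetric]) (auto intro: ennreal_leI)
        also have "\<dots> \<le> ennreal K * (v \<xi> * ennreal (h / (h + dist \<xi> \<zeta>)\<^sup>2) + ennreal (h / \<rho>\<^sub>0\<^sup>2) * ennreal (w \<xi>))"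
          by (rule mult_left_mono[OF le2]) simp
        finally show ?case .
      qed
    qed
    also have "\<dots> = ennreal K * ((\<integral>\<^sup>+\<xi>. v \<xi> * ennreal (h / (h + dist \<xi> \<zeta>)\<^sup>2) \<partial>circle_measure) + ennreal (h / \<rho>\<^sub>0\<^sup>2) * ennreal W)"
      by (simp add: nn_integral_cmult nn_integral_add nnW)
    also have "\<dots> \<le> ennreal K * (ennreal (8 * e) + ennreal (h / \<rho>\<^sub>0\<^sup>2) * ennreal W)"
    proof (intro mult_left_mono add_right_mono nn_integral_dyadic_kernel)
      fix \<rho> :: real assume \<rho>: "0 < \<rho>"
      have "(\<integral>\<^sup>+\<xi>. v \<xi> * indicator {\<xi>. dist \<xi> \<zeta> \<le> \<rho>} \<xi> \<partial>circle_measure)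
        \<le> (\<integral>\<^sup>+\<xi>. ennreal (w \<xi>) * indicator {\<xi>. dist \<xi> \<zeta> \<le> min \<rho> \<rho>\<^sub>0} \<xi> \<partial>circle_measure)"
        by (intro nn_integral_mono) (auto simp: v_def indicator_def)
      also have "\<dots> \<le> ennreal (e * min \<rho> \<rho>\<^sub>0)" using \<rho> \<rho>0 by (intro small) auto
      also have "\<dots> \<le> ennreal (e * \<rho>)" using e by (intro ennreal_leI mult_left_mono) auto
      finally show "(\<integral>\<^sup>+\<xi>. v \<xi> * indicator {\<xi>. dist \<xi> \<zeta> \<le> \<rho>} \<xi> \<partial>circle_measure) \<le> ennreal (e * \<rho>)" .
    qed (use h e in auto)
    also have "\<dots> = ennreal (K * (8 * e + h / \<rho>\<^sub>0\<^sup>2 * W))"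
      using K e h W by (simp add: ennreal_mult ennreal_plus del: times_divide_eq_left)
    finally show ?thesis
      using K e h W by (subst (asm) ennreal_le_iff) (auto simp: h_def)
  qed
  show "(?F \<longlongrightarrow> g \<zeta>) (at \<zeta> within stolz_region \<alpha> \<zeta>)"
    unfolding Lim_within
  proof (intro allI impI)
    fix \<eta> :: real assume \<eta>: "0 < \<eta>"
    \<comment> \<open>Chosen so that the near part K * 8 e equals \<eta> / 2.\<close>
    define e where "e = \<eta> / (16 * K)"
    have e: "0 < e" using \<eta> K by (simp add: e_def)
    from leb[folded w_def, THEN spec, THEN mp, OF e] obtain \<rho>\<^sub>0 where \<rho>\<^sub>0: "\<rho>\<^sub>0 > 0" and *: "\<forall>\<rho>. 0 < \<rho> \<and> \<rho> \<le> \<rho>\<^sub>0 \<longrightarrow>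
        (\<integral>\<^sup>+\<xi>. ennreal (w \<xi>) * indicator {\<xi>. dist \<xi> \<zeta> \<le> \<rho>} \<xi> \<partial>circle_measure) \<le> ennreal (e * \<rho>)"
      by (elim exE conjE)
    have small: "(\<integral>\<^sup>+\<xi>. ennreal (w \<xi>) * indicator {\<xi>. dist \<xi> \<zeta> \<le> \<rho>} \<xi> \<partial>circle_measure) \<le> ennreal (e * \<rho>)"
      if "0 < \<rho>" "\<rho> \<le> \<rho>\<^sub>0" for \<rho>
      using *[THEN spec, THEN mp, OF conjI[OF that]] .
    \<comment> \<open>Makes the far part at most \<eta> / 2. Using W + 1 instead of W avoids
      division by 0 and provides the strict inequality.\<close>
    define d where "d = \<rho>\<^sub>0\<^sup>2 * \<eta> / (2 * K * (W + 1))"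
    have d: "0 < d" using \<rho>\<^sub>0 \<eta> K W by (simp add: d_def)
    show "\<exists>d>0. \<forall>z\<in>stolz_region \<alpha> \<zeta>. 0 < dist z \<zeta> \<and> dist z \<zeta> < d \<longrightarrow> dist (?F z) (g \<zeta>) < \<eta>"
    proof (intro exI[of _ d] conjI ballI impI d)
      fix z assume z: "z \<in> stolz_region \<alpha> \<zeta>" and dz: "0 < dist z \<zeta> \<and> dist z \<zeta> < d"
      have "1 - cmod z \<le> dist z \<zeta>" using norm_triangle_ineq2[of \<zeta> z] \<zeta> by (simp add: dist_norm norm_minus_commute)
      then have h: "1 - cmod z < d" using dz by linarith
      have "dist (?F z) (g \<zeta>) \<le> K * (8 * e + (1 - cmod z) / \<rho>\<^sub>0\<^sup>2 * W)"
        unfolding dist_norm by (rule bound[OF z \<rho>\<^sub>0 e small])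
      also have "\<dots> < K * (8 * e + d / \<rho>\<^sub>0\<^sup>2 * (W + 1))"
      proof -
        have "(1 - cmod z) / \<rho>\<^sub>0\<^sup>2 * W \<le> d / \<rho>\<^sub>0\<^sup>2 * W"
          using h W by (intro mult_right_mono divide_right_mono) auto
        also have "\<dots> < d / \<rho>\<^sub>0\<^sup>2 * (W + 1)" using d \<rho>\<^sub>0 by (intro mult_strict_left_mono) auto
        finally show ?thesis using K by simp
      qed
      also have "\<dots> = \<eta>"
      proof -
        have "d / \<rho>\<^sub>0\<^sup>2 * (W + 1) = \<eta> / (2 * K)" using \<rho>\<^sub>0 W K by (simp add: d_def)
        moreover have "8 * e = \<eta> / (2 * K)" by (simp add: e_def)
        ultimately show ?thesis using K by simp
      qed
      finally show "dist (?F z) (g \<zeta>) < \<eta>" .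
    qed
  qed
qed

text \<open>The Lebesgue point theorem needs a Borel representative \<open>g'\<close>; replacing
  \<open>g\<close> by it changes neither the Poisson integral nor, off a null set, the claimed
  limit. \<open>F\<close> is controlled only inside the disk, which is enough because Stolz regions
  lie there.\<close>

lemma Cauchy_Fatou:
  fixes g :: "complex \<Rightarrow> complex"
  assumes g: "integrable circle_measure g"
    and moments: "\<And>n. n > 0 \<Longrightarrow> (\<integral>\<zeta>. g \<zeta> * \<zeta> ^ n \<partial>circle_measure) = 0"
    and F: "\<And>z. cmod z < 1 \<Longrightarrow> (\<lambda>k. (\<integral>\<zeta>. g \<zeta> * cnj (\<zeta> ^ k) \<partial>circle_measure) * z ^ k) sums F z"
  shows "has_boundary_values F g"
proof -
  obtain g' where g' [measurable]: "g' \<in> borel_measurable borel" and eq: "AE \<zeta> in circle_measure. g \<zeta> = g' \<zeta>"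
    using borel_version_circle[OF borel_measurable_integrable[OF g]] by blast
  have g'm: "g' \<in> borel_measurable circle_measure" by (rule borel_measurable_circle) (rule g')
  have int: "integrable circle_measure g'"
    using iffD1[OF integrable_cong_AE[OF borel_measurable_integrable[OF g] g'm eq] g] .
  have FP: "F z = (\<integral>\<xi>. g' \<xi> * of_real (poisson z \<xi>) \<partial>circle_measure)" if "cmod z < 1" for z
  proof -
    have "F z = (\<integral>\<xi>. g \<xi> * of_real (poisson z \<xi>) \<partial>circle_measure)"
      by (rule sums_unique2[OF F[OF that] poisson_integral_sums[OF g that moments]])
    also have "\<dots> = (\<integral>\<xi>. g' \<xi> * of_real (poisson z \<xi>) \<partial>circle_measure)"
    proof (rule integral_cong_AE)
      have "(\<lambda>\<xi>. complex_of_real (poisson z \<xi>)) \<in> borel_measurable circle_measure"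
        by (rule borel_measurable_circle) measurable
      then show "(\<lambda>\<xi>. g \<xi> * of_real (poisson z \<xi>)) \<in> borel_measurable circle_measure"
        "(\<lambda>\<xi>. g' \<xi> * of_real (poisson z \<xi>)) \<in> borel_measurable circle_measure"
        using borel_measurable_integrable[OF g] g'm by measurable
    qed (use eq in \<open>eventually_elim, simp\<close>)
    finally show ?thesis .
  qed
  show ?thesis
    unfolding has_boundary_values_def
    using Lebesgue_points_circle[OF g' int] AE_circle_norm eq
  proof eventually_elim
    case (elim \<zeta>)
    have "nontangential_limit (\<lambda>z. \<integral>\<xi>. g' \<xi> * of_real (poisson z \<xi>) \<partial>circle_measure) \<zeta> (g' \<zeta>)"
      by (rule poisson_integral_nontangential[OF g' int elim(2,1)])
    then show ?case
      unfolding nontangential_limit_def elim(3)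
    proof (intro allI impI)
      fix \<alpha> :: real
      assume "\<forall>\<alpha>>1. ((\<lambda>z. \<integral>\<xi>. g' \<xi> * of_real (poisson z \<xi>) \<partial>circle_measure) \<longlongrightarrow> g' \<zeta>) (at \<zeta> within stolz_region \<alpha> \<zeta>)" "1 < \<alpha>"
      then have "((\<lambda>z. \<integral>\<xi>. g' \<xi> * of_real (poisson z \<xi>) \<partial>circle_measure) \<longlongrightarrow> g' \<zeta>) (at \<zeta> within stolz_region \<alpha> \<zeta>)" by blast
      then show "(F \<longlongrightarrow> g' \<zeta>) (at \<zeta> within stolz_region \<alpha> \<zeta>)"
        by (rule Lim_transform_within[OF _ zero_less_one]) (simp add: FP stolz_region_def)
    qed
  qed
qed

section \<open>The Hardy space as an orthogonal complement\<close>

lemma circle_orthonormal: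
  "(\<integral>\<zeta>. \<zeta> ^ j * cnj (\<zeta> ^ k) \<partial>circle_measure) = (if j = k then 1 else 0)"
proof -
  have *: "(\<integral>\<zeta>. \<zeta> ^ (n + k) * cnj (\<zeta> ^ k) \<partial>circle_measure) = (if n = 0 then 1 else 0)" for n k
  proof -
    have "(\<integral>\<zeta>. \<zeta> ^ (n + k) * cnj (\<zeta> ^ k) \<partial>circle_measure) = (\<integral>\<zeta>. \<zeta> ^ n \<partial>circle_measure)"
    proof (rule integral_cong_AE)
      show "AE \<zeta> in circle_measure. \<zeta> ^ (n + k) * cnj (\<zeta> ^ k) = \<zeta> ^ n"
        using AE_circle_norm
      proof eventually_elim
        case (elim \<zeta>)
        have "\<zeta> ^ k * cnj (\<zeta> ^ k) = 1"
          using elim by (simp only: complex_norm_square[symmetric] norm_power) simp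
        then show ?case by (simp add: power_add)
      qed
      show "(\<lambda>\<zeta>. \<zeta> ^ (n + k) * cnj (\<zeta> ^ k)) \<in> borel_measurable circle_measure"
        by (rule borel_measurable_circle) measurable
    qed measurable
    then show ?thesis using integral_circle_power[of n] by auto
  qed
  show ?thesis
  proof (cases "k \<le> j")
    case True
    then show ?thesis using *[of "j - k" k] by auto
  next
    case False
    have "(\<integral>\<zeta>. \<zeta> ^ j * cnj (\<zeta> ^ k) \<partial>circle_measure) = (\<integral>\<zeta>. cnj (\<zeta> ^ k * cnj (\<zeta> ^ j)) \<partial>circle_measure)"
      by (simp add: mult.commute)
    also have "\<dots> = cnj (\<integral>\<zeta>. \<zeta> ^ k * cnj (\<zeta> ^ j) \<partial>circle_measure)"
      by (rule Bochner_Integration.integral_cnj)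
    finally show ?thesis using False *[of "k - j" j] by auto
  qed
qed

text \<open>With \<open>F\<^sub>r\<close> the dilation of \<open>F\<close>, comparing coefficients gives
  \<open>\<langle>F\<^sub>r, F\<^sub>r\<rangle> = \<Sum> r\<^sup>2\<^sup>k \<bar>a\<^sub>k\<bar>\<^sup>2 \<le> \<Sum> r\<^sup>k \<bar>a\<^sub>k\<bar>\<^sup>2 = \<langle>g, F\<^sub>r\<rangle>\<close>, hence \<open>\<parallel>F\<^sub>r\<parallel> \<le> \<parallel>g\<parallel>\<close>.\<close>

lemma Cauchy_series_hardy2_disk:
  assumes g: "g \<in> L2"
  defines "a \<equiv> \<lambda>k. \<integral>\<zeta>. g \<zeta> * cnj (\<zeta> ^ k) \<partial>circle_measure"
  assumes F: "\<And>z. cmod z < 1 \<Longrightarrow> (\<lambda>k. a k * z ^ k) sums F z"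
  shows "F \<in> hardy2_disk"
proof -
  have a_eq: "(\<integral>\<zeta>. g \<zeta> * cnj (\<zeta> ^ k) \<partial>circle_measure) = a k" for k by (simp only: a_def)
  have hol: "F holomorphic_on ball 0 1"
    by (rule power_series_holomorphic[where a=a]) (use F in simp)
  have "l2_norm (\<lambda>\<zeta>. F (of_real r * \<zeta>)) \<le> l2_norm g" if r: "0 \<le> r" "r < 1" for r
  proof -
    obtain r' where r': "r < r'" "r' < 1" using dense[OF r(2)] by auto
    have "summable (\<lambda>k. a k * of_real r' ^ k)"
      using F[of "of_real r'"] r' r by (auto simp: sums_iff)
    then have "summable (\<lambda>k. norm (a k * of_real r ^ k))"
      by (rule powser_insidea) (use r' r in auto)
    then have b: "summable (\<lambda>k. cmod (a k) * r ^ k)" using r by (simp add: norm_mult norm_power)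
    have s: "AE \<zeta> in circle_measure. (\<lambda>k. a k * (of_real r * \<zeta>) ^ k) sums F (of_real r * \<zeta>)"
      using AE_circle_norm by eventually_elim (rule F, use r in \<open>simp add: norm_mult\<close>)
    have bound: "AE \<zeta> in circle_measure. \<forall>k. cmod (a k * (of_real r * \<zeta>) ^ k) \<le> cmod (a k) * r ^ k"
      using AE_circle_norm by eventually_elim (use r in \<open>simp add: norm_mult norm_power\<close>)
    have m: "(\<lambda>\<zeta>. a k * (of_real r * \<zeta>) ^ k) \<in> borel_measurable circle_measure" for k
      by (rule borel_measurable_circle) measurable
    let ?Fr = "\<lambda>\<zeta>. F (of_real r * \<zeta>)"
    have Fm: "?Fr \<in> borel_measurable circle_measure" by (rule integral_circle_dilation(2)[OF hol r])
    have FL: "?Fr \<in> L2"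
    proof (rule L2_bounded[OF Fm])
      show "AE \<zeta> in circle_measure. cmod (?Fr \<zeta>) \<le> (\<Sum>k. cmod (a k) * r ^ k)"
        using s bound
      proof eventually_elim
        case (elim \<zeta>)
        have "cmod (\<Sum>k. a k * (of_real r * \<zeta>) ^ k) \<le> (\<Sum>k. cmod (a k) * r ^ k)"
          by (rule norm_suminf_le) (use elim b in auto)
        then show ?case using elim(1) by (simp add: sums_iff)
      qed
    qed
    \<comment> \<open>\<open>G\<close> is kept general because the expansion is used twice, with the
      dilation itself and with \<open>g\<close>; the two series are then compared term by
      term.\<close>
    have inner: "(\<lambda>k. of_real (r ^ k) * cnj (a k) * (\<integral>\<zeta>. G \<zeta> * cnj (\<zeta> ^ k) \<partial>circle_measure)) sums l2_inner G ?Fr" if "G \<in> L2" for G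
    proof -
      have "(\<lambda>k. \<integral>\<zeta>. G \<zeta> * cnj (a k * (of_real r * \<zeta>) ^ k) \<partial>circle_measure) sums (\<integral>\<zeta>. G \<zeta> * cnj (?Fr \<zeta>) \<partial>circle_measure)"
      proof (rule integral_circle_sums(1)[OF L2_integrable[OF that] b])
        show "(\<lambda>\<zeta>. cnj (a k * (of_real r * \<zeta>) ^ k)) \<in> borel_measurable circle_measure" for k
          using m by measurable
        show "AE \<zeta> in circle_measure. \<forall>k. cmod (cnj (a k * (of_real r * \<zeta>) ^ k)) \<le> cmod (a k) * r ^ k"
          unfolding complex_mod_cnj by (rule bound)
        show "AE \<zeta> in circle_measure. (\<lambda>k. cnj (a k * (of_real r * \<zeta>) ^ k)) sums cnj (?Fr \<zeta>)"
          using s by eventually_elim (simp only: sums_cnj)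
      qed
      moreover have "(\<integral>\<zeta>. G \<zeta> * cnj (a k * (of_real r * \<zeta>) ^ k) \<partial>circle_measure)
          = of_real (r ^ k) * cnj (a k) * (\<integral>\<zeta>. G \<zeta> * cnj (\<zeta> ^ k) \<partial>circle_measure)" for k
        by (subst integral_mult_right_zero[symmetric]) (simp add: power_mult_distrib mult_ac)
      ultimately show ?thesis by (simp add: l2_inner_def)
    qed
    have coeff: "(\<integral>\<zeta>. ?Fr \<zeta> * cnj (\<zeta> ^ k) \<partial>circle_measure) = a k * of_real (r ^ k)" for k
    proof -
      have L: "(\<lambda>\<zeta>. cnj (\<zeta> ^ k)) \<in> L2"
      proof (rule L2_bounded[of _ 1])
        show "(\<lambda>\<zeta>. cnj (\<zeta> ^ k)) \<in> borel_measurable circle_measure" by (rule borel_measurable_circle) measurable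
      qed (use AE_circle_norm in \<open>eventually_elim, simp add: norm_power\<close>)
      have "(\<integral>\<zeta>. cnj (\<zeta> ^ k) * (a j * (of_real r * \<zeta>) ^ j) \<partial>circle_measure) = (if j = k then a j * of_real (r ^ j) else 0)" for j
      proof -
        have "(\<integral>\<zeta>. cnj (\<zeta> ^ k) * (a j * (of_real r * \<zeta>) ^ j) \<partial>circle_measure)
          = (a j * of_real (r ^ j)) * (\<integral>\<zeta>. \<zeta> ^ j * cnj (\<zeta> ^ k) \<partial>circle_measure)"
          by (subst integral_mult_right_zero[symmetric]) (simp add: power_mult_distrib mult_ac)
        then show ?thesis unfolding circle_orthonormal by simp
      qed
      then have "(\<lambda>j. if j = k then a j * of_real (r ^ j) else 0) sums (\<integral>\<zeta>. cnj (\<zeta> ^ k) * ?Fr \<zeta> \<partial>circle_measure)"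
        using integral_circle_sums(1)[OF L2_integrable[OF L] b m bound s] by simp
      from sums_unique2[OF this sums_single[of k "\<lambda>j. a j * of_real (r ^ j)"]]
      show ?thesis by (simp add: mult.commute)
    qed
    have s1: "(\<lambda>k. Re (of_real (r ^ k) * cnj (a k) * (a k * of_real (r ^ k)))) sums Re (l2_inner ?Fr ?Fr)"
      using inner[OF FL] unfolding coeff by (rule sums_Re)
    have s2: "(\<lambda>k. Re (of_real (r ^ k) * cnj (a k) * a k)) sums Re (l2_inner g ?Fr)"
      using inner[OF g] unfolding a_eq by (rule sums_Re)
    have le: "Re (of_real (r ^ k) * cnj (a k) * (a k * of_real (r ^ k))) \<le> Re (of_real (r ^ k) * cnj (a k) * a k)" for k
    proof -
      have "of_real (r ^ k) * cnj (a k) * a k = of_real (r ^ k * (cmod (a k))\<^sup>2)"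
        by (simp only: of_real_mult complex_norm_square) (simp add: mult_ac)
      moreover have "of_real (r ^ k) * cnj (a k) * (a k * of_real (r ^ k)) = of_real (r ^ k * (r ^ k * (cmod (a k))\<^sup>2))"
        by (simp only: of_real_mult complex_norm_square) (simp add: mult_ac)
      moreover have "r ^ k * (r ^ k * (cmod (a k))\<^sup>2) \<le> 1 * (r ^ k * (cmod (a k))\<^sup>2)"
        using r by (intro mult_right_mono) (auto simp: power_le_one)
      ultimately show ?thesis by (simp only: Re_complex_of_real mult_1)
    qed
    have "Re (l2_inner ?Fr ?Fr) \<le> Re (l2_inner g ?Fr)"
      by (rule sums_le[OF le s1 s2])
    also have "\<dots> \<le> l2_norm g * l2_norm ?Fr"
      using l2_Cauchy_Schwarz[OF g FL] complex_Re_le_cmod order_trans by blast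
    finally have "l2_norm ?Fr * l2_norm ?Fr \<le> l2_norm g * l2_norm ?Fr"
      unfolding l2_inner_self by (simp add: power2_eq_square)
    then show ?thesis
      using l2_norm_nonneg[of ?Fr] l2_norm_nonneg[of g]
      by (cases "l2_norm ?Fr = 0") (auto simp: mult_le_cancel_right)
  qed
  then have "(\<integral>\<zeta>. (cmod (F (of_real r * \<zeta>)))\<^sup>2 \<partial>circle_measure) \<le> (l2_norm g)\<^sup>2" if "0 \<le> r" "r < 1" for r
    using that by (simp only: l2_norm_square[symmetric]) (intro power_mono, auto)
  then show ?thesis
    unfolding hardy2_disk_def using hol by (auto intro!: bdd_aboveI[of _ "(l2_norm g)\<^sup>2"])
qed

lemma hardy2_iff_moments:
  "g \<in> hardy2 \<longleftrightarrow> g \<in> L2 \<and> (\<forall>n>0. (\<integral>\<zeta>. g \<zeta> * \<zeta> ^ n \<partial>circle_measure) = 0)"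
proof
  assume "g \<in> hardy2"
  then show "g \<in> L2 \<and> (\<forall>n>0. (\<integral>\<zeta>. g \<zeta> * \<zeta> ^ n \<partial>circle_measure) = 0)"
    using hardy2_moments by (auto simp: hardy2_def)
next
  assume "g \<in> L2 \<and> (\<forall>n>0. (\<integral>\<zeta>. g \<zeta> * \<zeta> ^ n \<partial>circle_measure) = 0)"
  then have g: "g \<in> L2" and mom: "\<And>n. n > 0 \<Longrightarrow> (\<integral>\<zeta>. g \<zeta> * \<zeta> ^ n \<partial>circle_measure) = 0" by auto
  define a where "a k = (\<integral>\<zeta>. g \<zeta> * cnj (\<zeta> ^ k) \<partial>circle_measure)" for k
  define F where "F z = (\<Sum>k. a k * z ^ k)" for z
  have "(\<lambda>k. a k * z ^ k) sums F z" if "cmod z < 1" for z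
    using poisson_integral_sums[OF L2_integrable[OF g] that mom] unfolding F_def a_def[symmetric] by (simp add: sums_iff)
  then have F: "\<And>z. cmod z < 1 \<Longrightarrow> (\<lambda>k. (\<integral>\<zeta>. g \<zeta> * cnj (\<zeta> ^ k) \<partial>circle_measure) * z ^ k) sums F z"
    by (simp only: a_def)
  have "F \<in> hardy2_disk" by (rule Cauchy_series_hardy2_disk[OF g F])
  moreover have "has_boundary_values F g" by (rule Cauchy_Fatou[OF L2_integrable[OF g] mom F])
  ultimately show "g \<in> hardy2" using g by (auto simp: hardy2_def)
qed

text \<open>The n-th moment is the inner product with the conjugate of \<open>\<zeta> ^ n\<close>.
  In this form the Hardy space inherits closedness, and with it projections, from the general facts
  on \<open>l2_perp\<close>.\<close>

lemma hardy2_eq_l2_perp: "hardy2 = l2_perp ((\<lambda>n \<zeta>. cnj (\<zeta> ^ n)) ` {0<..})"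
  by (auto simp: hardy2_iff_moments l2_perp_def l2_inner_def)

section \<open>Model spaces\<close>

lemma nontangential_limit_unique:
  assumes "cmod \<zeta> = 1" "nontangential_limit f \<zeta> w" "nontangential_limit f \<zeta> w'"
  shows "w = w'"
proof -
  obtain r :: "nat \<Rightarrow> real" where r: "\<And>m. 0 \<le> r m" "\<And>m. r m < 1" "r \<longlonglongrightarrow> 1"
    by (rule ex_radial_sequence) blast
  show ?thesis
    using nontangential_limit_radial[OF assms(2,1) r] nontangential_limit_radial[OF assms(3,1) r]
    by (rule LIMSEQ_unique)
qed

text \<open>Boundary values are a.e. limits of dilations along one radial sequence; their arbitrary
  values on a null set are harmless for a complete measure.\<close>

lemma has_boundary_values_measurable:
  assumes "f holomorphic_on ball 0 1" "has_boundary_values f g"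
  shows "g \<in> borel_measurable circle_measure"
proof -
  obtain r :: "nat \<Rightarrow> real" where r: "\<And>m. 0 \<le> r m" "\<And>m. r m < 1" "r \<longlonglongrightarrow> 1"
    by (rule ex_radial_sequence) blast
  have [measurable]: "(\<lambda>\<zeta>. f (of_real (r m) * \<zeta>)) \<in> borel_measurable circle_measure" for m
    by (rule integral_circle_dilation(2)[OF assms(1) r(1,2)])
  show ?thesis
  proof (rule measurable_circle_AE)
    show "(\<lambda>\<zeta>. lim (\<lambda>m. f (of_real (r m) * \<zeta>))) \<in> borel_measurable circle_measure"
      by measurable
    show "AE \<zeta> in circle_measure. lim (\<lambda>m. f (of_real (r m) * \<zeta>)) = g \<zeta>"
      using assms(2)[unfolded has_boundary_values_def] AE_circle_norm
      by eventually_elim (rule limI, rule nontangential_limit_radial[OF _ _ r])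
  qed
qed

lemma has_boundary_values_const: "has_boundary_values (\<lambda>_. c) (\<lambda>_. c)"
  by (simp add: has_boundary_values_def nontangential_limit_def)

lemma has_boundary_values_mult:
  assumes "has_boundary_values f g" "has_boundary_values f' g'"
  shows "has_boundary_values (\<lambda>z. f z * f' z) (\<lambda>\<zeta>. g \<zeta> * g' \<zeta>)"
  using assms unfolding has_boundary_values_def
  by eventually_elim (auto simp: nontangential_limit_def intro!: tendsto_mult)

lemma has_boundary_values_diff:
  assumes "has_boundary_values f g" "has_boundary_values f' g'"
  shows "has_boundary_values (\<lambda>z. f z - f' z) (\<lambda>\<zeta>. g \<zeta> - g' \<zeta>)"
  using assms unfolding has_boundary_values_def
  by eventually_elim (auto simp: nontangential_limit_def intro!: tendsto_diff)

lemma const_hardy2_disk: "(\<lambda>_. c) \<in> hardy2_disk"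
  by (auto simp: hardy2_disk_def intro!: bdd_aboveI)

lemma hardy_inf_disk_iff:
  "f \<in> hardy_inf_disk \<longleftrightarrow> f holomorphic_on ball 0 1 \<and> (\<exists>B. \<forall>z. cmod z < 1 \<longrightarrow> cmod (f z) \<le> B)"
proof -
  have "bounded (f ` ball 0 1) \<longleftrightarrow> (\<exists>B. \<forall>z\<in>ball 0 1. cmod (f z) \<le> B)"
    unfolding bounded_iff by blast
  then show ?thesis by (simp add: hardy_inf_disk_def Ball_def)
qed

lemma hardy2_disk_mult:
  assumes f: "f \<in> hardy_inf_disk" and h: "h \<in> hardy2_disk"
  shows "(\<lambda>z. f z * h z) \<in> hardy2_disk"
proof -
  have hol: "f holomorphic_on ball 0 1" "h holomorphic_on ball 0 1"
    using assms by (auto simp: hardy_inf_disk_def hardy2_disk_def)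
  obtain B where B: "\<And>z. cmod z < 1 \<Longrightarrow> cmod (f z) \<le> B"
    using f unfolding hardy_inf_disk_iff by blast
  obtain C where C: "\<And>r. 0 \<le> r \<Longrightarrow> r < 1 \<Longrightarrow> (\<lambda>\<zeta>. h (of_real r * \<zeta>)) \<in> L2"
    "\<And>r. 0 \<le> r \<Longrightarrow> r < 1 \<Longrightarrow> l2_norm (\<lambda>\<zeta>. h (of_real r * \<zeta>)) \<le> C"
    using hardy2_disk_L2_dilation[OF h] by blast
  have "(\<integral>\<zeta>. (cmod (f (of_real r * \<zeta>) * h (of_real r * \<zeta>)))\<^sup>2 \<partial>circle_measure) \<le> B\<^sup>2 * C\<^sup>2" if r: "0 \<le> r" "r < 1" for r
  proof -
    have le: "AE \<zeta> in circle_measure. cmod (f (of_real r * \<zeta>)) \<le> B"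
      using AE_circle_norm by eventually_elim (rule B, use r in \<open>simp add: norm_mult\<close>)
    have L: "(\<lambda>\<zeta>. f (of_real r * \<zeta>) * h (of_real r * \<zeta>)) \<in> L2"
      by (rule L2_mult_bounded[OF C(1)[OF r] integral_circle_dilation(2)[OF hol(1) r] le])
    have "(\<integral>\<zeta>. (cmod (f (of_real r * \<zeta>) * h (of_real r * \<zeta>)))\<^sup>2 \<partial>circle_measure)
      \<le> (\<integral>\<zeta>. B\<^sup>2 * (cmod (h (of_real r * \<zeta>)))\<^sup>2 \<partial>circle_measure)"
    proof (rule integral_mono_AE)
      show "AE \<zeta> in circle_measure. (cmod (f (of_real r * \<zeta>) * h (of_real r * \<zeta>)))\<^sup>2 \<le> B\<^sup>2 * (cmod (h (of_real r * \<zeta>)))\<^sup>2"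
        using le by eventually_elim (auto simp: norm_mult power_mult_distrib intro!: mult_right_mono power_mono)
    qed (use L2_integrable_square[OF L] L2_integrable_square[OF C(1)[OF r]] in auto)
    also have "\<dots> = B\<^sup>2 * (l2_norm (\<lambda>\<zeta>. h (of_real r * \<zeta>)))\<^sup>2" by (simp add: l2_norm_square)
    also have "\<dots> \<le> B\<^sup>2 * C\<^sup>2" by (intro mult_left_mono power_mono C r) auto
    finally show ?thesis .
  qed
  then show ?thesis
    unfolding hardy2_disk_def using hol by (auto intro!: holomorphic_intros bdd_aboveI[of _ "B\<^sup>2 * C\<^sup>2"])
qed

lemma hardy_inf_disk_subset_hardy2_disk: "hardy_inf_disk \<subseteq> hardy2_disk"
  using hardy2_disk_mult[OF _ const_hardy2_disk[of 1]] by auto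

section \<open>The model space of a fixed inner function and its kernel at the origin\<close>

context
  fixes \<Theta> :: "complex \<Rightarrow> complex"
  assumes inner: "inner_function \<Theta>"
begin

lemma inner_bounded: "\<Theta> \<in> hardy_inf_disk"
  using inner by (simp add: inner_function_def)

lemma inner_unimodular: "AE \<zeta> in circle_measure. cmod (boundary_fun \<Theta> \<zeta>) = 1"
  using inner by (simp add: inner_function_def)

text \<open>\<open>boundary_fun\<close> has the default value 0 where no limit exists, so modulus 1
  almost everywhere already forces the limit to exist there; its uniqueness identifies it with the
  \<open>THE\<close> term.\<close>

lemma inner_boundary_values: "has_boundary_values \<Theta> (boundary_fun \<Theta>)"
  unfolding has_boundary_values_def
  using inner_unimodular AE_circle_norm
proof eventually_elim
  case (elim \<zeta>)
  then obtain w where w: "nontangential_limit \<Theta> \<zeta> w"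
    by (auto simp: boundary_fun_def split: if_splits)
  then have "boundary_fun \<Theta> \<zeta> = (THE w. nontangential_limit \<Theta> \<zeta> w)" by (auto simp: boundary_fun_def)
  also have "\<dots> = w"
    using w nontangential_limit_unique[OF elim(2)] by (intro the_equality) auto
  finally show ?case using w by simp
qed

lemma inner_boundary_measurable: "boundary_fun \<Theta> \<in> borel_measurable circle_measure"
  using inner_bounded by (intro has_boundary_values_measurable[OF _ inner_boundary_values]) (simp add: hardy_inf_disk_def)

lemma inner_mult_L2: "h \<in> L2 \<Longrightarrow> (\<lambda>\<zeta>. boundary_fun \<Theta> \<zeta> * h \<zeta>) \<in> L2"
  by (rule L2_mult_bounded[OF _ inner_boundary_measurable, of _ 1])
    (auto intro: eventually_mono[OF inner_unimodular])

lemma inner_L2: "boundary_fun \<Theta> \<in> L2"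
  using inner_mult_L2[OF L2_const[of 1]] by simp

text \<open>The zeroth moment of the Hardy function \<Theta> f. It evaluates the inner products
  needed both for membership of the kernel in the model space and for its norm.\<close>

lemma integral_inner_mult:
  assumes f: "f \<in> hardy2_disk" "has_boundary_values f h" and h: "h \<in> L2"
  shows "(\<integral>\<zeta>. boundary_fun \<Theta> \<zeta> * h \<zeta> \<partial>circle_measure) = \<Theta> 0 * f 0"
  using hardy2_moments[OF hardy2_disk_mult[OF inner_bounded f(1)]
      has_boundary_values_mult[OF inner_boundary_values f(2)] inner_mult_L2[OF h], of 0] by simp

text \<open>Both defining conditions are orthogonality conditions, so the model space is the
  complement of the union of the two families; the results on \<open>l2_proj\<close> then apply to
  \<open>model_proj\<close>.\<close>

lemma model_space_eq_l2_perp: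
  obtains S where "S \<subseteq> L2" "model_space \<Theta> = l2_perp S"
proof
  let ?S = "(\<lambda>n \<zeta>. cnj (\<zeta> ^ n)) ` {0<..} \<union> (\<lambda>h \<zeta>. boundary_fun \<Theta> \<zeta> * h \<zeta>) ` hardy2"
  have "(\<lambda>\<zeta>. cnj (\<zeta> ^ n)) \<in> L2" for n
  proof (rule L2_bounded[of _ 1])
    show "(\<lambda>\<zeta>. cnj (\<zeta> ^ n)) \<in> borel_measurable circle_measure" by (rule borel_measurable_circle) measurable
  qed (use AE_circle_norm in \<open>eventually_elim, simp add: norm_power\<close>)
  then show "?S \<subseteq> L2" by (auto simp: hardy2_def intro: inner_mult_L2)
  show "model_space \<Theta> = l2_perp ?S"
    unfolding model_space_def by (subst hardy2_eq_l2_perp) (auto simp: l2_perp_def)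
qed

definition kernel0 :: "complex \<Rightarrow> complex" where
  "kernel0 \<zeta> = 1 - cnj (\<Theta> 0) * boundary_fun \<Theta> \<zeta>"

lemma kernel0_L2: "kernel0 \<in> L2"
  unfolding kernel0_def[abs_def] by (intro L2_diff L2_scale inner_L2 L2_const)

lemma kernel0_inf: "\<exists>f \<in> hardy_inf_disk. has_boundary_values f kernel0"
proof
  let ?f = "\<lambda>z. 1 - cnj (\<Theta> 0) * \<Theta> z"
  show "has_boundary_values ?f kernel0"
    unfolding kernel0_def[abs_def]
    by (intro has_boundary_values_diff has_boundary_values_mult has_boundary_values_const inner_boundary_values)
  obtain B where B: "\<And>z. cmod z < 1 \<Longrightarrow> cmod (\<Theta> z) \<le> B"
    using inner_bounded unfolding hardy_inf_disk_iff by blast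
  have "cmod (?f z) \<le> 1 + cmod (\<Theta> 0) * B" if "cmod z < 1" for z
  proof -
    have "cmod (?f z) \<le> 1 + cmod (\<Theta> 0) * cmod (\<Theta> z)"
      using norm_triangle_ineq4[of 1 "cnj (\<Theta> 0) * \<Theta> z"] by (simp add: norm_mult)
    also have "\<dots> \<le> 1 + cmod (\<Theta> 0) * B" using B[OF that] by (intro add_left_mono mult_left_mono) auto
    finally show ?thesis .
  qed
  moreover have "?f holomorphic_on ball 0 1"
    using inner_bounded unfolding hardy_inf_disk_iff by (auto intro!: holomorphic_intros)
  ultimately show "?f \<in> hardy_inf_disk" unfolding hardy_inf_disk_iff by blast
qed

text \<open>For h with disk function f, the constant 1 pairs with \<Theta> h to cnj (\<Theta>(0)
  f(0)), while \<Theta> pairs with \<Theta> h to cnj (f(0)) because |\<Theta>| = 1 on the circle.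
  The factor cnj (\<Theta>(0)) in the kernel makes the two contributions cancel.\<close>

lemma kernel0_model_space_inf: "kernel0 \<in> model_space_inf \<Theta>"
proof -
  have "kernel0 \<in> hardy2"
    using kernel0_inf kernel0_L2 hardy_inf_disk_subset_hardy2_disk by (auto simp: hardy2_def)
  moreover have "l2_inner kernel0 (\<lambda>\<zeta>. boundary_fun \<Theta> \<zeta> * h \<zeta>) = 0" if "h \<in> hardy2" for h
  proof -
    obtain f where f: "f \<in> hardy2_disk" "has_boundary_values f h" and h: "h \<in> L2"
      using \<open>h \<in> hardy2\<close> by (auto simp: hardy2_def)
    note Lh = inner_mult_L2[OF h]
    have hm: "h \<in> borel_measurable circle_measure" using L2_measurable[OF h] .
    have "l2_inner kernel0 (\<lambda>\<zeta>. boundary_fun \<Theta> \<zeta> * h \<zeta>)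
      = l2_inner (\<lambda>_. 1) (\<lambda>\<zeta>. boundary_fun \<Theta> \<zeta> * h \<zeta>) - cnj (\<Theta> 0) * l2_inner (boundary_fun \<Theta>) (\<lambda>\<zeta>. boundary_fun \<Theta> \<zeta> * h \<zeta>)"
      unfolding kernel0_def[abs_def] l2_inner_diff[OF L2_const L2_scale[OF inner_L2] Lh] l2_inner_scale ..
    also have "l2_inner (\<lambda>_. 1) (\<lambda>\<zeta>. boundary_fun \<Theta> \<zeta> * h \<zeta>) = cnj (\<integral>\<zeta>. boundary_fun \<Theta> \<zeta> * h \<zeta> \<partial>circle_measure)"
      unfolding l2_inner_def mult_1 by (rule Bochner_Integration.integral_cnj)
    also have "\<dots> = cnj (\<Theta> 0 * f 0)" by (simp only: integral_inner_mult[OF f h])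
    also have "l2_inner (boundary_fun \<Theta>) (\<lambda>\<zeta>. boundary_fun \<Theta> \<zeta> * h \<zeta>) = (\<integral>\<zeta>. cnj (h \<zeta>) \<partial>circle_measure)"
      unfolding l2_inner_def
    proof (rule integral_cong_AE)
      show "(\<lambda>\<zeta>. boundary_fun \<Theta> \<zeta> * cnj (boundary_fun \<Theta> \<zeta> * h \<zeta>)) \<in> borel_measurable circle_measure"
        "(\<lambda>\<zeta>. cnj (h \<zeta>)) \<in> borel_measurable circle_measure"
        using hm inner_boundary_measurable by measurable
      show "AE \<zeta> in circle_measure. boundary_fun \<Theta> \<zeta> * cnj (boundary_fun \<Theta> \<zeta> * h \<zeta>) = cnj (h \<zeta>)"
        using inner_unimodular
      proof eventually_elim
        case (elim \<zeta>)
        have "boundary_fun \<Theta> \<zeta> * cnj (boundary_fun \<Theta> \<zeta>) = 1"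
          by (simp only: complex_norm_square[symmetric] elim) simp
        then show ?case by (simp add: mult.assoc[symmetric])
      qed
    qed
    also have "\<dots> = cnj (\<integral>\<zeta>. h \<zeta> \<partial>circle_measure)" by (rule Bochner_Integration.integral_cnj)
    also have "(\<integral>\<zeta>. h \<zeta> \<partial>circle_measure) = f 0" using hardy2_moments[OF f h, of 0] by simp
    finally show ?thesis by simp
  qed
  ultimately show ?thesis
    using kernel0_inf kernel0_L2 by (auto simp: model_space_inf_def model_space_def l2_perp_def)
qed

text \<open>Expanding the square gives 1 - 2 |\<Theta>(0)|^2 + |\<Theta>(0)|^2, since \<Theta> has
  norm 1 and its mean over the circle is \<Theta>(0).\<close>

lemma kernel0_norm: "(l2_norm kernel0)\<^sup>2 = 1 - (cmod (\<Theta> 0))\<^sup>2"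
proof -
  have "(l2_norm (\<lambda>\<zeta>. 1 - cnj (\<Theta> 0) * boundary_fun \<Theta> \<zeta>))\<^sup>2
    = (l2_norm (\<lambda>_. 1))\<^sup>2 - 2 * Re (cnj (cnj (\<Theta> 0)) * l2_inner (\<lambda>_. 1) (boundary_fun \<Theta>))
      + (cmod (cnj (\<Theta> 0)))\<^sup>2 * (l2_norm (boundary_fun \<Theta>))\<^sup>2"
    by (rule l2_norm_diff_square[OF L2_const inner_L2])
  also have "l2_inner (\<lambda>_. 1) (boundary_fun \<Theta>) = cnj (\<Theta> 0)"
  proof -
    have "(\<integral>\<zeta>. cnj (boundary_fun \<Theta> \<zeta>) \<partial>circle_measure) = cnj (\<integral>\<zeta>. boundary_fun \<Theta> \<zeta> \<partial>circle_measure)"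
      by (rule Bochner_Integration.integral_cnj)
    then show ?thesis
      using integral_inner_mult[OF const_hardy2_disk has_boundary_values_const, of 1] by (simp add: l2_inner_def)
  qed
  also have "(l2_norm (boundary_fun \<Theta>))\<^sup>2 = (l2_norm (\<lambda>_. 1))\<^sup>2"
    unfolding l2_norm_square
    by (rule integral_cong_AE)
      (use inner_boundary_measurable in \<open>auto intro: eventually_mono[OF inner_unimodular]\<close>)
  also have "(l2_norm (\<lambda>_. 1))\<^sup>2 = 1" by (simp add: l2_norm_square)
  also have "Re (cnj (cnj (\<Theta> 0)) * cnj (\<Theta> 0)) = (cmod (\<Theta> 0))\<^sup>2"
    by (simp only: complex_cnj_cnj complex_norm_square[symmetric] Re_complex_of_real)
  finally show ?thesis by (simp add: kernel0_def[abs_def])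
qed

text \<open>Pointwise, \<phi> times the kernel is \<phi> - cnj (\<Theta>(0)) \<Theta> \<phi>. The
  same combination of projections lies in the model space and leaves a residual orthogonal to it, so
  uniqueness identifies it a.e. with the projection of the product. The scalar \<open>c\<close> is
  carried along because homogeneity, too, holds only a.e.\<close>

lemma truncated_toeplitz_kernel0:
  assumes \<phi>: "\<phi> \<in> L2"
  shows "AE \<zeta> in circle_measure. truncated_toeplitz \<Theta> \<phi> (\<lambda>\<zeta>. c * kernel0 \<zeta>) \<zeta>
      = c * (model_proj \<Theta> \<phi> \<zeta> - cnj (\<Theta> 0) * model_proj \<Theta> (\<lambda>\<xi>. boundary_fun \<Theta> \<xi> * \<phi> \<xi>) \<zeta>)"
    and "(\<lambda>\<zeta>. model_proj \<Theta> \<phi> \<zeta> - cnj (\<Theta> 0) * model_proj \<Theta> (\<lambda>\<xi>. boundary_fun \<Theta> \<xi> * \<phi> \<xi>) \<zeta>) \<in> L2"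
proof -
  obtain S where S: "S \<subseteq> L2" "model_space \<Theta> = l2_perp S" by (rule model_space_eq_l2_perp)
  let ?\<psi> = "\<lambda>\<xi>. boundary_fun \<Theta> \<xi> * \<phi> \<xi>"
  let ?g = "\<lambda>\<zeta>. model_proj \<Theta> \<phi> \<zeta> - cnj (\<Theta> 0) * model_proj \<Theta> ?\<psi> \<zeta>"
  note \<psi> = inner_mult_L2[OF \<phi>]
  have P: "model_proj \<Theta> f \<in> l2_perp S" "(\<lambda>\<zeta>. f \<zeta> - model_proj \<Theta> f \<zeta>) \<in> l2_perp (l2_perp S)" if "f \<in> L2" for f
    using l2_proj_perp[OF S(1) that] by (simp_all add: model_proj_def S(2))
  have perp2: "l2_perp S \<subseteq> L2" using l2_perp_L2 by blast
  have g: "?g \<in> l2_perp S"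
    by (intro l2_perp_diff l2_perp_scale S(1) P \<phi> \<psi>)
  then show "?g \<in> L2" by (rule l2_perp_L2)
  \<comment> \<open>The residual of the combination is the same combination of the two residuals,
    and \<open>l2_perp (l2_perp S)\<close> is a linear space.\<close>
  have "(\<lambda>\<zeta>. c * ((\<phi> \<zeta> - model_proj \<Theta> \<phi> \<zeta>) - cnj (\<Theta> 0) * (?\<psi> \<zeta> - model_proj \<Theta> ?\<psi> \<zeta>))) \<in> l2_perp (l2_perp S)"
    by (intro l2_perp_scale l2_perp_diff perp2 P \<phi> \<psi>)
  moreover have "(\<lambda>\<zeta>. c * ((\<phi> \<zeta> - model_proj \<Theta> \<phi> \<zeta>) - cnj (\<Theta> 0) * (?\<psi> \<zeta> - model_proj \<Theta> ?\<psi> \<zeta>)))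
    = (\<lambda>\<zeta>. \<phi> \<zeta> * (c * kernel0 \<zeta>) - c * ?g \<zeta>)"
    by (simp add: kernel0_def algebra_simps)
  ultimately have "(\<lambda>\<zeta>. \<phi> \<zeta> * (c * kernel0 \<zeta>) - c * ?g \<zeta>) \<in> l2_perp (l2_perp S)" by simp
  moreover have "(\<lambda>\<zeta>. \<phi> \<zeta> * (c * kernel0 \<zeta>)) \<in> L2"
  proof -
    have "(\<lambda>\<zeta>. c * (\<phi> \<zeta> - cnj (\<Theta> 0) * ?\<psi> \<zeta>)) \<in> L2"
      by (intro L2_scale L2_diff \<phi> \<psi>)
    then show ?thesis by (simp add: kernel0_def algebra_simps)
  qed
  ultimately show "AE \<zeta> in circle_measure. truncated_toeplitz \<Theta> \<phi> (\<lambda>\<zeta>. c * kernel0 \<zeta>) \<zeta> = c * ?g \<zeta>"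
    unfolding truncated_toeplitz_def model_proj_def[of \<Theta>, symmetric]
    using l2_proj_unique_AE[OF S(1) _ l2_perp_scale[OF g]] by (simp add: model_proj_def S(2))
qed

end

theorem theorem2:
  fixes \<Theta> \<phi> :: "complex \<Rightarrow> complex"
  assumes "inner_function \<Theta>" and "\<phi> \<in> L2"
  shows "ennreal
      (l2_norm (\<lambda>\<zeta>. model_proj \<Theta> \<phi> \<zeta> - cnj (\<Theta> 0) * model_proj \<Theta> (\<lambda>\<xi>. boundary_fun \<Theta> \<xi> * \<phi> \<xi>) \<zeta>)
        / sqrt (1 - (cmod (\<Theta> 0))\<^sup>2))
    \<le> truncated_toeplitz_norm \<Theta> \<phi>"
proof -
  let ?k = "kernel0 \<Theta>"
  let ?g = "\<lambda>\<zeta>. model_proj \<Theta> \<phi> \<zeta> - cnj (\<Theta> 0) * model_proj \<Theta> (\<lambda>\<xi>. boundary_fun \<Theta> \<xi> * \<phi> \<xi>) \<zeta>"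
  note inner = assms(1)
  have norm_k: "l2_norm ?k = sqrt (1 - (cmod (\<Theta> 0))\<^sup>2)"
    using kernel0_norm[OF inner] by (metis l2_norm_nonneg real_sqrt_unique)
  show ?thesis
  proof (cases "l2_norm ?k = 0")
    \<comment> \<open>Here |\<Theta>(0)| = 1; the denominator is 0, so the quotient is 0 and the
      bound is trivial.\<close>
    case True
    then show ?thesis by (simp add: norm_k[symmetric])
  next
    case False
    \<comment> \<open>Normalization: the supremum ranges over functions of norm exactly 1.\<close>
    define c where "c = complex_of_real (1 / l2_norm ?k)"
    let ?f = "\<lambda>\<zeta>. c * ?k \<zeta>"
    have c: "cmod c = 1 / l2_norm ?k" by (simp add: c_def norm_divide)
    have "?f \<in> model_space_inf \<Theta>"
    proof -
      obtain S where S: "S \<subseteq> L2" "model_space \<Theta> = l2_perp S" by (rule model_space_eq_l2_perp[OF inner])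
      obtain u where u: "u \<in> hardy_inf_disk" "has_boundary_values u ?k" using kernel0_inf[OF inner] by blast
      obtain B where B: "\<And>z. cmod z < 1 \<Longrightarrow> cmod (u z) \<le> B"
        using u(1) unfolding hardy_inf_disk_iff by blast
      have "(\<lambda>z. c * u z) \<in> hardy_inf_disk"
        using u(1) B by (auto simp: hardy_inf_disk_iff norm_mult
            intro!: holomorphic_intros exI[of _ "cmod c * B"] mult_left_mono)
      moreover have "has_boundary_values (\<lambda>z. c * u z) ?f"
        by (rule has_boundary_values_mult[OF has_boundary_values_const u(2)])
      moreover have "?f \<in> model_space \<Theta>"
        using kernel0_model_space_inf[OF inner] S l2_perp_scale by (auto simp: model_space_inf_def)
      ultimately show ?thesis by (auto simp: model_space_inf_def)
    qed
    moreover have "l2_norm ?f = 1"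
      unfolding l2_norm_scale c using False by simp
    ultimately have "ennreal (l2_norm (truncated_toeplitz \<Theta> \<phi> ?f)) \<le> truncated_toeplitz_norm \<Theta> \<phi>"
      unfolding truncated_toeplitz_norm_def by (intro SUP_upper) simp
    moreover have "l2_norm (truncated_toeplitz \<Theta> \<phi> ?f) = l2_norm (\<lambda>\<zeta>. c * ?g \<zeta>)"
    proof (rule sym, rule l2_norm_cong_AE)
      show "(\<lambda>\<zeta>. c * ?g \<zeta>) \<in> L2"
        by (rule L2_scale[OF truncated_toeplitz_kernel0(2)[OF assms]])
      show "AE \<zeta> in circle_measure. c * ?g \<zeta> = truncated_toeplitz \<Theta> \<phi> ?f \<zeta>"
        using truncated_toeplitz_kernel0(1)[OF assms, of c] by eventually_elim (rule sym)
    qed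
    moreover have "\<dots> = l2_norm ?g / sqrt (1 - (cmod (\<Theta> 0))\<^sup>2)"
      unfolding l2_norm_scale c norm_k by simp
    ultimately show ?thesis by simp
  qed
qed

end
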